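(* Let $F_{38}:=(6,\{01,02,03,04,15,45\})$. Then $\lambda_{F_{38}}=72/625$. Furthermore, the $F_{38}$-problem is perfectly $B$-stable with $B:=(5,\{01,12,23,34,40\})$, and the unique (up to automorphisms of $B$) maximiser of $p(F_{38},B(\boldsymbol x))$ over $\boldsymbol x\in\mathbb S_5$ is $\boldsymbol x=(1/5,1/5,1/5,1/5,1/5)$.
   Context: All graphs are finite and simple. $(m,E)$ denotes the graph or pattern with vertex set $\{0,\dots,m-1\}$ and edge set $E$; $ij$ abbreviates $\{i,j\}$ ($ii$ is a loop). For graphs $F,G$ with $\kappa\le n$ vertices, $p(F,G)$ is the number of $\kappa$-subsets of $V(G)$ inducing a subgraph isomorphic to $F$, divided by $\binom n\kappa$; $p(F,n)$ is the maximum of $p(F,G)$ over $n$-vertex graphs $G$; $\lambda_F=\lim_{n\to\infty}p(F,n)$ (the limit exists). A pattern is a graph in which loops are allowed; its automorphisms are the bijections of the vertex set preserving edges, non-edges, loops and non-loops. For a pattern $B$ on $\{0,\dots,m-1\}$ and disjoint (possibly empty) sets $V_0,\dots,V_{m-1}$, the blowup $B(V_0,\dots,V_{m-1})$ is the simple graph on $\bigcup V_i$ in which distinct $x\in V_i$, $y\in V_j$ are adjacent iff $\{i,j\}\in E(B)$ (so $V_i$ is a clique if $i$ has a loop and independent otherwise); $B()$ is the family of all blowups. $\mathbb S_m=\{\boldsymbol x\in\mathbb R^m:x_i\ge0,\sum x_i=1\}$, and $p(F,B(\boldsymbol x))$ is the limit as $n\to\infty$ of $p(F,B(V_0,\dots,V_{m-1}))$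 with $|V_i|=(x_i+o(1))n$. $\delta_{\mathrm{edit}}(G,B())$ is the minimum number of vertex pairs whose adjacency must be changed to turn $G$ into a graph isomorphic to a blowup of $B$ (of the same order). The $F$-problem is perfectly $B$-stable if there is $C>0$ such that every graph $G$ with $n\ge C$ vertices satisfies $\delta_{\mathrm{edit}}(G,B())\le C\,(p(F,n)-p(F,G))\,n^2$. *)

theory Defs
  imports Complex_Main "HOL-Library.Disjoint_Sets"
begin

text \<open>A pattern is a pair of a vertex set and an edge set; an edge is a set \<open>{i, j}\<close> of
  vertices, so a loop at \<open>i\<close> is the singleton \<open>{i, i} = {i}\<close>. Graphs are the loopless patterns.\<close>

type_synonym 'a pattern = "'a set \<times> 'a set set"

abbreviation verts :: "'a pattern \<Rightarrow> 'a set" where "verts \<equiv> fst"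
abbreviation edges :: "'a pattern \<Rightarrow> 'a set set" where "edges \<equiv> snd"

definition is_pattern :: "'a pattern \<Rightarrow> bool" where
  "is_pattern B \<longleftrightarrow> finite (verts B) \<and> edges B \<subseteq> {{x, y} |x y. x \<in> verts B \<and> y \<in> verts B}"

definition is_graph :: "'a pattern \<Rightarrow> bool" where
  "is_graph G \<longleftrightarrow> is_pattern G \<and> (\<forall>x. {x} \<notin> edges G)"

text \<open>The case \<open>x = y\<close> says that loops and non-loops are preserved.\<close>

definition is_iso :: "('a \<Rightarrow> 'b) \<Rightarrow> 'a pattern \<Rightarrow> 'b pattern \<Rightarrow> bool" where
  "is_iso f G H \<longleftrightarrow> bij_betw f (verts G) (verts H) \<and>
     (\<forall>x\<in>verts G. \<forall>y\<in>verts G. {x, y} \<in> edges G \<longleftrightarrow> {f x, f y} \<in> edges H)"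

definition isomorphic :: "'a pattern \<Rightarrow> 'b pattern \<Rightarrow> bool" where
  "isomorphic G H \<longleftrightarrow> (\<exists>f. is_iso f G H)"

definition automorphism :: "('a \<Rightarrow> 'a) \<Rightarrow> 'a pattern \<Rightarrow> bool" where
  "automorphism f B \<longleftrightarrow> is_iso f B B"

definition induced :: "'a pattern \<Rightarrow> 'a set \<Rightarrow> 'a pattern" where
  "induced G S = (S, {e \<in> edges G. e \<subseteq> S})"

text \<open>If \<open>G\<close> has fewer vertices than \<open>F\<close>, the density is \<open>0 / 0 = 0\<close>.\<close>

definition density :: "'a pattern \<Rightarrow> 'b pattern \<Rightarrow> real" where
  "density F G =
     real (card {S. S \<subseteq> verts G \<and> card S = card (verts F) \<and> isomorphic (induced G S) F})
       / real (card (verts G) choose card (verts F))"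

text \<open>Every finite graph is isomorphic to one with vertices in \<open>nat\<close>, so it suffices to let
  the graphs below range over that type.\<close>

definition max_density :: "'a pattern \<Rightarrow> nat \<Rightarrow> real" where
  "max_density F n = Max {density F G |G :: nat pattern. is_graph G \<and> card (verts G) = n}"

definition inducibility :: "'a pattern \<Rightarrow> real" where
  "inducibility F = lim (max_density F)"

definition blowup :: "'b pattern \<Rightarrow> ('b \<Rightarrow> 'a set) \<Rightarrow> 'a pattern" where
  "blowup B V = (\<Union>i\<in>verts B. V i,
     {{x, y} |x y i j. i \<in> verts B \<and> j \<in> verts B \<and> x \<in> V i \<and> y \<in> V j \<and> x \<noteq> y \<and> {i, j} \<in> edges B})"

definition blowup_parts :: "'b pattern \<Rightarrow> ('b \<Rightarrow> 'a set) \<Rightarrow> bool" where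
  "blowup_parts B V \<longleftrightarrow> disjoint_family_on V (verts B) \<and> (\<forall>i\<in>verts B. finite (V i))"

definition blowups :: "'b pattern \<Rightarrow> 'a pattern set" where
  "blowups B = {blowup B V |V. blowup_parts B V}"

text \<open>Vectors in \<open>\<real>\<^sup>m\<close> are functions vanishing outside \<open>{..<m}\<close>.\<close>

definition simplex :: "nat \<Rightarrow> (nat \<Rightarrow> real) set" where
  "simplex m = {x. (\<forall>i<m. 0 \<le> x i) \<and> (\<Sum>i<m. x i) = 1 \<and> (\<forall>i\<ge>m. x i = 0)}"

text \<open>The common limit of the densities of \<open>F\<close> along all sequences of blowups of \<open>B\<close>
  whose parts \<open>V n i\<close> have size \<open>(x i + o(1)) n\<close>.\<close>

definition limit_density :: "'a pattern \<Rightarrow> 'b pattern \<Rightarrow> ('b \<Rightarrow> real) \<Rightarrow> real" where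
  "limit_density F B x = (THE L. \<forall>V :: nat \<Rightarrow> 'b \<Rightarrow> nat set.
     (\<forall>n. blowup_parts B (V n)) \<longrightarrow>
     (\<forall>i\<in>verts B. (\<lambda>n. real (card (V n i)) / real n) \<longlonglongrightarrow> x i) \<longrightarrow>
     (\<lambda>n. density F (blowup B (V n))) \<longlonglongrightarrow> L)"

definition is_maximiser :: "nat \<Rightarrow> 'a pattern \<Rightarrow> nat pattern \<Rightarrow> (nat \<Rightarrow> real) \<Rightarrow> bool" where
  "is_maximiser m F B x \<longleftrightarrow>
     x \<in> simplex m \<and> (\<forall>y\<in>simplex m. limit_density F B y \<le> limit_density F B x)"

definition unique_maximiser :: "nat \<Rightarrow> 'a pattern \<Rightarrow> nat pattern \<Rightarrow> (nat \<Rightarrow> real) \<Rightarrow> bool" where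
  "unique_maximiser m F B u \<longleftrightarrow> is_maximiser m F B u \<and>
     (\<forall>x. is_maximiser m F B x \<longrightarrow> (\<exists>\<sigma>. automorphism \<sigma> B \<and> (\<forall>i\<in>verts B. x i = u (\<sigma> i))))"

definition edit_distance :: "'a pattern \<Rightarrow> 'b pattern \<Rightarrow> nat" where
  "edit_distance G B =
     Min {card ((edges G - edges H) \<union> (edges H - edges G)) |H.
       is_graph H \<and> verts H = verts G \<and> (\<exists>H' \<in> (blowups B :: 'a pattern set). isomorphic H H')}"

definition perfectly_stable :: "'a pattern \<Rightarrow> 'b pattern \<Rightarrow> bool" where
  "perfectly_stable F B \<longleftrightarrow> (\<exists>C::real. C > 0 \<and>
     (\<forall>G :: nat pattern. is_graph G \<longrightarrow> real (card (verts G)) \<ge> C \<longrightarrow>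
       real (edit_distance G B)
         \<le> C * (max_density F (card (verts G)) - density F G) * (real (card (verts G)))\<^sup>2))"

definition F38 :: "nat pattern" where
  "F38 = ({0..<6}, {{0,1}, {0,2}, {0,3}, {0,4}, {1,5}, {4,5}})"

definition C5 :: "nat pattern" where
  "C5 = ({0..<5}, {{0,1}, {1,2}, {2,3}, {3,4}, {4,0}})"

end

theory Submission
  imports Defs "HOL-Combinatorics.Multiset_Permutations"
begin

text \<open>Write \<open>F\<close> for the graph of the statement, and draw six vertices of a graph independently, with
repetition, each with probability proportional to a weight \<open>w\<close>. Let \<open>T\<close> be the weight of the ordered
draws that show exactly the labelled pattern \<open>F\<close>, and \<open>W\<close> the total weight of the vertices. In a
blowup of the pentagon with five parts of equal weight there are ten ways to place \<open>F\<close>, so that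
\<open>T = 10 (W/5)^6\<close>, that is, \<open>62500 T = 40 W^6\<close>. As \<open>F\<close> has four automorphisms, a density of \<open>F\<close> is
about \<open>720/4 = 180\<close> times the corresponding fraction of draws, and \<open>180 * 10/5^6 = 72/625\<close>. The heart of
the matter is that \<open>62500 T \<le> 40 W^6\<close> for every graph and all weights; because the draws allow repetition,
this is an exact inequality without error terms.

It is proved by the flag algebra method. A \<open>cost\<close> is attached to every ordered draw: \<open>62500\<close> if it
shows \<open>F\<close>, plus the value of one of three quadratic forms when its first vertices form an induced
path on four vertices, a non-edge, or an induced claw; the form is evaluated at the ways in which
the remaining vertices, split into two groups, see these first vertices (their flags). For paths there is a
further charge of \<open>18\<close> for misfits, which are explained below. Summed over
the remaining vertices, the value of a form becomes a quadratic form in the weights of the flags, and it is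
nonnegative because the three forms are sums of squares. On the other hand, the cost of a draw
averages to at most \<open>40\<close> over the \<open>720\<close> orders of its six vertices. This is a finite check over the
graphs on six vertices, \<open>cost_sum_le\<close>.

The certificate has room to spare, and this yields stability. In a blowup of the pentagon
every vertex sees a given induced path in one of five ways, according to its part; call a pair of
vertices a misfit for the path if it contradicts this picture. The certificate pays for every
misfit, and also for the differences between the weights of parts that are consecutive in the cyclic order.
So \<open>flag_inequality\<close> bounds \<open>62500 T\<close>, plus \<open>18\<close> times the weight of all paths together with a misfit for
them, plus the imbalance of the parts seen from each path. Applied to the weighted pentagon itself, it says
that the uniform weights are the unique maximiser.

For perfect stability, take a nearly extremal graph \<open>G\<close> and the induced path with the fewest
misfits. The way in which vertices see this path defines a blowup \<open>H\<close> of the pentagon on the same vertices, and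
\<open>G\<close> and \<open>H\<close> disagree only on misfits. By the imbalance term, \<open>H\<close> is almost balanced. Now choose
vertex weights, all close to \<open>1\<close>, that balance \<open>H\<close> perfectly. For these weights \<open>H\<close> attains the bound exactly,
while \<open>G\<close> falls short of it by a constant times the number of misfits times \<open>n^4\<close>, since every induced path has
at least as many misfits as the chosen one. Returning to unit weights and to injective draws changes the
difference between \<open>G\<close> and \<open>H\<close> only through draws that meet a disagreement, and hence only by a small
multiple of the same quantity. So \<open>H\<close> has at least constant times \<open>n^4\<close> more embeddings
of \<open>F\<close> per disagreement than \<open>G\<close> (\<open>near_extremal\<close>). A graph that is not nearly extremal is no issue,
as \<open>n^2\<close> edits always suffice.\<close>

section \<open>Six vertices, and how they see a path, a non-edge or a claw\<close>

text \<open>The six positions of a draw. A draw of vertices is a function from positions to vertices, so that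
permuting a draw is composition with a permutation of this finite type.\<close>

datatype ix = I0 | I1 | I2 | I3 | I4 | I5

lemma UNIV_ix: "UNIV = {I0, I1, I2, I3, I4, I5}"
  using ix.exhaust by auto

instance ix :: finite
  by standard (simp add: UNIV_ix)

text \<open>The vertices \<open>p0, ..., p5\<close> play the roles of the vertices \<open>0, ..., 5\<close> of the graph \<open>F38\<close>. The relation
is a parameter, so that the same predicate serves for graphs, for the pentagon, and for six-vertex
graphs on the type of positions.\<close>

definition F38_at :: "('a \<Rightarrow> 'a \<Rightarrow> bool) \<Rightarrow> 'a \<Rightarrow> 'a \<Rightarrow> 'a \<Rightarrow> 'a \<Rightarrow> 'a \<Rightarrow> 'a \<Rightarrow> bool" where
  "F38_at a p0 p1 p2 p3 p4 p5 \<longleftrightarrow>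
     a p0 p1 \<and> a p0 p2 \<and> a p0 p3 \<and> a p0 p4 \<and> a p1 p5 \<and> a p4 p5 \<and>
     \<not> a p0 p5 \<and> \<not> a p1 p2 \<and> \<not> a p1 p3 \<and> \<not> a p1 p4 \<and> \<not> a p2 p3 \<and> \<not> a p2 p4 \<and>
     \<not> a p2 p5 \<and> \<not> a p3 p4 \<and> \<not> a p3 p5"

definition path_at :: "('a \<Rightarrow> 'a \<Rightarrow> bool) \<Rightarrow> 'a \<Rightarrow> 'a \<Rightarrow> 'a \<Rightarrow> 'a \<Rightarrow> bool" where
  "path_at a p0 p1 p2 p3 \<longleftrightarrow>
     a p0 p1 \<and> a p1 p2 \<and> a p2 p3 \<and> \<not> a p0 p2 \<and> \<not> a p0 p3 \<and> \<not> a p1 p3"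

definition claw_at :: "('a \<Rightarrow> 'a \<Rightarrow> bool) \<Rightarrow> 'a \<Rightarrow> 'a \<Rightarrow> 'a \<Rightarrow> 'a \<Rightarrow> bool" where
  "claw_at a p0 p1 p2 p3 \<longleftrightarrow>
     a p0 p1 \<and> a p0 p2 \<and> a p0 p3 \<and> \<not> a p1 p2 \<and> \<not> a p1 p3 \<and> \<not> a p2 p3"

text \<open>How a vertex sees an induced path \<open>p0 p1 p2 p3\<close>. In a blowup of the pentagon the path runs through
four consecutive parts, and \<open>Part0, ..., Part4\<close> are the ways in which the vertices of the five parts
see it, in cyclic order. A vertex adjacent to none, or only to one end, of the path is \<open>Apart\<close>,
\<open>Tip0\<close> or \<open>Tip3\<close>. All other ways are merged into \<open>Stray\<close>, where the quadratic form vanishes.\<close>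

datatype pathflag = Part0 | Part1 | Part2 | Part3 | Part4 | Apart | Tip0 | Tip3 | Stray

fun path_flag :: "bool \<Rightarrow> bool \<Rightarrow> bool \<Rightarrow> bool \<Rightarrow> pathflag" where
  "path_flag False False False False = Apart"
| "path_flag False False False True = Tip3"
| "path_flag False False True False = Part3"
| "path_flag False False True True = Stray"
| "path_flag False True False False = Part0"
| "path_flag False True False True = Part2"
| "path_flag False True True False = Stray"
| "path_flag False True True True = Stray"
| "path_flag True False False False = Tip0"
| "path_flag True False False True = Part4"
| "path_flag True False True False = Part1"
| "path_flag True False True True = Stray"
| "path_flag True True False False = Stray"
| "path_flag True True False True = Stray"
| "path_flag True True True False = Stray"
| "path_flag True True True True = Stray"

text \<open>How two vertices \<open>x\<close> and \<open>y\<close> see a non-edge \<open>p0 p1\<close>. The letters describe \<open>x\<close> and \<open>y\<close>, in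
alphabetical order apart from \<open>N\<close> coming first: \<open>N\<close> for neither, \<open>A\<close> for only \<open>p0\<close>, \<open>B\<close> for only \<open>p1\<close>, \<open>D\<close> for
both. The digit says whether \<open>x\<close> and \<open>y\<close> are adjacent. The quadratic form vanishes when both
see both, so these two cases are merged.\<close>

datatype pairflag = NN0 | NN1 | NA0 | NA1 | NB0 | NB1 | ND0 | ND1 | AA0 | AA1 | AB0 | AB1 | AD0 | AD1 | BB0 | BB1 | BD0 | BD1 | BothBoth

fun pair_flag :: "bool \<Rightarrow> bool \<Rightarrow> bool \<Rightarrow> bool \<Rightarrow> bool \<Rightarrow> pairflag" where
  "pair_flag False False False False False = NN0"
| "pair_flag False False False False True = NN1"
| "pair_flag False False False True False = NB0"
| "pair_flag False False False True True = NB1"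
| "pair_flag False False True False False = NA0"
| "pair_flag False False True False True = NA1"
| "pair_flag False False True True False = ND0"
| "pair_flag False False True True True = ND1"
| "pair_flag False True False False False = NB0"
| "pair_flag False True False False True = NB1"
| "pair_flag False True False True False = BB0"
| "pair_flag False True False True True = BB1"
| "pair_flag False True True False False = AB0"
| "pair_flag False True True False True = AB1"
| "pair_flag False True True True False = BD0"
| "pair_flag False True True True True = BD1"
| "pair_flag True False False False False = NA0"
| "pair_flag True False False False True = NA1"
| "pair_flag True False False True False = AB0"
| "pair_flag True False False True True = AB1"
| "pair_flag True False True False False = AA0"
| "pair_flag True False True False True = AA1"
| "pair_flag True False True True False = AD0"
| "pair_flag True False True True True = AD1"
| "pair_flag True True False False False = ND0"
| "pair_flag True True False False True = ND1"
| "pair_flag True True False True False = BD0"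
| "pair_flag True True False True True = BD1"
| "pair_flag True True True False False = AD0"
| "pair_flag True True True False True = AD1"
| "pair_flag True True True True False = BothBoth"
| "pair_flag True True True True True = BothBoth"

text \<open>How a vertex sees an induced claw with centre \<open>p0\<close>: \<open>T\<close> if it is adjacent to the centre and \<open>S\<close>
if not, followed by the number of adjacent leaves. The quadratic form vanishes when exactly one leaf is
adjacent.\<close>

datatype clawflag = S0 | S2 | S3 | T0 | T2 | T3 | SRest

fun claw_flag :: "bool \<Rightarrow> bool \<Rightarrow> bool \<Rightarrow> bool \<Rightarrow> clawflag" where
  "claw_flag False False False False = S0"
| "claw_flag False False False True = SRest"
| "claw_flag False False True False = SRest"
| "claw_flag False False True True = S2"
| "claw_flag False True False False = SRest"
| "claw_flag False True False True = S2"
| "claw_flag False True True False = S2"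
| "claw_flag False True True True = S3"
| "claw_flag True False False False = T0"
| "claw_flag True False False True = SRest"
| "claw_flag True False True False = SRest"
| "claw_flag True False True True = T2"
| "claw_flag True True False False = SRest"
| "claw_flag True True False True = T2"
| "claw_flag True True True False = T2"
| "claw_flag True True True True = T3"

definition pair_at :: "('a \<Rightarrow> 'a \<Rightarrow> bool) \<Rightarrow> 'a \<Rightarrow> 'a \<Rightarrow> 'a \<Rightarrow> 'a \<Rightarrow> pairflag" where
  "pair_at a p0 p1 x y = pair_flag (a x p0) (a x p1) (a y p0) (a y p1) (a x y)"

section \<open>The certificate\<close>

text \<open>The three forms solve a semidefinite program: together with \<open>62500\<close> for each copy of \<open>F38\<close> they have to
keep the average cost of every six-vertex graph at \<open>40\<close> or less. Equality is forced for the graphs that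
occur in blowups of the pentagon, and this forces the flag weights seen in the balanced blowup into
the kernels of the forms. The numerical solution was rounded to a nearby point of the lattice of
integer solutions of these equations.\<close>

primrec path_form :: "pathflag \<Rightarrow> pathflag \<Rightarrow> int" where
  "path_form Part0 = case_pathflag 7036 1018 (-8192) (-860) 998 1516 2526 (-2526) 0"
| "path_form Part1 = case_pathflag 1018 9628 (-1140) (-8192) (-1314) (-1308) 3011 (-3011) 0"
| "path_form Part2 = case_pathflag (-8192) (-1140) 9628 1018 (-1314) (-1308) (-3011) 3011 0"
| "path_form Part3 = case_pathflag (-860) (-8192) 1018 7036 998 1516 (-2526) 2526 0"
| "path_form Part4 = case_pathflag 998 (-1314) (-1314) 998 632 (-416) 0 0 0"
| "path_form Apart = case_pathflag 1516 (-1308) (-1308) 1516 (-416) 3624 0 0 0"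
| "path_form Tip0 = case_pathflag 2526 3011 (-3011) (-2526) 0 0 3857 (-3857) 0"
| "path_form Tip3 = case_pathflag (-2526) (-3011) 3011 2526 0 0 (-3857) 3857 0"
| "path_form Stray = case_pathflag 0 0 0 0 0 0 0 0 0"

primrec pair_form :: "pairflag \<Rightarrow> pairflag \<Rightarrow> int" where
  "pair_form NN0 = case_pairflag 40 4 54 (-32) 54 (-32) 40 (-56) 106 (-58) (-8) (-186) 34 (-62) 106 (-58) 34 (-62) 0"
| "pair_form NN1 = case_pairflag 4 974 (-143) 456 (-143) 456 478 (-486) (-373) 57 (-160) 313 199 (-55) (-373) 57 199 (-55) 0"
| "pair_form NA0 = case_pairflag 54 (-143) 127 (-162) 127 (-162) (-31) 4 254 (-112) 20 (-350) 25 (-101) 254 (-112) 25 (-101) 0"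
| "pair_form NA1 = case_pairflag (-32) 456 (-162) 709 (-162) 149 318 (-245) (-108) 117 (-112) 306 (-89) 12 (-636) 117 175 12 0"
| "pair_form NB0 = case_pairflag 54 (-143) 127 (-162) 127 (-162) (-31) 4 254 (-112) 20 (-350) 25 (-101) 254 (-112) 25 (-101) 0"
| "pair_form NB1 = case_pairflag (-32) 456 (-162) 149 (-162) 709 318 (-245) (-636) 117 (-112) 306 175 12 (-108) 117 (-89) 12 0"
| "pair_form ND0 = case_pairflag 40 478 (-31) 318 (-31) 318 389 (-349) (-149) (-11) (-120) (-57) 125 (-140) (-149) (-11) 125 (-140) 0"
| "pair_form ND1 = case_pairflag (-56) (-486) 4 (-245) 4 (-245) (-349) 345 75 42 107 113 (-142) 138 75 42 (-142) 138 0"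
| "pair_form AA0 = case_pairflag 106 (-373) 254 (-108) 254 (-636) (-149) 75 1020 (-272) 61 (-841) (-152) (-36) 522 (-272) 96 (-36) 0"
| "pair_form AA1 = case_pairflag (-58) 57 (-112) 117 (-112) 117 (-11) 42 (-272) 120 (-5) 356 (-31) 75 (-272) 120 (-31) 75 0"
| "pair_form AB0 = case_pairflag (-8) (-160) 20 (-112) 20 (-112) (-120) 107 61 (-5) 40 (-5) (-35) 31 61 (-5) (-35) 31 0"
| "pair_form AB1 = case_pairflag (-186) 313 (-350) 306 (-350) 306 (-57) 113 (-841) 356 (-5) 1207 (-66) 254 (-841) 356 (-66) 254 0"
| "pair_form AD0 = case_pairflag 34 199 25 (-89) 25 175 125 (-142) (-152) (-31) (-35) (-66) 152 (-96) 96 (-31) 22 (-96) 0"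
| "pair_form AD1 = case_pairflag (-62) (-55) (-101) 12 (-101) 12 (-140) 138 (-36) 75 31 254 (-96) 225 (-36) 75 (-96) 225 0"
| "pair_form BB0 = case_pairflag 106 (-373) 254 (-636) 254 (-108) (-149) 75 522 (-272) 61 (-841) 96 (-36) 1020 (-272) (-152) (-36) 0"
| "pair_form BB1 = case_pairflag (-58) 57 (-112) 117 (-112) 117 (-11) 42 (-272) 120 (-5) 356 (-31) 75 (-272) 120 (-31) 75 0"
| "pair_form BD0 = case_pairflag 34 199 25 175 25 (-89) 125 (-142) 96 (-31) (-35) (-66) 22 (-96) (-152) (-31) 152 (-96) 0"
| "pair_form BD1 = case_pairflag (-62) (-55) (-101) 12 (-101) 12 (-140) 138 (-36) 75 31 254 (-96) 225 (-36) 75 (-96) 225 0"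
| "pair_form BothBoth = case_pairflag 0 0 0 0 0 0 0 0 0 0 0 0 0 0 0 0 0 0 0"

primrec claw_form :: "clawflag \<Rightarrow> clawflag \<Rightarrow> int" where
  "claw_form S0 = case_clawflag 336 316 (-20) (-148) (-550) (-22) 0"
| "claw_form S2 = case_clawflag 316 696 380 (-538) (-527) 381 0"
| "claw_form S3 = case_clawflag (-20) 380 400 (-390) 23 403 0"
| "claw_form T0 = case_clawflag (-148) (-538) (-390) 464 252 (-392) 0"
| "claw_form T2 = case_clawflag (-550) (-527) 23 252 936 36 0"
| "claw_form T3 = case_clawflag (-22) 381 403 (-392) 36 413 0"
| "claw_form SRest = case_clawflag 0 0 0 0 0 0 0"

text \<open>The next three lists diagonalise the forms by symmetric Gaussian elimination, separately on the parts that are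
symmetric and antisymmetric under reversing the path or exchanging the ends of the non-edge. An
entry \<open>(d, l)\<close> stands for the square \<open>d * l\<^sup>2\<close> of the linear form with coefficients \<open>l\<close>. From the
path form the imbalance form below has been split off first.\<close>

definition path_squares :: "(real \<times> (pathflag \<Rightarrow> real)) list" where
  "path_squares =
    [(2/453, case_pathflag 379 (-327) (-327) 379 (-104) 906 0 0 0),
     (1/2013365748, case_pathflag 2222258 (-2753637) (-2753637) 2222258 1062758 0 0 0 0),
     (23632497/4444516, case_pathflag 0 1 1 0 (-2) 0 0 0 0),
     (1/15788, case_pathflag 7894 9211 (-9211) (-7894) 0 0 5052 (-5052) 0),
     (1/34902938141, case_pathflag 0 (-250924) 250924 0 0 0 (-8842903) 8842903 0),
     (241759129/35371612, case_pathflag 0 (-1) 1 0 0 0 0 0 0)]"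

definition pair_squares :: "(real \<times> (pairflag \<Rightarrow> real)) list" where
  "pair_squares =
    [(1/10, case_pairflag 20 2 27 (-16) 27 (-16) 20 (-28) 53 (-29) (-4) (-93) 17 (-31) 53 (-29) 17 (-31) 0),
     (1/5410, case_pairflag 0 (-1484) 541 (-1188) 541 (-1188) (-850) 796 1109 (-337) 308 (-989) (-209) (-173) 1109 (-337) (-209) (-173) 0),
     (1/41713805, case_pairflag 0 72128 0 77105 0 77105 88370 (-62217) (-23626) (-1841) (-27464) (-32448) 13149 (-40894) (-23626) (-1841) 13149 (-40894) 0),
     (1/6715830079, case_pairflag 0 1357622 0 0 0 0 435499 (-557155) (-473526) (-31584) (-83676) 653116 467360 (-286027) (-473526) (-31584) 467360 (-286027) 0),
     (1/49597193386605, case_pairflag 0 (-91108716) 0 0 0 0 0 22777179 (-31128843) 10927387 5612353 8498851 (-11462183) (-17570457) (-31128843) 10927387 (-11462183) (-17570457) 0),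
     (1/11324742751583135, case_pairflag 0 0 0 0 0 0 0 0 1491590695 (-346436260) 8581612 (-853062085) (-319264305) 830656883 1491590695 (-346436260) (-319264305) 830656883 0),
     (1/1339478207012409891, case_pairflag 0 0 0 0 0 0 0 0 0 1496699923 5660260 (-1464093254) 732046627 407532846 0 1496699923 732046627 407532846 0),
     (1/61537761070797948035, case_pairflag 0 0 0 0 0 0 0 0 0 0 8223126109 4267780120 (-2133890060) (-5101962024) 0 0 (-2133890060) (-5101962024) 0),
     (1/83404859234238114980, case_pairflag 0 0 0 0 0 0 0 0 0 0 0 (-20285438440) 10142719220 14550555961 0 0 10142719220 14550555961 0),
     (8701707351/10142719220, case_pairflag 0 0 0 0 0 0 0 0 0 0 0 0 0 1 0 0 0 1 0),
     (2/35, case_pairflag 0 0 0 70 0 (-70) 0 0 66 0 0 0 (-33) 0 (-66) 0 33 0 0),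
     (1/105, case_pairflag 0 0 0 0 0 0 0 0 3 0 0 0 16 0 (-3) 0 (-16) 0 0),
     (1/3, case_pairflag 0 0 0 0 0 0 0 0 0 0 0 0 1 0 0 0 (-1) 0 0)]"

definition claw_squares :: "(real \<times> (clawflag \<Rightarrow> real)) list" where
  "claw_squares =
    [(1/400, case_clawflag (-20) 380 400 (-390) 23 403 0),
     (1/134000, case_clawflag (-6700) (-6700) 0 3350 10977 37 0),
     (1/621877250, case_clawflag 0 0 0 0 148508 41023 0),
     (316407/74254, case_clawflag 0 0 0 0 0 1 0)]"

definition sum_squares :: "(real \<times> ('f \<Rightarrow> real)) list \<Rightarrow> 'f \<Rightarrow> 'f \<Rightarrow> real" where
  "sum_squares sq f g = (\<Sum>(d, l)\<leftarrow>sq. d * l f * l g)"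

text \<open>The Laplacian of the pentagon: the sum of the squared differences of the weights of cyclically consecutive
parts. That the path form still is a sum of squares after subtracting it makes the uniform weights the only
maximiser and gives the balance of nearly extremal graphs.\<close>

definition imbalance_form :: "pathflag \<Rightarrow> pathflag \<Rightarrow> real" where
  "imbalance_form f g = sum_squares
     [(1, case_pathflag 1 (-1) 0 0 0 0 0 0 0), (1, case_pathflag 0 1 (-1) 0 0 0 0 0 0),
      (1, case_pathflag 0 0 1 (-1) 0 0 0 0 0), (1, case_pathflag 0 0 0 1 (-1) 0 0 0 0),
      (1, case_pathflag (-1) 0 0 0 1 0 0 0 0)] f g"

lemma path_form_squares:
  "real_of_int (path_form f g) = imbalance_form f g + sum_squares path_squares f g"
  by (cases f; cases g; simp add: imbalance_form_def sum_squares_def path_squares_def)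

lemma claw_form_squares: "real_of_int (claw_form f g) = sum_squares claw_squares f g"
  by (cases f; cases g; simp add: sum_squares_def claw_squares_def)

lemma pair_form_squares: "real_of_int (pair_form f g) = sum_squares pair_squares f g"
  by (cases f; cases g; simp add: sum_squares_def pair_squares_def)

section \<open>The cost of a six-vertex graph\<close>

text \<open>Two vertices, with their views of an induced path and their adjacency, that cannot both be
placed in a blowup of the pentagon extending the path.\<close>

primrec misfit :: "pathflag \<Rightarrow> pathflag \<Rightarrow> bool \<Rightarrow> bool" where
  "misfit Part0 = case_pathflag (\<lambda>e. e) Not (\<lambda>e. e) (\<lambda>e. e) Not (\<lambda>_. True) (\<lambda>_. True) (\<lambda>_. True) (\<lambda>_. True)"
| "misfit Part1 = case_pathflag Not (\<lambda>e. e) Not (\<lambda>e. e) (\<lambda>e. e) (\<lambda>_. True) (\<lambda>_. True) (\<lambda>_. True) (\<lambda>_. True)"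
| "misfit Part2 = case_pathflag (\<lambda>e. e) Not (\<lambda>e. e) Not (\<lambda>e. e) (\<lambda>_. True) (\<lambda>_. True) (\<lambda>_. True) (\<lambda>_. True)"
| "misfit Part3 = case_pathflag (\<lambda>e. e) (\<lambda>e. e) Not (\<lambda>e. e) Not (\<lambda>_. True) (\<lambda>_. True) (\<lambda>_. True) (\<lambda>_. True)"
| "misfit Part4 = case_pathflag Not (\<lambda>e. e) (\<lambda>e. e) Not (\<lambda>e. e) (\<lambda>_. True) (\<lambda>_. True) (\<lambda>_. True) (\<lambda>_. True)"
| "misfit Apart = (\<lambda>_ _. True)"
| "misfit Tip0 = (\<lambda>_ _. True)"
| "misfit Tip3 = (\<lambda>_ _. True)"
| "misfit Stray = (\<lambda>_ _. True)"

text \<open>The weight \<open>18\<close> of a misfit is the largest integer for which the bound on the cost stays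
true: graphs that do not occur in blowups of the pentagon leave that much slack in the certificate.\<close>

definition path_weight :: "pathflag \<Rightarrow> pathflag \<Rightarrow> bool \<Rightarrow> int" where
  "path_weight f g e = (if misfit f g e then path_form f g + 18 else path_form f g)"

definition copy_cost :: "('a \<Rightarrow> 'a \<Rightarrow> bool) \<Rightarrow> 'a \<Rightarrow> 'a \<Rightarrow> 'a \<Rightarrow> 'a \<Rightarrow> 'a \<Rightarrow> 'a \<Rightarrow> int" where
  "copy_cost a p0 p1 p2 p3 p4 p5 = (if F38_at a p0 p1 p2 p3 p4 p5 then 62500 else 0)"

definition path_cost :: "('a \<Rightarrow> 'a \<Rightarrow> bool) \<Rightarrow> 'a \<Rightarrow> 'a \<Rightarrow> 'a \<Rightarrow> 'a \<Rightarrow> 'a \<Rightarrow> 'a \<Rightarrow> int" where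
  "path_cost a p0 p1 p2 p3 p4 p5 = (if path_at a p0 p1 p2 p3
     then path_weight (path_flag (a p4 p0) (a p4 p1) (a p4 p2) (a p4 p3))
       (path_flag (a p5 p0) (a p5 p1) (a p5 p2) (a p5 p3)) (a p4 p5)
     else 0)"

definition claw_cost :: "('a \<Rightarrow> 'a \<Rightarrow> bool) \<Rightarrow> 'a \<Rightarrow> 'a \<Rightarrow> 'a \<Rightarrow> 'a \<Rightarrow> 'a \<Rightarrow> 'a \<Rightarrow> int" where
  "claw_cost a p0 p1 p2 p3 p4 p5 = (if claw_at a p0 p1 p2 p3
     then claw_form (claw_flag (a p4 p0) (a p4 p1) (a p4 p2) (a p4 p3))
       (claw_flag (a p5 p0) (a p5 p1) (a p5 p2) (a p5 p3))
     else 0)"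

definition pair_cost :: "('a \<Rightarrow> 'a \<Rightarrow> bool) \<Rightarrow> 'a \<Rightarrow> 'a \<Rightarrow> 'a \<Rightarrow> 'a \<Rightarrow> 'a \<Rightarrow> 'a \<Rightarrow> int" where
  "pair_cost a p0 p1 p2 p3 p4 p5 = (if a p0 p1 then 0
     else pair_form (pair_at a p0 p1 p2 p3) (pair_at a p0 p1 p4 p5))"

definition cost :: "('a \<Rightarrow> 'a \<Rightarrow> bool) \<Rightarrow> 'a \<Rightarrow> 'a \<Rightarrow> 'a \<Rightarrow> 'a \<Rightarrow> 'a \<Rightarrow> 'a \<Rightarrow> int" where
  "cost a p0 p1 p2 p3 p4 p5 = copy_cost a p0 p1 p2 p3 p4 p5 + path_cost a p0 p1 p2 p3 p4 p5
     + claw_cost a p0 p1 p2 p3 p4 p5 + pair_cost a p0 p1 p2 p3 p4 p5"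

definition cost_sum :: "(ix \<Rightarrow> ix \<Rightarrow> bool) \<Rightarrow> int" where
  "cost_sum a = (\<Sum>\<pi> | \<pi> permutes UNIV. cost a (\<pi> I0) (\<pi> I1) (\<pi> I2) (\<pi> I3) (\<pi> I4) (\<pi> I5))"

section \<open>Evaluating the cost by early pruning\<close>

text \<open>Sums over the choice of one element of \<open>xs\<close>, handing the elements that remain to the summand. Nested
choices enumerate all arrangements, and a test that fails after the first choices cuts off all
arrangements that start with them. The recursion keeps the skipped elements in \<open>ys\<close>.\<close>

primrec pick :: "('a \<Rightarrow> 'a list \<Rightarrow> int) \<Rightarrow> 'a list \<Rightarrow> 'a list \<Rightarrow> int" where
  "pick f ys [] = 0"
| "pick f ys (x # xs) = f x (ys @ xs) + pick f (ys @ [x]) xs"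

lemma pick_eq_sum:
  "distinct (ys @ xs) \<Longrightarrow> pick f ys xs = (\<Sum>x\<in>set xs. f x (remove1 x (ys @ xs)))"
proof (induction xs arbitrary: ys)
  case (Cons x xs)
  have "remove1 y ((ys @ [x]) @ xs) = remove1 y (ys @ x # xs)" for y by simp
  moreover have "remove1 x (ys @ x # xs) = ys @ xs"
    using Cons.prems by (simp add: remove1_append)
  ultimately show ?case using Cons.prems Cons.IH[of "ys @ [x]"] by (simp add: Cons.prems)
qed simp

lemma pick_cong:
  "(\<And>x r. Suc (length r) = length ys + length xs \<Longrightarrow> f x r = g x r) \<Longrightarrow> pick f ys xs = pick g ys xs"
proof (induction xs arbitrary: ys)
  case (Cons x xs)
  then show ?case using Cons.IH[of "ys @ [x]"] by simp
qed simp

lemma pick_zero: "pick (\<lambda>x r. 0) ys = (\<lambda>xs. 0)"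
proof
  show "pick (\<lambda>x r. 0) ys xs = 0" for xs by (induction xs arbitrary: ys) auto
qed

text \<open>The rule that moves a test out of the choices that it does not depend on. It is stated for the partial
application because nested choices occur in this eta-contracted form.\<close>

lemma pick_if:
  "pick (\<lambda>x r. if c then f x r else g x r) ys = (\<lambda>xs. if c then pick f ys xs else pick g ys xs)"
  by auto

text \<open>Choosing \<open>k\<close> elements one after the other; this form allows induction on \<open>k\<close>.\<close>

primrec nest :: "nat \<Rightarrow> ('a list \<Rightarrow> int) \<Rightarrow> 'a list \<Rightarrow> int" where
  "nest 0 F r = F []"
| "nest (Suc k) F r = pick (\<lambda>p r. nest k (\<lambda>ps. F (p # ps)) r) [] r"

lemma nest_eq_sum:
  "distinct r \<Longrightarrow> length r = k \<Longrightarrow> nest k F r = (\<Sum>ps\<in>permutations_of_set (set r). F ps)"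
proof (induction k arbitrary: F r)
  case (Suc k)
  have ne: "set r \<noteq> {}" using Suc.prems by auto
  have "nest (Suc k) F r = (\<Sum>p\<in>set r. nest k (\<lambda>ps. F (p # ps)) (remove1 p r))"
    using Suc.prems by (simp add: pick_eq_sum)
  also have "\<dots> = (\<Sum>p\<in>set r. \<Sum>ps\<in>permutations_of_set (set r - {p}). F (p # ps))"
  proof (rule sum.cong)
    fix p assume p: "p \<in> set r"
    have "nest k (\<lambda>ps. F (p # ps)) (remove1 p r) = (\<Sum>ps\<in>permutations_of_set (set (remove1 p r)). F (p # ps))"
      using Suc.prems p by (intro Suc.IH) (auto simp: length_remove1)
    then show "nest k (\<lambda>ps. F (p # ps)) (remove1 p r) = (\<Sum>ps\<in>permutations_of_set (set r - {p}). F (p # ps))"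
      using Suc.prems by (simp add: set_remove1_eq)
  qed simp
  also have "\<dots> = (\<Sum>p\<in>set r. sum F ((#) p ` permutations_of_set (set r - {p})))"
    by (subst sum.reindex) (auto simp: inj_on_def)
  also have "\<dots> = sum F (\<Union>p\<in>set r. (#) p ` permutations_of_set (set r - {p}))"
    by (rule sum.UNION_disjoint[symmetric]) auto
  also have "(\<Union>p\<in>set r. (#) p ` permutations_of_set (set r - {p})) = permutations_of_set (set r)"
    using permutations_of_set_nonempty[OF ne] by simp
  finally show ?case .
qed simp

lemma sum_permutations_nest:
  fixes F :: "ix list \<Rightarrow> int"
  shows "(\<Sum>\<pi> | \<pi> permutes UNIV. F (map \<pi> [I0, I1, I2, I3, I4, I5])) = nest 6 F [I0, I1, I2, I3, I4, I5]"
proof -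
  define U where "U = [I0, I1, I2, I3, I4, I5]"
  have U: "set U = UNIV" "distinct U" "length U = 6" by (auto simp: U_def UNIV_ix)
  have six: "\<exists>a b c d e f. ps = [a, b, c, d, e, f]" if "ps \<in> permutations_of_set (UNIV :: ix set)" for ps
  proof -
    have "length ps = 6"
      using that U by (metis permutations_of_setD distinct_card)
    then show ?thesis
      by (auto simp: numeral_eq_Suc length_Suc_conv)
  qed
  have "(\<Sum>\<pi> | \<pi> permutes UNIV. F (map \<pi> U)) = (\<Sum>ps\<in>permutations_of_set UNIV. F ps)"
  proof (rule sum.reindex_bij_witness[where j = "\<lambda>\<pi>. map \<pi> U"
        and i = "\<lambda>ps. case_ix (ps ! 0) (ps ! 1) (ps ! 2) (ps ! 3) (ps ! 4) (ps ! 5)"])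
    fix \<pi> :: "ix \<Rightarrow> ix" assume "\<pi> \<in> {\<pi>. \<pi> permutes UNIV}"
    then have b: "bij \<pi>" by (simp add: permutes_univ bij_iff)
    show "(\<lambda>ps. case_ix (ps ! 0) (ps ! 1) (ps ! 2) (ps ! 3) (ps ! 4) (ps ! 5)) (map \<pi> U) = \<pi>"
    proof
      show "(\<lambda>ps. case_ix (ps ! 0) (ps ! 1) (ps ! 2) (ps ! 3) (ps ! 4) (ps ! 5)) (map \<pi> U) i = \<pi> i" for i
        by (cases i) (simp_all add: U_def)
    qed
    show "map \<pi> U \<in> permutations_of_set UNIV"
      using b U by (auto simp: permutations_of_set_def distinct_map bij_def intro: inj_on_subset)
  next
    fix ps :: "ix list" assume ps: "ps \<in> permutations_of_set UNIV"
    then obtain a b c d e f where abc: "ps = [a, b, c, d, e, f]" using six by blast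
    show *: "map (case_ix (ps ! 0) (ps ! 1) (ps ! 2) (ps ! 3) (ps ! 4) (ps ! 5)) U = ps"
      by (simp add: abc U_def)
    let ?p = "case_ix (ps ! 0) (ps ! 1) (ps ! 2) (ps ! 3) (ps ! 4) (ps ! 5)"
    have "range ?p = UNIV"
      using ps * U by (metis permutations_of_setD(1) set_map)
    then have "bij ?p"
      using finite_UNIV_surj_inj[of ?p] by (simp only: bij_def finite_class.finite_UNIV)
    then show "?p \<in> {\<pi>. \<pi> permutes UNIV}"
      by (intro CollectI bij_imp_permutes) simp_all
  qed simp
  also have "\<dots> = nest 6 F U"
    using nest_eq_sum[OF U(2,3)] U(1) by simp
  finally show ?thesis by (simp add: U_def)
qed

lemma sum_permutations_pick:
  fixes f :: "ix \<Rightarrow> ix \<Rightarrow> ix \<Rightarrow> ix \<Rightarrow> ix \<Rightarrow> ix \<Rightarrow> int"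
  shows "(\<Sum>\<pi> | \<pi> permutes UNIV. f (\<pi> I0) (\<pi> I1) (\<pi> I2) (\<pi> I3) (\<pi> I4) (\<pi> I5)) =
    pick (\<lambda>p0 r. pick (\<lambda>p1 r. pick (\<lambda>p2 r. pick (\<lambda>p3 r. pick (\<lambda>p4 r. pick (\<lambda>p5 r.
      f p0 p1 p2 p3 p4 p5) [] r) [] r) [] r) [] r) [] r) [] [I0, I1, I2, I3, I4, I5]"
  using sum_permutations_nest[of "\<lambda>ps. f (ps ! 0) (ps ! 1) (ps ! 2) (ps ! 3) (ps ! 4) (ps ! 5)"]
  by (simp add: eval_nat_numeral del: pick.simps)

text \<open>The following functions are the four parts of \<open>cost_sum\<close> with every test placed at the earliest
choice at which it can be made.\<close>

definition F38_count :: "(ix \<Rightarrow> ix \<Rightarrow> bool) \<Rightarrow> int" where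
  "F38_count a =
    pick (\<lambda>p0 r. pick (\<lambda>p1 r. (if a p0 p1 then
    pick (\<lambda>p2 r. (if a p0 p2 then (if a p1 p2 then 0 else
    pick (\<lambda>p3 r. (if a p0 p3 then (if a p1 p3 then 0 else (if a p2 p3 then 0 else
    pick (\<lambda>p4 r. (if a p0 p4 then (if a p1 p4 then 0 else (if a p2 p4 then 0 else (if a p3 p4 then 0 else
    pick (\<lambda>p5 r. (if a p1 p5 then (if a p4 p5 then (if a p0 p5 then 0 else (if a p2 p5 then 0 else
      (if a p3 p5 then 0 else 62500))) else 0) else 0))
    [] r))) else 0)) [] r)) else 0)) [] r) else 0)) [] r else 0)) [] r) [] [I0, I1, I2, I3, I4, I5]"

definition path_count :: "(ix \<Rightarrow> ix \<Rightarrow> bool) \<Rightarrow> int" where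
  "path_count a =
    pick (\<lambda>p0 r. pick (\<lambda>p1 r. (if a p0 p1 then
    pick (\<lambda>p2 r. (if a p1 p2 then (if a p0 p2 then 0 else
    pick (\<lambda>p3 r. (if a p2 p3 then (if a p0 p3 then 0 else (if a p1 p3 then 0 else
    pick (\<lambda>p4 r. pick (\<lambda>p5 r. path_weight
      (path_flag (a p4 p0) (a p4 p1) (a p4 p2) (a p4 p3))
      (path_flag (a p5 p0) (a p5 p1) (a p5 p2) (a p5 p3)) (a p4 p5))
    [] r) [] r)) else 0)) [] r) else 0)) [] r else 0)) [] r) [] [I0, I1, I2, I3, I4, I5]"

definition claw_count :: "(ix \<Rightarrow> ix \<Rightarrow> bool) \<Rightarrow> int" where
  "claw_count a =
    pick (\<lambda>p0 r. pick (\<lambda>p1 r. (if a p0 p1 then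
    pick (\<lambda>p2 r. (if a p0 p2 then (if a p1 p2 then 0 else
    pick (\<lambda>p3 r. (if a p0 p3 then (if a p1 p3 then 0 else (if a p2 p3 then 0 else
    pick (\<lambda>p4 r. pick (\<lambda>p5 r. claw_form
      (claw_flag (a p4 p0) (a p4 p1) (a p4 p2) (a p4 p3))
      (claw_flag (a p5 p0) (a p5 p1) (a p5 p2) (a p5 p3)))
    [] r) [] r)) else 0)) [] r) else 0)) [] r else 0)) [] r) [] [I0, I1, I2, I3, I4, I5]"

text \<open>The \<open>24\<close> ways to arrange four vertices in two pairs give only three values, one for each partition into
pairs.\<close>

fun pairings :: "('a \<Rightarrow> 'a \<Rightarrow> pairflag) \<Rightarrow> 'a list \<Rightarrow> int" where
  "pairings h [x, y, z, w] =
    8 * (pair_form (h x y) (h z w) + (pair_form (h x z) (h y w) + pair_form (h x w) (h y z)))"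
| "pairings h _ = 0"

definition pair_count :: "(ix \<Rightarrow> ix \<Rightarrow> bool) \<Rightarrow> int" where
  "pair_count a =
    pick (\<lambda>p0 r. pick (\<lambda>p1 r. if a p0 p1 then 0 else pairings (pair_at a p0 p1) r) [] r) [] [I0, I1, I2, I3, I4, I5]"

lemma sum_copy_cost:
  "(\<Sum>\<pi> | \<pi> permutes UNIV. copy_cost a (\<pi> I0) (\<pi> I1) (\<pi> I2) (\<pi> I3) (\<pi> I4) (\<pi> I5))
     = F38_count a"
proof -
  have "copy_cost a p0 p1 p2 p3 p4 p5 =
    (if a p0 p1 then if a p0 p2 then if a p1 p2 then 0 else if a p0 p3 then if a p1 p3 then 0 else if a p2 p3 then 0
      else if a p0 p4 then if a p1 p4 then 0 else if a p2 p4 then 0 else if a p3 p4 then 0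
      else if a p1 p5 then if a p4 p5 then if a p0 p5 then 0 else if a p2 p5 then 0 else if a p3 p5 then 0
      else 62500 else 0 else 0 else 0 else 0 else 0 else 0)" for p0 p1 p2 p3 p4 p5
    by (simp add: copy_cost_def F38_at_def)
  then show ?thesis
    unfolding sum_permutations_pick F38_count_def by (simp only: pick_if pick_zero)
qed

lemma sum_path_cost:
  "(\<Sum>\<pi> | \<pi> permutes UNIV. path_cost a (\<pi> I0) (\<pi> I1) (\<pi> I2) (\<pi> I3) (\<pi> I4) (\<pi> I5)) = path_count a"
proof -
  have "path_cost a p0 p1 p2 p3 p4 p5 =
    (if a p0 p1 then if a p1 p2 then if a p0 p2 then 0 else if a p2 p3 then if a p0 p3 then 0 else if a p1 p3 then 0
      else path_weight (path_flag (a p4 p0) (a p4 p1) (a p4 p2) (a p4 p3))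
       (path_flag (a p5 p0) (a p5 p1) (a p5 p2) (a p5 p3)) (a p4 p5) else 0 else 0 else 0)" for p0 p1 p2 p3 p4 p5
    by (simp add: path_cost_def path_at_def)
  then show ?thesis
    unfolding sum_permutations_pick path_count_def by (simp only: pick_if pick_zero)
qed

lemma sum_claw_cost:
  "(\<Sum>\<pi> | \<pi> permutes UNIV. claw_cost a (\<pi> I0) (\<pi> I1) (\<pi> I2) (\<pi> I3) (\<pi> I4) (\<pi> I5)) = claw_count a"
proof -
  have "claw_cost a p0 p1 p2 p3 p4 p5 =
    (if a p0 p1 then if a p0 p2 then if a p1 p2 then 0 else if a p0 p3 then if a p1 p3 then 0 else if a p2 p3 then 0
      else claw_form (claw_flag (a p4 p0) (a p4 p1) (a p4 p2) (a p4 p3))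
       (claw_flag (a p5 p0) (a p5 p1) (a p5 p2) (a p5 p3)) else 0 else 0 else 0)" for p0 p1 p2 p3 p4 p5
    by (simp add: claw_cost_def claw_at_def)
  then show ?thesis
    unfolding sum_permutations_pick claw_count_def by (simp only: pick_if pick_zero)
qed

lemma pair_form_commute: "pair_form f g = pair_form g f"
  by (cases f; cases g; simp)

lemma pair_flag_commute: "pair_flag a b c d e = pair_flag c d a b e"
  by (cases a; cases b; cases c; cases d; cases e; simp)

lemma pairings_pick:
  assumes h: "\<And>x y. h x y = h y x" and len: "length r = 4"
  shows "pick (\<lambda>p2 r. pick (\<lambda>p3 r. pick (\<lambda>p4 r. pick (\<lambda>p5 r. pair_form (h p2 p3) (h p4 p5)) [] r) [] r) [] r) [] r
    = pairings h r"
proof -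
  obtain x y z w where r: "r = [x, y, z, w]"
    using len by (auto simp: numeral_eq_Suc length_Suc_conv)
  show ?thesis
    unfolding r
    by (simp add: h[of y x] h[of z x] h[of w x] h[of z y] h[of w y] h[of w z]
        pair_form_commute[of "h z w" "h x y"] pair_form_commute[of "h y w" "h x z"] pair_form_commute[of "h y z" "h x w"])
qed

lemma sum_pair_cost:
  assumes sym: "\<And>i j. a i j = a j i"
  shows "(\<Sum>\<pi> | \<pi> permutes UNIV. pair_cost a (\<pi> I0) (\<pi> I1) (\<pi> I2) (\<pi> I3) (\<pi> I4) (\<pi> I5)) = pair_count a"
proof -
  have h: "pair_at a p0 p1 x y = pair_at a p0 p1 y x" for p0 p1 x y
    unfolding pair_at_def sym[of x y] by (rule pair_flag_commute)
  show ?thesis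
    unfolding sum_permutations_pick pair_count_def
    unfolding pair_cost_def pick_if pick_zero
    by (intro pick_cong if_cong refl pairings_pick h) simp_all
qed

section \<open>The cost of every six-vertex graph is at most 28800\<close>

text \<open>A graph on the six positions, given by its adjacencies in the order \<open>01, 02, 12, 03, 13, 23, ...\<close>.
With such constants each adjacency test is a single rewrite step.\<close>

datatype graph = Bits bool bool bool bool bool bool bool bool bool bool bool bool bool bool bool

fun adj :: "graph \<Rightarrow> ix \<Rightarrow> ix \<Rightarrow> bool" where
"adj (Bits a01 a02 a12 a03 a13 a23 a04 a14 a24 a34 a05 a15 a25 a35 a45) I0 I0 = False"
| "adj (Bits a01 a02 a12 a03 a13 a23 a04 a14 a24 a34 a05 a15 a25 a35 a45) I0 I1 = a01"
| "adj (Bits a01 a02 a12 a03 a13 a23 a04 a14 a24 a34 a05 a15 a25 a35 a45) I0 I2 = a02"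
| "adj (Bits a01 a02 a12 a03 a13 a23 a04 a14 a24 a34 a05 a15 a25 a35 a45) I0 I3 = a03"
| "adj (Bits a01 a02 a12 a03 a13 a23 a04 a14 a24 a34 a05 a15 a25 a35 a45) I0 I4 = a04"
| "adj (Bits a01 a02 a12 a03 a13 a23 a04 a14 a24 a34 a05 a15 a25 a35 a45) I0 I5 = a05"
| "adj (Bits a01 a02 a12 a03 a13 a23 a04 a14 a24 a34 a05 a15 a25 a35 a45) I1 I0 = a01"
| "adj (Bits a01 a02 a12 a03 a13 a23 a04 a14 a24 a34 a05 a15 a25 a35 a45) I1 I1 = False"
| "adj (Bits a01 a02 a12 a03 a13 a23 a04 a14 a24 a34 a05 a15 a25 a35 a45) I1 I2 = a12"
| "adj (Bits a01 a02 a12 a03 a13 a23 a04 a14 a24 a34 a05 a15 a25 a35 a45) I1 I3 = a13"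
| "adj (Bits a01 a02 a12 a03 a13 a23 a04 a14 a24 a34 a05 a15 a25 a35 a45) I1 I4 = a14"
| "adj (Bits a01 a02 a12 a03 a13 a23 a04 a14 a24 a34 a05 a15 a25 a35 a45) I1 I5 = a15"
| "adj (Bits a01 a02 a12 a03 a13 a23 a04 a14 a24 a34 a05 a15 a25 a35 a45) I2 I0 = a02"
| "adj (Bits a01 a02 a12 a03 a13 a23 a04 a14 a24 a34 a05 a15 a25 a35 a45) I2 I1 = a12"
| "adj (Bits a01 a02 a12 a03 a13 a23 a04 a14 a24 a34 a05 a15 a25 a35 a45) I2 I2 = False"
| "adj (Bits a01 a02 a12 a03 a13 a23 a04 a14 a24 a34 a05 a15 a25 a35 a45) I2 I3 = a23"
| "adj (Bits a01 a02 a12 a03 a13 a23 a04 a14 a24 a34 a05 a15 a25 a35 a45) I2 I4 = a24"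
| "adj (Bits a01 a02 a12 a03 a13 a23 a04 a14 a24 a34 a05 a15 a25 a35 a45) I2 I5 = a25"
| "adj (Bits a01 a02 a12 a03 a13 a23 a04 a14 a24 a34 a05 a15 a25 a35 a45) I3 I0 = a03"
| "adj (Bits a01 a02 a12 a03 a13 a23 a04 a14 a24 a34 a05 a15 a25 a35 a45) I3 I1 = a13"
| "adj (Bits a01 a02 a12 a03 a13 a23 a04 a14 a24 a34 a05 a15 a25 a35 a45) I3 I2 = a23"
| "adj (Bits a01 a02 a12 a03 a13 a23 a04 a14 a24 a34 a05 a15 a25 a35 a45) I3 I3 = False"
| "adj (Bits a01 a02 a12 a03 a13 a23 a04 a14 a24 a34 a05 a15 a25 a35 a45) I3 I4 = a34"
| "adj (Bits a01 a02 a12 a03 a13 a23 a04 a14 a24 a34 a05 a15 a25 a35 a45) I3 I5 = a35"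
| "adj (Bits a01 a02 a12 a03 a13 a23 a04 a14 a24 a34 a05 a15 a25 a35 a45) I4 I0 = a04"
| "adj (Bits a01 a02 a12 a03 a13 a23 a04 a14 a24 a34 a05 a15 a25 a35 a45) I4 I1 = a14"
| "adj (Bits a01 a02 a12 a03 a13 a23 a04 a14 a24 a34 a05 a15 a25 a35 a45) I4 I2 = a24"
| "adj (Bits a01 a02 a12 a03 a13 a23 a04 a14 a24 a34 a05 a15 a25 a35 a45) I4 I3 = a34"
| "adj (Bits a01 a02 a12 a03 a13 a23 a04 a14 a24 a34 a05 a15 a25 a35 a45) I4 I4 = False"
| "adj (Bits a01 a02 a12 a03 a13 a23 a04 a14 a24 a34 a05 a15 a25 a35 a45) I4 I5 = a45"
| "adj (Bits a01 a02 a12 a03 a13 a23 a04 a14 a24 a34 a05 a15 a25 a35 a45) I5 I0 = a05"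
| "adj (Bits a01 a02 a12 a03 a13 a23 a04 a14 a24 a34 a05 a15 a25 a35 a45) I5 I1 = a15"
| "adj (Bits a01 a02 a12 a03 a13 a23 a04 a14 a24 a34 a05 a15 a25 a35 a45) I5 I2 = a25"
| "adj (Bits a01 a02 a12 a03 a13 a23 a04 a14 a24 a34 a05 a15 a25 a35 a45) I5 I3 = a35"
| "adj (Bits a01 a02 a12 a03 a13 a23 a04 a14 a24 a34 a05 a15 a25 a35 a45) I5 I4 = a45"
| "adj (Bits a01 a02 a12 a03 a13 a23 a04 a14 a24 a34 a05 a15 a25 a35 a45) I5 I5 = False"

fun deg_of :: "bool \<Rightarrow> bool \<Rightarrow> bool \<Rightarrow> bool \<Rightarrow> bool \<Rightarrow> int" where
"deg_of True True True True True = 5"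
| "deg_of True True True True False = 4"
| "deg_of True True True False True = 4"
| "deg_of True True True False False = 3"
| "deg_of True True False True True = 4"
| "deg_of True True False True False = 3"
| "deg_of True True False False True = 3"
| "deg_of True True False False False = 2"
| "deg_of True False True True True = 4"
| "deg_of True False True True False = 3"
| "deg_of True False True False True = 3"
| "deg_of True False True False False = 2"
| "deg_of True False False True True = 3"
| "deg_of True False False True False = 2"
| "deg_of True False False False True = 2"
| "deg_of True False False False False = 1"
| "deg_of False True True True True = 4"
| "deg_of False True True True False = 3"
| "deg_of False True True False True = 3"
| "deg_of False True True False False = 2"
| "deg_of False True False True True = 3"
| "deg_of False True False True False = 2"
| "deg_of False True False False True = 2"
| "deg_of False True False False False = 1"
| "deg_of False False True True True = 3"
| "deg_of False False True True False = 2"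
| "deg_of False False True False True = 2"
| "deg_of False False True False False = 1"
| "deg_of False False False True True = 2"
| "deg_of False False False True False = 1"
| "deg_of False False False False True = 1"
| "deg_of False False False False False = 0"
definition degree_at :: "(ix \<Rightarrow> ix \<Rightarrow> bool) \<Rightarrow> ix \<Rightarrow> int" where
  "degree_at a = case_ix
     (deg_of (a I0 I1) (a I0 I2) (a I0 I3) (a I0 I4) (a I0 I5))
     (deg_of (a I1 I0) (a I1 I2) (a I1 I3) (a I1 I4) (a I1 I5))
     (deg_of (a I2 I0) (a I2 I1) (a I2 I3) (a I2 I4) (a I2 I5))
     (deg_of (a I3 I0) (a I3 I1) (a I3 I2) (a I3 I4) (a I3 I5))
     (deg_of (a I4 I0) (a I4 I1) (a I4 I2) (a I4 I3) (a I4 I5))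
     (deg_of (a I5 I0) (a I5 I1) (a I5 I2) (a I5 I3) (a I5 I4))"

definition for_both :: "(bool \<Rightarrow> bool) \<Rightarrow> bool" where
  "for_both f = (if f False then f True else False)"

text \<open>Every graph has a labelling with ascending degrees, so only such labellings have to be checked.
There are 936 of them among the 32768 labelled graphs.\<close>

definition ascending :: "(ix \<Rightarrow> int) \<Rightarrow> bool" where
  "ascending d = (if d I4 \<le> d I5 then if d I3 \<le> d I4 then if d I2 \<le> d I3 then
    if d I1 \<le> d I2 then d I0 \<le> d I1 else False else False else False else False)"

definition cost_count :: "(ix \<Rightarrow> ix \<Rightarrow> bool) \<Rightarrow> int" where
  "cost_count a = F38_count a + path_count a + claw_count a + pair_count a"

definition bounded_if_ascending :: "(ix \<Rightarrow> ix \<Rightarrow> bool) \<Rightarrow> bool" where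
  "bounded_if_ascending a = (if ascending (degree_at a) then cost_count a \<le> 28800 else True)"

text \<open>The check is divided according to the first three adjacencies at \<open>I0\<close>, so that the eight pieces can run in
parallel.\<close>

definition cost_check_block :: "bool \<Rightarrow> bool \<Rightarrow> bool \<Rightarrow> bool" where
  "cost_check_block a01 a02 a03 \<longleftrightarrow>
    for_both (\<lambda>a12. for_both (\<lambda>a13. for_both (\<lambda>a23. for_both (\<lambda>a04. for_both (\<lambda>a14. for_both (\<lambda>a24.
    for_both (\<lambda>a34. for_both (\<lambda>a05. for_both (\<lambda>a15. for_both (\<lambda>a25. for_both (\<lambda>a35. for_both (\<lambda>a45.
      bounded_if_ascending
        (adj (Bits a01 a02 a12 a03 a13 a23 a04 a14 a24 a34 a05 a15 a25 a35 a45))))))))))))))"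

lemma cost_check_block0: "cost_check_block False False False"
  by code_simp

lemma cost_check_block1: "cost_check_block False False True"
  by code_simp

lemma cost_check_block2: "cost_check_block False True False"
  by code_simp

lemma cost_check_block3: "cost_check_block False True True"
  by code_simp

lemma cost_check_block4: "cost_check_block True False False"
  by code_simp

lemma cost_check_block5: "cost_check_block True False True"
  by code_simp

lemma cost_check_block6: "cost_check_block True True False"
  by code_simp

lemma cost_check_block7: "cost_check_block True True True"
  by code_simp

lemma cost_sum_eq_count:
  assumes "\<And>i j. a i j = a j i"
  shows "cost_sum a = cost_count a"
  unfolding cost_sum_def cost_count_def cost_def sum.distrib sum_copy_cost sum_path_cost sum_claw_cost sum_pair_cost[OF assms] by simp

lemma cost_compose:
  "cost (\<lambda>i j. a (\<sigma> i) (\<sigma> j)) p0 p1 p2 p3 p4 p5 = cost a (\<sigma> p0) (\<sigma> p1) (\<sigma> p2) (\<sigma> p3) (\<sigma> p4) (\<sigma> p5)"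
  by (simp add: cost_def copy_cost_def path_cost_def claw_cost_def pair_cost_def
      F38_at_def path_at_def claw_at_def pair_at_def)

lemma cost_sum_relabel:
  assumes "\<sigma> permutes UNIV"
  shows "cost_sum (\<lambda>i j. a (\<sigma> i) (\<sigma> j)) = cost_sum a"
  unfolding cost_sum_def cost_compose
  using setum_permutations_compose_left[OF assms, of "\<lambda>\<pi>. cost a (\<pi> I0) (\<pi> I1) (\<pi> I2) (\<pi> I3) (\<pi> I4) (\<pi> I5)"]
  by simp

lemma for_bothD: "for_both f \<Longrightarrow> f x"
  by (cases x) (auto simp: for_both_def split: if_splits)

lemma deg_of_eq: "deg_of a b c d e = of_bool a + of_bool b + of_bool c + of_bool d + of_bool e"
  by (cases a; cases b; cases c; cases d; cases e; simp)

lemma degree_at_eq: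
  assumes "\<And>i. \<not> a i i"
  shows "degree_at a i = (\<Sum>j\<in>UNIV. of_bool (a i j))"
  by (cases i) (simp_all add: UNIV_ix degree_at_def deg_of_eq assms)

lemma permutation_of_list:
  assumes "distinct ps" "set ps = (UNIV :: ix set)"
  obtains \<pi> where "\<pi> permutes UNIV" "map \<pi> [I0, I1, I2, I3, I4, I5] = ps"
proof -
  let ?U = "[I0, I1, I2, I3, I4, I5]"
  have "length ps = 6"
    using assms distinct_card[of ps] by (simp add: UNIV_ix)
  then obtain a b c d e f where ps: "ps = [a, b, c, d, e, f]"
    by (auto simp: numeral_eq_Suc length_Suc_conv)
  let ?p = "case_ix a b c d e f"
  have "range ?p = UNIV"
    using assms by (auto simp: ps UNIV_ix)
  then have "bij ?p"
    using finite_UNIV_surj_inj[of ?p] by (simp only: bij_def finite_class.finite_UNIV)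
  then have "?p permutes UNIV"
    by (intro bij_imp_permutes) simp_all
  then show thesis
    by (rule that) (simp add: ps)
qed

lemma degree_sorted_relabelling:
  assumes irr: "\<And>i. \<not> a i i"
  obtains \<sigma> where "\<sigma> permutes UNIV" "ascending (degree_at (\<lambda>i j. a (\<sigma> i) (\<sigma> j)))"
proof -
  define U where "U = [I0, I1, I2, I3, I4, I5]"
  have "distinct U" "set U = UNIV"
    by (simp_all add: U_def UNIV_ix)
  then have "distinct (sort_key (degree_at a) U)" "set (sort_key (degree_at a) U) = UNIV"
    by simp_all
  then obtain \<sigma> where \<sigma>: "\<sigma> permutes UNIV" "map \<sigma> U = sort_key (degree_at a) U"
    unfolding U_def by (rule permutation_of_list)
  have deg: "degree_at (\<lambda>i j. a (\<sigma> i) (\<sigma> j)) i = degree_at a (\<sigma> i)" for i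
  proof -
    have "(\<Sum>j\<in>UNIV. of_bool (a (\<sigma> i) (\<sigma> j)) :: int) = (\<Sum>j\<in>UNIV. of_bool (a (\<sigma> i) j))"
      by (rule sum.reindex_bij_betw) (rule permutes_imp_bij[OF \<sigma>(1)])
    then show ?thesis
      by (simp only: degree_at_eq[of a, OF irr] degree_at_eq[of "\<lambda>i j. a (\<sigma> i) (\<sigma> j)", OF irr])
  qed
  have "sorted (map (degree_at a) (map \<sigma> U))"
    unfolding \<sigma>(2) by (rule sorted_sort_key)
  then have "ascending (degree_at (\<lambda>i j. a (\<sigma> i) (\<sigma> j)))"
    by (simp add: ascending_def deg U_def)
  with \<sigma>(1) show thesis by (rule that)
qed

lemma cost_check:
  "bounded_if_ascending (adj (Bits a01 a02 a12 a03 a13 a23 a04 a14 a24 a34 a05 a15 a25 a35 a45))"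
proof -
  have "cost_check_block a01 a02 a03"
    using cost_check_block0 cost_check_block1 cost_check_block2 cost_check_block3
      cost_check_block4 cost_check_block5 cost_check_block6 cost_check_block7
    by (cases a01; cases a02; cases a03) simp_all
  then show ?thesis
    unfolding cost_check_block_def by - ((drule for_bothD)+, assumption)
qed

lemma adj_of_matrix:
  assumes sym: "\<And>i j. a i j = a j i" and irr: "\<And>i. \<not> a i i"
  shows "adj (Bits (a I0 I1) (a I0 I2) (a I1 I2) (a I0 I3) (a I1 I3) (a I2 I3) (a I0 I4) (a I1 I4) (a I2 I4) (a I3 I4)
     (a I0 I5) (a I1 I5) (a I2 I5) (a I3 I5) (a I4 I5)) = a"
proof (intro ext)
  show "adj (Bits (a I0 I1) (a I0 I2) (a I1 I2) (a I0 I3) (a I1 I3) (a I2 I3) (a I0 I4) (a I1 I4) (a I2 I4) (a I3 I4)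
     (a I0 I5) (a I1 I5) (a I2 I5) (a I3 I5) (a I4 I5)) i j = a i j" for i j
    by (cases i; cases j) (simp_all only: adj.simps irr sym)
qed

lemma cost_sum_le:
  assumes sym: "\<And>i j. a i j = a j i" and irr: "\<And>i. \<not> a i i"
  shows "cost_sum a \<le> 28800"
proof -
  obtain \<sigma> where \<sigma>: "\<sigma> permutes UNIV" "ascending (degree_at (\<lambda>i j. a (\<sigma> i) (\<sigma> j)))"
    using degree_sorted_relabelling[of a, OF irr] by blast
  define b where "b i j = a (\<sigma> i) (\<sigma> j)" for i j
  have b: "b i j = b j i" "\<not> b i i" for i j by (simp_all add: b_def irr sym[of "\<sigma> i"])
  have "bounded_if_ascending b" using cost_check adj_of_matrix[of b, OF b] by metis
  moreover have "ascending (degree_at b)" using \<sigma>(2) by (simp add: b_def[abs_def])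
  ultimately have "cost_sum b \<le> 28800"
    by (simp add: bounded_if_ascending_def cost_sum_eq_count[OF b(1)])
  then show ?thesis
    using cost_sum_relabel[OF \<sigma>(1), of a] by (simp add: b_def[abs_def])
qed

section \<open>Sampling with repetition from a weighted graph\<close>

definition wsum :: "'v set \<Rightarrow> ('v \<Rightarrow> real) \<Rightarrow> ((ix \<Rightarrow> 'v) \<Rightarrow> real) \<Rightarrow> real" where
  "wsum V w g = (\<Sum>x | range x \<subseteq> V. (\<Prod>i\<in>UNIV. w (x i)) * g x)"

lemma finite_tuples: "finite V \<Longrightarrow> finite {x :: ix \<Rightarrow> 'v. range x \<subseteq> V}"
  using finite_PiE[of "UNIV :: ix set" "\<lambda>_. V"] by (simp add: PiE_def Pi_def image_subset_iff)

lemma wsum_nested: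
  "wsum V w g = (\<Sum>a\<in>V. w a * (\<Sum>b\<in>V. w b * (\<Sum>c\<in>V. w c * (\<Sum>d\<in>V. w d * (\<Sum>e\<in>V. w e * (\<Sum>f\<in>V. w f *
     g (case_ix a b c d e f)))))))"
proof -
  have "wsum V w g = (\<Sum>(a, b, c, d, e, f)\<in>V \<times> V \<times> V \<times> V \<times> V \<times> V.
      w a * (w b * (w c * (w d * (w e * (w f * g (case_ix a b c d e f)))))))"
    unfolding wsum_def
  proof (rule sum.reindex_bij_witness[where i = "\<lambda>(a, b, c, d, e, f). case_ix a b c d e f"
        and j = "\<lambda>x. (x I0, x I1, x I2, x I3, x I4, x I5)"])
    fix x :: "ix \<Rightarrow> 'a"
    have x: "case_ix (x I0) (x I1) (x I2) (x I3) (x I4) (x I5) = x"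
      by (rule ext) (simp split: ix.split)
    then show "(\<lambda>(a, b, c, d, e, f). case_ix a b c d e f) (x I0, x I1, x I2, x I3, x I4, x I5) = x"
      by simp
    show "(case (x I0, x I1, x I2, x I3, x I4, x I5) of (a, b, c, d, e, f) \<Rightarrow>
        w a * (w b * (w c * (w d * (w e * (w f * g (case_ix a b c d e f))))))) = (\<Prod>i\<in>UNIV. w (x i)) * g x"
      by (simp add: x UNIV_ix mult.assoc)
  qed (auto simp: UNIV_ix)
  then show ?thesis
    by (simp add: sum.cartesian_product[symmetric] sum_distrib_left)
qed

lemma wsum_add: "wsum V w (\<lambda>x. g x + h x) = wsum V w g + wsum V w h"
  by (simp add: wsum_def distrib_left sum.distrib)

lemma wsum_cmult: "wsum V w (\<lambda>x. c * g x) = c * wsum V w g"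
  by (simp add: wsum_def sum_distrib_left mult.left_commute)

lemma wsum_sum: "wsum V w (\<lambda>x. \<Sum>i\<in>I. g i x) = (\<Sum>i\<in>I. wsum V w (g i))"
  unfolding wsum_def by (simp add: sum_distrib_left) (rule sum.swap)

lemma wsum_mono:
  assumes "\<And>v. v \<in> V \<Longrightarrow> 0 \<le> w v" "\<And>x. range x \<subseteq> V \<Longrightarrow> g x \<le> h x"
  shows "wsum V w g \<le> wsum V w h"
  unfolding wsum_def
  by (intro sum_mono mult_left_mono prod_nonneg) (use assms in \<open>auto simp: image_subset_iff\<close>)

lemma wsum_const: "wsum V w (\<lambda>_. c) = c * (\<Sum>v\<in>V. w v) ^ 6"
  unfolding wsum_nested sum_distrib_right[symmetric] by (simp add: eval_nat_numeral)

lemma wsum_relabel: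
  assumes \<pi>: "\<pi> permutes UNIV"
  shows "wsum V w (\<lambda>x. g (x \<circ> \<pi>)) = wsum V w g"
  unfolding wsum_def
proof (rule sum.reindex_bij_witness[where j = "\<lambda>x. x \<circ> \<pi>" and i = "\<lambda>x. x \<circ> inv \<pi>"])
  fix x :: "ix \<Rightarrow> 'a"
  show "x \<circ> \<pi> \<circ> inv \<pi> = x" "x \<circ> inv \<pi> \<circ> \<pi> = x"
    using permutes_inv_o[OF \<pi>] by (simp_all add: comp_assoc)
  have "(\<Prod>i\<in>UNIV. w (x (\<pi> i))) = (\<Prod>i\<in>UNIV. w (x i))"
    by (rule prod.reindex_bij_betw) (rule permutes_imp_bij[OF \<pi>])
  then show "(\<Prod>i\<in>UNIV. w ((x \<circ> \<pi>) i)) * g (x \<circ> \<pi>) = (\<Prod>i\<in>UNIV. w (x i)) * g (x \<circ> \<pi>)"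
    by simp
qed auto

text \<open>A sum over all draws does not change when the draws are permuted, so the cost may be averaged over all orders;
a draw carries the six-vertex graph of its adjacencies, in which repeated vertices are
nonadjacent twins.\<close>

lemma wsum_cost_le:
  assumes w: "\<And>v. v \<in> V \<Longrightarrow> 0 \<le> w v"
    and sym: "\<And>u v. A u v = A v u" and irr: "\<And>v. \<not> A v v"
  shows "wsum V w (\<lambda>x. real_of_int (cost A (x I0) (x I1) (x I2) (x I3) (x I4) (x I5))) \<le> 40 * (\<Sum>v\<in>V. w v) ^ 6"
proof -
  let ?P = "{\<pi> :: ix \<Rightarrow> ix. \<pi> permutes UNIV}"
  define g where "g x = real_of_int (cost A (x I0) (x I1) (x I2) (x I3) (x I4) (x I5))" for x
  have card: "card ?P = 720"
    by (subst card_permutations[of UNIV 6]) (simp_all add: UNIV_ix fact_numeral)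
  have "(\<Sum>\<pi>\<in>?P. g (x \<circ> \<pi>)) \<le> 28800" for x
  proof -
    define a where "a i j = A (x i) (x j)" for i j
    have *: "(\<Sum>\<pi>\<in>?P. g (x \<circ> \<pi>)) = real_of_int (cost_sum a)"
      by (simp add: g_def cost_sum_def a_def[abs_def] cost_compose)
    have "cost_sum a \<le> 28800"
      by (rule cost_sum_le) (use sym irr in \<open>auto simp: a_def\<close>)
    then show ?thesis unfolding * by linarith
  qed
  then have "wsum V w (\<lambda>x. \<Sum>\<pi>\<in>?P. g (x \<circ> \<pi>)) \<le> wsum V w (\<lambda>x. 28800)"
    by (intro wsum_mono w)
  moreover have "wsum V w (\<lambda>x. \<Sum>\<pi>\<in>?P. g (x \<circ> \<pi>)) = 720 * wsum V w g"
    by (simp add: wsum_sum wsum_relabel card)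
  ultimately show ?thesis
    unfolding g_def[abs_def] wsum_const by simp
qed

section \<open>The flag inequality\<close>

definition copies :: "'v set \<Rightarrow> ('v \<Rightarrow> 'v \<Rightarrow> bool) \<Rightarrow> ('v \<Rightarrow> real) \<Rightarrow> real" where
  "copies V A w = wsum V w (\<lambda>x. of_bool (F38_at A (x I0) (x I1) (x I2) (x I3) (x I4) (x I5)))"

definition path_sum ::
  "'v set \<Rightarrow> ('v \<Rightarrow> 'v \<Rightarrow> bool) \<Rightarrow> ('v \<Rightarrow> real) \<Rightarrow> ('v \<Rightarrow> 'v \<Rightarrow> 'v \<Rightarrow> 'v \<Rightarrow> real) \<Rightarrow> real" where
  "path_sum V A w X = (\<Sum>a\<in>V. w a * (\<Sum>b\<in>V. w b * (\<Sum>c\<in>V. w c * (\<Sum>d\<in>V. w d *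
     (if path_at A a b c d then X a b c d else 0)))))"

definition role :: "('v \<Rightarrow> 'v \<Rightarrow> bool) \<Rightarrow> 'v \<Rightarrow> 'v \<Rightarrow> 'v \<Rightarrow> 'v \<Rightarrow> 'v \<Rightarrow> pathflag" where
  "role A a b c d y = path_flag (A y a) (A y b) (A y c) (A y d)"

definition imbalance ::
  "'v set \<Rightarrow> ('v \<Rightarrow> 'v \<Rightarrow> bool) \<Rightarrow> ('v \<Rightarrow> real) \<Rightarrow> 'v \<Rightarrow> 'v \<Rightarrow> 'v \<Rightarrow> 'v \<Rightarrow> real" where
  "imbalance V A w a b c d =
     (\<Sum>y\<in>V. w y * (\<Sum>z\<in>V. w z * imbalance_form (role A a b c d y) (role A a b c d z)))"

definition misfits ::
  "'v set \<Rightarrow> ('v \<Rightarrow> 'v \<Rightarrow> bool) \<Rightarrow> ('v \<Rightarrow> real) \<Rightarrow> 'v \<Rightarrow> 'v \<Rightarrow> 'v \<Rightarrow> 'v \<Rightarrow> real" where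
  "misfits V A w a b c d =
     (\<Sum>y\<in>V. w y * (\<Sum>z\<in>V. w z * of_bool (misfit (role A a b c d y) (role A a b c d z) (A y z))))"

text \<open>Summing a quadratic form of two flags over two independently chosen vertices gives the quadratic form of the
flag weights, here written as a sum of squares.\<close>

lemma sum_squares_mass:
  "(\<Sum>y\<in>S. u y * (\<Sum>z\<in>S. u z * sum_squares sq (f y) (f z))) =
     (\<Sum>(d, l)\<leftarrow>sq. d * (\<Sum>y\<in>S. u y * l (f y))\<^sup>2)"
proof (induction sq)
  case (Cons p sq)
  obtain d l where p: "p = (d, l)" by (cases p)
  have split: "sum_squares (p # sq) g h = d * l g * l h + sum_squares sq g h" for g h
    by (simp add: sum_squares_def p)
  have "(\<Sum>y\<in>S. u y * (\<Sum>z\<in>S. u z * sum_squares (p # sq) (f y) (f z))) =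
      (\<Sum>y\<in>S. u y * (\<Sum>z\<in>S. u z * (d * l (f y) * l (f z))))
        + (\<Sum>y\<in>S. u y * (\<Sum>z\<in>S. u z * sum_squares sq (f y) (f z)))"
    by (simp add: split distrib_left sum.distrib)
  also have "(\<Sum>y\<in>S. u y * (\<Sum>z\<in>S. u z * (d * l (f y) * l (f z)))) = d * (\<Sum>y\<in>S. u y * l (f y))\<^sup>2"
    by (simp add: power2_eq_square sum_product sum_distrib_left mult_ac)
  finally show ?case
    using Cons.IH by (simp add: p)
qed (simp add: sum_squares_def)

lemma sum_squares_nonneg:
  assumes "\<And>d l. (d, l) \<in> set sq \<Longrightarrow> 0 \<le> d"
  shows "0 \<le> (\<Sum>y\<in>S. u y * (\<Sum>z\<in>S. u z * sum_squares sq (f y) (f z)))"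
  unfolding sum_squares_mass
  by (rule sum_list_nonneg) (use assms in auto)

lemma path_sum_mono:
  assumes "\<And>v. v \<in> V \<Longrightarrow> 0 \<le> w v"
    and "\<And>a b c d. path_at A a b c d \<Longrightarrow> {a, b, c, d} \<subseteq> V \<Longrightarrow> X a b c d \<le> Y a b c d"
  shows "path_sum V A w X \<le> path_sum V A w Y"
  unfolding path_sum_def
  by (intro sum_mono mult_left_mono) (use assms in auto)

lemma path_cost_ge:
  assumes w: "\<And>v. v \<in> V \<Longrightarrow> 0 \<le> w v"
  shows "path_sum V A w (\<lambda>a b c d. imbalance V A w a b c d + 18 * misfits V A w a b c d) \<le>
    wsum V w (\<lambda>x. real_of_int (path_cost A (x I0) (x I1) (x I2) (x I3) (x I4) (x I5)))"
proof -
  define q where "q a b c d = (\<Sum>y\<in>V. w y * (\<Sum>z\<in>V. w z *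
      real_of_int (path_weight (role A a b c d y) (role A a b c d z) (A y z))))" for a b c d
  have "imbalance V A w a b c d + 18 * misfits V A w a b c d \<le> q a b c d" for a b c d
  proof -
    have "real_of_int (path_weight f g e) = imbalance_form f g + 18 * of_bool (misfit f g e) + sum_squares path_squares f g" for f g e
      by (simp add: path_weight_def path_form_squares)
    then have "q a b c d = imbalance V A w a b c d + 18 * misfits V A w a b c d
        + (\<Sum>y\<in>V. w y * (\<Sum>z\<in>V. w z * sum_squares path_squares (role A a b c d y) (role A a b c d z)))"
      by (simp add: q_def imbalance_def misfits_def distrib_left sum.distrib sum_distrib_left mult_ac)
    moreover have "0 \<le> (\<Sum>y\<in>V. w y * (\<Sum>z\<in>V. w z * sum_squares path_squares (role A a b c d y) (role A a b c d z)))"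
      by (rule sum_squares_nonneg) (auto simp: path_squares_def)
    ultimately show ?thesis by linarith
  qed
  then have "path_sum V A w (\<lambda>a b c d. imbalance V A w a b c d + 18 * misfits V A w a b c d) \<le> path_sum V A w q"
    by (intro path_sum_mono w)
  also have "path_sum V A w q = wsum V w (\<lambda>x. real_of_int (path_cost A (x I0) (x I1) (x I2) (x I3) (x I4) (x I5)))"
    unfolding wsum_nested path_sum_def q_def path_cost_def role_def by (intro sum.cong refl arg_cong2[where f = "(*)"]) auto
  finally show ?thesis .
qed

lemma claw_cost_nonneg:
  assumes w: "\<And>v. v \<in> V \<Longrightarrow> 0 \<le> w v"
  shows "0 \<le> wsum V w (\<lambda>x. real_of_int (claw_cost A (x I0) (x I1) (x I2) (x I3) (x I4) (x I5)))"
proof -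
  have step: "(\<And>v. v \<in> V \<Longrightarrow> 0 \<le> F v) \<Longrightarrow> 0 \<le> (\<Sum>v\<in>V. w v * F v)" for F :: "'a \<Rightarrow> real"
    by (intro sum_nonneg mult_nonneg_nonneg w)
  have nonneg: "0 \<le> (\<Sum>y\<in>V. w y * (\<Sum>z\<in>V. w z * real_of_int (claw_cost A a b c d y z)))" for a b c d
  proof (cases "claw_at A a b c d")
    case True
    then show ?thesis
      unfolding claw_cost_def
      by (simp only: if_True claw_form_squares)
        (rule sum_squares_nonneg[where f = "\<lambda>y. claw_flag (A y a) (A y b) (A y c) (A y d)"], auto simp: claw_squares_def)
  qed (simp add: claw_cost_def)
  show ?thesis
    unfolding wsum_nested ix.case by (rule step, rule step, rule step, rule step, rule nonneg)
qed

text \<open>Here the two groups are pairs of vertices, so the squares are sums over \<open>V \<times> V\<close>.\<close>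

lemma pair_cost_nonneg:
  assumes w: "\<And>v. v \<in> V \<Longrightarrow> 0 \<le> w v"
  shows "0 \<le> wsum V w (\<lambda>x. real_of_int (pair_cost A (x I0) (x I1) (x I2) (x I3) (x I4) (x I5)))"
proof -
  have step: "(\<And>v. v \<in> V \<Longrightarrow> 0 \<le> F v) \<Longrightarrow> 0 \<le> (\<Sum>v\<in>V. w v * F v)" for F :: "'a \<Rightarrow> real"
    by (intro sum_nonneg mult_nonneg_nonneg w)
  have nonneg: "0 \<le> (\<Sum>c\<in>V. w c * (\<Sum>d\<in>V. w d * (\<Sum>e\<in>V. w e * (\<Sum>f\<in>V. w f * real_of_int (pair_cost A a b c d e f)))))" for a b
  proof (cases "A a b")
    case False
    have "0 \<le> (\<Sum>y\<in>V \<times> V. (w (fst y) * w (snd y)) * (\<Sum>z\<in>V \<times> V. (w (fst z) * w (snd z)) *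
        sum_squares pair_squares (pair_at A a b (fst y) (snd y)) (pair_at A a b (fst z) (snd z))))"
      by (rule sum_squares_nonneg[where f = "\<lambda>y. pair_at A a b (fst y) (snd y)"]) (auto simp: pair_squares_def)
    then show ?thesis
      using False
      by (simp add: pair_cost_def pair_form_squares sum.cartesian_product' sum_distrib_left mult.assoc)
  qed (simp add: pair_cost_def)
  show ?thesis
    unfolding wsum_nested ix.case by (rule step, rule step, rule nonneg)
qed

text \<open>The main inequality. The term in \<open>imbalance\<close> and \<open>misfits\<close> records by how much the bound fails to
be attained.\<close>

theorem flag_inequality:
  assumes w: "\<And>v. v \<in> V \<Longrightarrow> 0 \<le> w v"
    and sym: "\<And>u v. A u v = A v u" and irr: "\<And>v. \<not> A v v"
  shows "62500 * copies V A w + path_sum V A w (\<lambda>a b c d. imbalance V A w a b c d + 18 * misfits V A w a b c d)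
    \<le> 40 * (\<Sum>v\<in>V. w v) ^ 6"
proof -
  have "wsum V w (\<lambda>x. real_of_int (copy_cost A (x I0) (x I1) (x I2) (x I3) (x I4) (x I5))) = 62500 * copies V A w"
    unfolding copies_def wsum_cmult[symmetric] by (intro arg_cong[where f = "wsum V w"] ext) (simp add: copy_cost_def)
  then show ?thesis
    using wsum_cost_le[where V = V and w = w and A = A, OF w sym irr] path_cost_ge[where V = V and w = w and A = A, OF w] claw_cost_nonneg[where V = V and w = w and A = A, OF w] pair_cost_nonneg[where V = V and w = w and A = A, OF w]
    by (simp add: cost_def wsum_add)
qed

section \<open>The pentagon\<close>

abbreviation adjacent :: "'a pattern \<Rightarrow> 'a \<Rightarrow> 'a \<Rightarrow> bool" where
  "adjacent G x y \<equiv> {x, y} \<in> edges G"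

lemma adjacent_commute: "adjacent G x y = adjacent G y x"
  by (simp add: insert_commute)

lemma C5_irrefl: "\<not> adjacent C5 i i"
  by (auto simp: C5_def)

lemma adjacent_C5:
  "adjacent C5 i j \<longleftrightarrow> (i, j) \<in> {(0, 1), (1, 0), (1, 2), (2, 1), (2, 3), (3, 2), (3, 4), (4, 3), (4, 0), (0, 4)}"
  by (auto simp: C5_def doubleton_eq_iff)

lemma imbalance_nonneg: "0 \<le> imbalance V A w a b c d"
  unfolding imbalance_def imbalance_form_def by (rule sum_squares_nonneg) auto

lemma misfits_nonneg: "(\<And>v. v \<in> V \<Longrightarrow> 0 \<le> w v) \<Longrightarrow> 0 \<le> misfits V A w a b c d"
  unfolding misfits_def by (intro sum_nonneg mult_nonneg_nonneg) auto

lemma path_sum_nonneg: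
  assumes "\<And>v. v \<in> V \<Longrightarrow> 0 \<le> w v" "\<And>a b c d. 0 \<le> X a b c d"
  shows "0 \<le> path_sum V A w X"
  unfolding path_sum_def by (intro sum_nonneg mult_nonneg_nonneg) (simp_all add: assms)

lemma copies_le:
  assumes w: "\<And>v. v \<in> V \<Longrightarrow> 0 \<le> w v"
    and sym: "\<And>u v. A u v = A v u" and irr: "\<And>v. \<not> A v v"
  shows "62500 * copies V A w \<le> 40 * (\<Sum>v\<in>V. w v) ^ 6"
proof -
  have "0 \<le> path_sum V A w (\<lambda>a b c d. imbalance V A w a b c d + 18 * misfits V A w a b c d)"
    by (intro path_sum_nonneg w add_nonneg_nonneg imbalance_nonneg mult_nonneg_nonneg misfits_nonneg) simp_all
  then show ?thesis
    using flag_inequality[where V = V and w = w and A = A, OF w sym irr] by linarith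
qed

text \<open>If a function of draws only depends on the classes of the vertices under \<open>\<kappa>\<close>, the weights can be
collected in the classes.\<close>

lemma wsum_push:
  assumes "finite V" "finite K" "\<And>v. v \<in> V \<Longrightarrow> \<kappa> v \<in> K"
  shows "wsum V w (\<lambda>x. g (\<lambda>i. \<kappa> (x i))) = wsum K (\<lambda>k. \<Sum>v | v \<in> V \<and> \<kappa> v = k. w v) g"
proof -
  have push: "(\<Sum>v\<in>V. w v * F (\<kappa> v)) = (\<Sum>k\<in>K. (\<Sum>v | v \<in> V \<and> \<kappa> v = k. w v) * F k)" for F
    using sum.group[of V K \<kappa> "\<lambda>v. w v * F (\<kappa> v)"] assms
    by (force simp: sum_distrib_right intro: sum.cong)
  define h where "h a b c d e f = g (case_ix a b c d e f)" for a b c d e f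
  define W where "W k = (\<Sum>v | v \<in> V \<and> \<kappa> v = k. w v)" for k
  note push = push[folded W_def]
  have *: "g (\<lambda>i. \<kappa> (case_ix a b c d e f i)) = h (\<kappa> a) (\<kappa> b) (\<kappa> c) (\<kappa> d) (\<kappa> e) (\<kappa> f)" for a b c d e f
    unfolding h_def by (rule arg_cong[where f = g], rule ext) (simp split: ix.split)
  note steps = push[of "\<lambda>f. h a b c d e f" for a b c d e]
    push[of "\<lambda>e. \<Sum>f\<in>K. W f * h a b c d e f" for a b c d]
    push[of "\<lambda>d. \<Sum>e\<in>K. W e * (\<Sum>f\<in>K. W f * h a b c d e f)" for a b c]
    push[of "\<lambda>c. \<Sum>d\<in>K. W d * (\<Sum>e\<in>K. W e * (\<Sum>f\<in>K. W f * h a b c d e f))" for a b]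
    push[of "\<lambda>b. \<Sum>c\<in>K. W c * (\<Sum>d\<in>K. W d * (\<Sum>e\<in>K. W e * (\<Sum>f\<in>K. W f * h a b c d e f)))" for a]
    push[of "\<lambda>a. \<Sum>b\<in>K. W b * (\<Sum>c\<in>K. W c * (\<Sum>d\<in>K. W d * (\<Sum>e\<in>K. W e * (\<Sum>f\<in>K. W f * h a b c d e f))))"]
  show ?thesis
    unfolding wsum_nested * steps h_def[symmetric] W_def[symmetric] by (rule refl)
qed

lemma copies_push:
  assumes "finite V" "\<And>v. v \<in> V \<Longrightarrow> \<kappa> v < 5"
  shows "copies V (\<lambda>u v. adjacent C5 (\<kappa> u) (\<kappa> v)) w =
    copies {..<5} (adjacent C5) (\<lambda>k. \<Sum>v | v \<in> V \<and> \<kappa> v = k. w v)"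
  unfolding copies_def
  using wsum_push[of V "{..<5}" \<kappa> w "\<lambda>x. of_bool (F38_at (adjacent C5) (x I0) (x I1) (x I2) (x I3) (x I4) (x I5))"]
    assms by (simp add: F38_at_def)

lemma card_UNIV_ix: "card (UNIV :: ix set) = 6"
  by (simp add: UNIV_ix)

text \<open>The upper bound is the flag inequality, and the lower bound lists ten placements of \<open>F38\<close>: there are
five choices for the part of the vertex \<open>0\<close>, and two choices for the neighbouring part
that holds the vertices \<open>1\<close> and \<open>4\<close>.\<close>

lemma copies_C5_uniform:
  assumes "0 \<le> c"
  shows "copies {..<5} (adjacent C5) (\<lambda>_. c) = 10 * c ^ 6"
proof (rule antisym)
  have "62500 * copies {..<5} (adjacent C5) (\<lambda>_. c) \<le> 40 * (\<Sum>v\<in>{..<5 :: nat}. c) ^ 6"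
    by (rule copies_le[OF _ adjacent_commute C5_irrefl]) (simp add: assms)
  then show "copies {..<5} (adjacent C5) (\<lambda>_. c) \<le> 10 * c ^ 6"
    by (simp add: power_mult_distrib)
next
  define X :: "(ix \<Rightarrow> nat) set" where "X =
    {case_ix 0 1 4 4 1 2, case_ix 1 2 0 0 2 3, case_ix 2 3 1 1 3 4, case_ix 3 4 2 2 4 0, case_ix 4 0 3 3 0 1,
     case_ix 0 4 1 1 4 3, case_ix 1 0 2 2 0 4, case_ix 2 1 3 3 1 0, case_ix 3 2 4 4 2 1, case_ix 4 3 0 0 3 2}"
  \<comment> \<open>The first two positions already tell the ten draws apart.\<close>
  have "card ((\<lambda>x. (x I0, x I1)) ` X) = 10"
    by (simp add: X_def)
  then have "10 \<le> card X"
    using card_image_le[of X "\<lambda>x. (x I0, x I1)"] by (simp add: X_def)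
  have X: "X \<subseteq> {x. range x \<subseteq> {..<5}}"
    by (simp add: X_def UNIV_ix)
  have F: "F38_at (adjacent C5) (x I0) (x I1) (x I2) (x I3) (x I4) (x I5)" if "x \<in> X" for x
    using that unfolding X_def by (elim insertE) (simp_all add: F38_at_def adjacent_C5)
  have "10 * c ^ 6 \<le> card X * c ^ 6"
    using \<open>10 \<le> card X\<close> assms by (intro mult_right_mono) simp_all
  also have "\<dots> = (\<Sum>x\<in>X. (\<Prod>i\<in>(UNIV :: ix set). c) * of_bool (F38_at (adjacent C5) (x I0) (x I1) (x I2) (x I3) (x I4) (x I5)))"
    using F by (simp add: card_UNIV_ix)
  also have "\<dots> \<le> copies {..<5} (adjacent C5) (\<lambda>_. c)"
    unfolding copies_def wsum_def using assms
    by (intro sum_mono2 finite_tuples X mult_nonneg_nonneg prod_nonneg) simp_all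
  finally show "10 * c ^ 6 \<le> copies {..<5} (adjacent C5) (\<lambda>_. c)" .
qed

definition cyclic_gap :: "(nat \<Rightarrow> real) \<Rightarrow> real" where
  "cyclic_gap w = (w 0 - w 1)\<^sup>2 + (w 1 - w 2)\<^sup>2 + (w 2 - w 3)\<^sup>2 + (w 3 - w 4)\<^sup>2 + (w 4 - w 0)\<^sup>2"

lemma C5_neighbours:
  "adjacent C5 0 j \<longleftrightarrow> j = 1 \<or> j = 4" "adjacent C5 1 j \<longleftrightarrow> j = 0 \<or> j = 2"
  "adjacent C5 2 j \<longleftrightarrow> j = 1 \<or> j = 3" "adjacent C5 3 j \<longleftrightarrow> j = 2 \<or> j = 4"
  "adjacent C5 4 j \<longleftrightarrow> j = 3 \<or> j = 0"
  by (auto simp: adjacent_C5)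

lemma C5_paths:
  assumes "path_at (adjacent C5) a b c d" "a < 5"
  shows "(a, b, c, d) \<in> {(0, 1, 2, 3), (1, 2, 3, 4), (2, 3, 4, 0), (3, 4, 0, 1), (4, 0, 1, 2),
    (0, 4, 3, 2), (1, 0, 4, 3), (2, 1, 0, 4), (3, 2, 1, 0), (4, 3, 2, 1)}"
proof -
  have *: "adjacent C5 a b" "adjacent C5 b c" "adjacent C5 c d" "\<not> adjacent C5 a c" "\<not> adjacent C5 a d" "\<not> adjacent C5 b d"
    using assms(1) by (simp_all add: path_at_def)
  from assms(2) consider "a = 0" | "a = 1" | "a = 2" | "a = 3" | "a = 4" by linarith
  then show ?thesis
    using * by cases (auto simp: C5_neighbours C5_neighbours[unfolded One_nat_def])
qed

text \<open>From any of its induced paths, the pentagon is seen as a whole, in cyclic order.\<close>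

lemma imbalance_C5:
  assumes "path_at (adjacent C5) a b c d" "a < 5"
  shows "imbalance {..<5} (adjacent C5) w a b c d = cyclic_gap w"
proof -
  have five: "{..<5} = {0, 1, 2, 3, 4 :: nat}" by auto
  show ?thesis
    using C5_paths[OF assms] unfolding imbalance_def imbalance_form_def sum_squares_mass five role_def cyclic_gap_def
    by (elim insertE) (simp_all add: adjacent_C5 power2_commute)
qed

text \<open>The part of the blowup to which a vertex is assigned. Vertices that fit nowhere are put into part \<open>0\<close>;
all pairs containing such a vertex are misfits.\<close>

primrec class_of :: "pathflag \<Rightarrow> nat" where
  "class_of Part0 = 0" | "class_of Part1 = 1" | "class_of Part2 = 2" | "class_of Part3 = 3" | "class_of Part4 = 4"
| "class_of Apart = 0" | "class_of Tip0 = 0" | "class_of Tip3 = 0" | "class_of Stray = 0"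

lemma class_of_less: "class_of f < 5"
  by (cases f) simp_all

lemma misfit_if_wrong:
  "e \<noteq> adjacent C5 (class_of f) (class_of g) \<Longrightarrow> misfit f g e"
  by (cases f; cases g; cases e; simp add: adjacent_C5 C5_irrefl[simplified])

lemma path_sum_cmult: "path_sum V A w (\<lambda>a b c d. k * X a b c d) = k * path_sum V A w X"
  unfolding path_sum_def sum_distrib_left by (intro sum.cong refl) auto

text \<open>The vertices \<open>2, 0, 1, 5\<close> of \<open>F38\<close> form an induced path, so copies can only be frequent where induced paths
are.\<close>

lemma copies_le_path_sum:
  assumes w: "\<And>v. v \<in> V \<Longrightarrow> 0 \<le> w v" and sym: "\<And>u v. A u v = A v u"
  shows "copies V A w \<le> (\<Sum>v\<in>V. w v)\<^sup>2 * path_sum V A w (\<lambda>a b c d. 1)"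
proof -
  \<comment> \<open>A relabelling that moves the induced path \<open>2, 0, 1, 5\<close> to the first four positions.\<close>
  define \<pi> where "\<pi> = case_ix I2 I0 I1 I5 I3 I4"
  define g :: "(ix \<Rightarrow> 'a) \<Rightarrow> real" where "g x = of_bool (path_at A (x I0) (x I1) (x I2) (x I3))" for x
  have "inj \<pi>"
    by (rule injI) (auto simp: \<pi>_def split: ix.splits)
  then have \<pi>: "\<pi> permutes UNIV"
    using finite_UNIV_inj_surj[of \<pi>] by (intro bij_imp_permutes) (simp_all add: bij_def)
  have "copies V A w \<le> wsum V w (\<lambda>x. g (x \<circ> \<pi>))"
    unfolding copies_def
    by (rule wsum_mono[OF w]) (use sym in \<open>auto simp: g_def \<pi>_def F38_at_def path_at_def\<close>)
  also have "\<dots> = wsum V w g"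
    by (rule wsum_relabel[OF \<pi>])
  also have "\<dots> = path_sum V A w (\<lambda>a b c d. (\<Sum>v\<in>V. w v)\<^sup>2)"
    unfolding wsum_nested g_def ix.case sum_distrib_right[symmetric] path_sum_def
    by (intro sum.cong refl arg_cong2[where f = "(*)"]) (simp add: power2_eq_square)
  finally show ?thesis
    using path_sum_cmult[of V A w "(\<Sum>v\<in>V. w v)\<^sup>2" "\<lambda>a b c d. 1"] by simp
qed

section \<open>Tuples through given pairs\<close>

text \<open>Counting by degrees of freedom: the draws in \<open>X\<close> are determined by the value of \<open>f\<close> and by the
vertices at the positions in \<open>J\<close>.\<close>

lemma card_determined:
  fixes X :: "(ix \<Rightarrow> 'v) set"
  assumes V: "finite V" and Y: "finite Y" and X: "X \<subseteq> {x. range x \<subseteq> V}"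
    and f: "f ` X \<subseteq> Y" and inj: "inj_on (\<lambda>x. (f x, restrict x J)) X"
  shows "card X \<le> card Y * card V ^ card J"
proof -
  have "card X \<le> card (Y \<times> (J \<rightarrow>\<^sub>E V))"
  proof (rule card_inj_on_le[OF inj])
    show "(\<lambda>x. (f x, restrict x J)) ` X \<subseteq> Y \<times> (J \<rightarrow>\<^sub>E V)"
      using X f by (auto simp: image_subset_iff)
    show "finite (Y \<times> (J \<rightarrow>\<^sub>E V))"
      using V Y by (intro finite_cartesian_product finite_PiE) auto
  qed
  then show ?thesis
    by (simp add: card_cartesian_product card_PiE)
qed

lemma restrict_eqD: "restrict x J = restrict y J \<Longrightarrow> i \<in> J \<Longrightarrow> x i = y i"
  by (metis restrict_apply')

lemma card_Compl_ix: "card (- X) = 6 - card (X :: ix set)"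
  by (simp add: Compl_eq_Diff_UNIV card_Diff_subset card_UNIV_ix)

lemma card_coincidence:
  assumes V: "finite V" and ij: "i \<noteq> (j :: ix)"
  shows "card {x. range x \<subseteq> V \<and> x i = x j} \<le> card V ^ 5"
proof -
  have "inj_on (\<lambda>x. ((), restrict x (- {i}))) {x. range x \<subseteq> V \<and> x i = x j}"
  proof (rule inj_onI)
    fix x y assume xy: "x \<in> {x. range x \<subseteq> V \<and> x i = x j}" "y \<in> {x. range x \<subseteq> V \<and> x i = x j}"
      "((), restrict x (- {i})) = ((), restrict y (- {i}))"
    then have eq: "x k = y k" if "k \<noteq> i" for k
      using that restrict_eqD[of x "- {i}" y k] by simp
    then have "x i = y i" using xy ij by auto
    with eq show "x = y" by (metis ext)
  qed
  then have "card {x. range x \<subseteq> V \<and> x i = x j} \<le> card {()} * card V ^ card (- {i})"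
    by (rule card_determined[OF V, rotated 3]) auto
  also have "card (- {i}) = 5"
    by (simp add: card_Compl_ix)
  finally show ?thesis by simp
qed

lemma card_through_pair:
  assumes V: "finite V" and S: "finite S" and ij: "i \<noteq> (j :: ix)"
  shows "card {x. range x \<subseteq> V \<and> (x i, x j) \<in> S} \<le> card S * card V ^ 4"
proof -
  have "inj_on (\<lambda>x. ((x i, x j), restrict x (- {i, j}))) {x. range x \<subseteq> V \<and> (x i, x j) \<in> S}"
  proof (rule inj_onI)
    fix x y assume xy: "((x i, x j), restrict x (- {i, j})) = ((y i, y j), restrict y (- {i, j}))"
    then have "x k = y k" for k
      using restrict_eqD[of x "- {i, j}" y k] by (cases "k \<in> {i, j}") auto
    then show "x = y" by (rule ext)
  qed
  then have "card {x. range x \<subseteq> V \<and> (x i, x j) \<in> S} \<le> card S * card V ^ card (- {i, j})"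
    by (rule card_determined[OF V S, rotated 2]) auto
  also have "card (- {i, j}) = 4"
    using ij by (simp add: card_Compl_ix)
  finally show ?thesis .
qed

text \<open>One of the coinciding positions lies outside \<open>{i, j}\<close>, as no pair in \<open>S\<close> consists of equal
vertices. This position and the pair leave three free positions.\<close>

lemma card_through_pair_coincidence:
  assumes V: "finite V" and S: "finite S" and irr: "\<And>v. (v, v) \<notin> S" and kl: "k \<noteq> (l :: ix)"
  shows "card {x. range x \<subseteq> V \<and> (x i, x j) \<in> S \<and> x k = x l} \<le> card S * card V ^ 3"
proof -
  have main: "card {x. range x \<subseteq> V \<and> (x i, x j) \<in> S \<and> x k = x l} \<le> card S * card V ^ 3"
    if kl: "k \<noteq> l" and l: "l \<notin> {i, j}" and ij: "i \<noteq> j" for k l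
  proof -
    have "inj_on (\<lambda>x. ((x i, x j), restrict x (- {i, j, l}))) {x. range x \<subseteq> V \<and> (x i, x j) \<in> S \<and> x k = x l}"
    proof (rule inj_onI)
      fix x y
      assume xy: "x \<in> {x. range x \<subseteq> V \<and> (x i, x j) \<in> S \<and> x k = x l}"
        "y \<in> {x. range x \<subseteq> V \<and> (x i, x j) \<in> S \<and> x k = x l}"
        "((x i, x j), restrict x (- {i, j, l})) = ((y i, y j), restrict y (- {i, j, l}))"
      have eq: "x m = y m" if "m \<noteq> l" for m
        using xy(3) that restrict_eqD[of x "- {i, j, l}" y m] by (cases "m \<in> {i, j}") auto
      then have "x l = y l" using xy kl by auto
      with eq show "x = y" by (metis ext)
    qed
    then have "card {x. range x \<subseteq> V \<and> (x i, x j) \<in> S \<and> x k = x l} \<le> card S * card V ^ card (- {i, j, l})"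
      by (rule card_determined[OF V S, rotated 2]) auto
    also have "card (- {i, j, l}) = 3"
      using ij l by (auto simp: card_Compl_ix card_insert_if)
    finally show ?thesis .
  qed
  consider "i = j" | "i \<noteq> j" "l \<notin> {i, j}" | "i \<noteq> j" "k \<notin> {i, j}" | "i \<noteq> j" "{k, l} = {i, j}"
    using kl by blast
  then show ?thesis
  proof cases
    case 3
    then show ?thesis using main[of l k] kl by (simp add: eq_commute)
  next
    case 4
    then have empty: "{x. range x \<subseteq> V \<and> (x i, x j) \<in> S \<and> x k = x l} = {}"
      using irr by (auto simp: doubleton_eq_iff)
    show ?thesis unfolding empty by simp
  qed (use main[of k l] kl irr in auto)
qed

lemma card_UNIV_ix2: "card (UNIV :: (ix \<times> ix) set) = 36"
  by (simp add: UNIV_Times_UNIV[symmetric] card_cartesian_product card_UNIV_ix del: UNIV_Times_UNIV)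

lemma card_not_inj:
  assumes "finite V"
  shows "card {x :: ix \<Rightarrow> 'v. range x \<subseteq> V \<and> \<not> inj x} \<le> 36 * card V ^ 5"
proof -
  have "{x :: ix \<Rightarrow> 'v. range x \<subseteq> V \<and> \<not> inj x}
      \<subseteq> (\<Union>p\<in>{p. fst p \<noteq> snd p}. {x. range x \<subseteq> V \<and> x (fst p) = x (snd p)})"
    by (fastforce simp: inj_def)
  then have "card {x :: ix \<Rightarrow> 'v. range x \<subseteq> V \<and> \<not> inj x}
      \<le> card (\<Union>p\<in>{p :: ix \<times> ix. fst p \<noteq> snd p}. {x. range x \<subseteq> V \<and> x (fst p) = x (snd p)})"
    by (intro card_mono finite_UN_I) (auto intro: finite_subset[OF _ finite_tuples[OF assms]])
  also have "\<dots> \<le> (\<Sum>p\<in>{p :: ix \<times> ix. fst p \<noteq> snd p}. card {x. range x \<subseteq> V \<and> x (fst p) = x (snd p)})"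
    by (rule card_UN_le) simp
  also have "\<dots> \<le> (\<Sum>p\<in>{p :: ix \<times> ix. fst p \<noteq> snd p}. card V ^ 5)"
    by (intro sum_mono card_coincidence assms) simp
  also have "\<dots> \<le> 36 * card V ^ 5"
    using card_mono[of UNIV "{p :: ix \<times> ix. fst p \<noteq> snd p}"] by (simp add: card_UNIV_ix2)
  finally show ?thesis .
qed

definition hits :: "('v \<times> 'v) set \<Rightarrow> (ix \<Rightarrow> 'v) \<Rightarrow> bool" where
  "hits S x \<longleftrightarrow> (\<exists>i j. (x i, x j) \<in> S)"

lemma card_hits:
  fixes V :: "'v set"
  assumes V: "finite V" and S: "finite S" and irr: "\<And>v. (v, v) \<notin> S"
  shows "card {x. range x \<subseteq> V \<and> hits S x} \<le> 36 * card S * card V ^ 4"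
proof -
  have le: "card {x. range x \<subseteq> V \<and> (x (fst p), x (snd p)) \<in> S} \<le> card S * card V ^ 4" for p :: "ix \<times> ix"
    using card_through_pair[OF V S, of "fst p" "snd p"] irr by (cases "fst p = snd p") auto
  have "{x. range x \<subseteq> V \<and> hits S x} \<subseteq> (\<Union>p\<in>UNIV. {x. range x \<subseteq> V \<and> (x (fst p), x (snd p)) \<in> S})"
    by (fastforce simp: hits_def)
  then have "card {x. range x \<subseteq> V \<and> hits S x}
      \<le> card (\<Union>p\<in>UNIV. {x :: ix \<Rightarrow> 'v. range x \<subseteq> V \<and> (x (fst p), x (snd p)) \<in> S})"
    by (intro card_mono finite_UN_I) (auto intro: finite_subset[OF _ finite_tuples[OF V]])
  also have "\<dots> \<le> (\<Sum>p\<in>UNIV. card {x :: ix \<Rightarrow> 'v. range x \<subseteq> V \<and> (x (fst p), x (snd p)) \<in> S})"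
    by (rule card_UN_le) simp
  also have "\<dots> \<le> (\<Sum>p\<in>(UNIV :: (ix \<times> ix) set). card S * card V ^ 4)"
    by (intro sum_mono le)
  finally show ?thesis by (simp add: card_UNIV_ix2)
qed

lemma card_hits_not_inj:
  fixes V :: "'v set"
  assumes V: "finite V" and S: "finite S" and irr: "\<And>v. (v, v) \<notin> S"
  shows "card {x. range x \<subseteq> V \<and> hits S x \<and> \<not> inj x} \<le> 1296 * card S * card V ^ 3"
proof -
  define E where "E = {p :: (ix \<times> ix) \<times> (ix \<times> ix). fst (snd p) \<noteq> snd (snd p)}"
  define X where "X p = {x :: ix \<Rightarrow> 'v. range x \<subseteq> V \<and> (x (fst (fst p)), x (snd (fst p))) \<in> S
      \<and> x (fst (snd p)) = x (snd (snd p))}" for p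
  have "{x. range x \<subseteq> V \<and> hits S x \<and> \<not> inj x} \<subseteq> (\<Union>p\<in>E. X p)"
  proof
    fix x assume x: "x \<in> {x. range x \<subseteq> V \<and> hits S x \<and> \<not> inj x}"
    then obtain i j k l where "(x i, x j) \<in> S" "k \<noteq> l" "x k = x l"
      by (auto simp: hits_def inj_def)
    then have "((i, j), (k, l)) \<in> E" "x \<in> X ((i, j), (k, l))"
      using x by (simp_all add: E_def X_def)
    then show "x \<in> (\<Union>p\<in>E. X p)" by blast
  qed
  then have "card {x. range x \<subseteq> V \<and> hits S x \<and> \<not> inj x} \<le> card (\<Union>p\<in>E. X p)"
    by (intro card_mono finite_UN_I) (auto simp: X_def intro: finite_subset[OF _ finite_tuples[OF V]])
  also have "\<dots> \<le> (\<Sum>p\<in>E. card (X p))"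
    by (rule card_UN_le) simp
  also have "\<dots> \<le> (\<Sum>p\<in>E. card S * card V ^ 3)"
    unfolding X_def by (intro sum_mono card_through_pair_coincidence V S irr) (simp add: E_def)
  also have "\<dots> \<le> 1296 * card S * card V ^ 3"
  proof -
    have "card E \<le> card (UNIV :: ((ix \<times> ix) \<times> (ix \<times> ix)) set)"
      by (intro card_mono) simp_all
    also have "\<dots> = 1296"
      by (simp add: UNIV_Times_UNIV[symmetric] card_cartesian_product card_UNIV_ix del: UNIV_Times_UNIV)
    finally show ?thesis by (simp add: mult.assoc)
  qed
  finally show ?thesis .
qed

section \<open>Densities and tuples\<close>

primrec index :: "ix \<Rightarrow> nat" where
  "index I0 = 0" | "index I1 = 1" | "index I2 = 2" | "index I3 = 3" | "index I4 = 4" | "index I5 = 5"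

lemma bij_index: "bij_betw index UNIV {0..<6}"
proof -
  have "inj index"
  proof (rule injI)
    show "index i = index j \<Longrightarrow> i = j" for i j
      by (cases i; cases j; simp)
  qed
  moreover have "range index = {0..<6}"
    by (auto simp: UNIV_ix)
  ultimately show ?thesis by (simp add: bij_betw_def)
qed

lemma all_ix: "(\<forall>i. P i) \<longleftrightarrow> P I0 \<and> P I1 \<and> P I2 \<and> P I3 \<and> P I4 \<and> P I5"
  by (metis ix.exhaust)

lemma adjacent_F38:
  "adjacent F38 i j \<longleftrightarrow> (i, j) \<in> {(0, 1), (0, 2), (0, 3), (0, 4), (1, 5), (4, 5), (1, 0), (2, 0), (3, 0), (4, 0), (5, 1), (5, 4)}"
  by (auto simp: F38_def doubleton_eq_iff)

text \<open>The bridge from the explicit pattern to isomorphism with \<open>F38\<close>.\<close>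

lemma F38_at_iff:
  assumes sym: "\<And>u v. A u v = A v u" and irr: "\<And>v. \<not> A v v"
  shows "F38_at A (x I0) (x I1) (x I2) (x I3) (x I4) (x I5) \<longleftrightarrow>
    (\<forall>i j. A (x i) (x j) \<longleftrightarrow> adjacent F38 (index i) (index j))"
  unfolding all_ix adjacent_F38 F38_at_def using sym irr by auto

lemma graph_adjacent:
  assumes "is_graph G"
  shows "finite (verts G)" "\<not> adjacent G v v" "adjacent G u v \<Longrightarrow> u \<in> verts G \<and> v \<in> verts G"
  using assms by (auto simp: is_graph_def is_pattern_def doubleton_eq_iff dest!: subsetD)

definition embeddings :: "'v set \<Rightarrow> ('v \<Rightarrow> 'v \<Rightarrow> bool) \<Rightarrow> (ix \<Rightarrow> 'v) set" where
  "embeddings V A = {x. range x \<subseteq> V \<and> inj x \<and> F38_at A (x I0) (x I1) (x I2) (x I3) (x I4) (x I5)}"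

lemma finite_embeddings: "finite V \<Longrightarrow> finite (embeddings V A)"
  by (rule finite_subset[OF _ finite_tuples[of V]]) (auto simp: embeddings_def)

text \<open>The evaluation function for copies also counts the automorphisms of \<open>F38\<close>: it returns \<open>62500\<close> for each of
them.\<close>

lemma F38_automorphisms:
  assumes sym: "\<And>i j. a i j = a j i" and irr: "\<And>i. \<not> a i i" and F: "F38_at a I0 I1 I2 I3 I4 I5"
  shows "card {\<pi>. \<pi> permutes UNIV \<and> F38_at a (\<pi> I0) (\<pi> I1) (\<pi> I2) (\<pi> I3) (\<pi> I4) (\<pi> I5)} = 4"
proof -
  let ?b = "adj (Bits True True False True False False True False False False False True False False True)"
  have "a = ?b"
    using F adj_of_matrix[of a, OF sym irr] by (simp add: F38_at_def)
  moreover have "F38_count ?b = 250000"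
    by code_simp
  ultimately have "F38_count a = 250000" by simp
  moreover have "(\<Sum>\<pi> | \<pi> permutes UNIV. copy_cost a (\<pi> I0) (\<pi> I1) (\<pi> I2) (\<pi> I3) (\<pi> I4) (\<pi> I5)) =
    62500 * int (card {\<pi>. \<pi> permutes UNIV \<and> F38_at a (\<pi> I0) (\<pi> I1) (\<pi> I2) (\<pi> I3) (\<pi> I4) (\<pi> I5)})"
    by (simp add: copy_cost_def sum.If_cases Int_def)
  ultimately show ?thesis
    unfolding sum_copy_cost by simp
qed

text \<open>The embeddings with a given image differ by automorphisms of \<open>F38\<close>.\<close>

lemma card_embeddings_of_range:
  assumes sym: "\<And>u v. A u v = A v u" and irr: "\<And>v. \<not> A v v" and x: "x \<in> embeddings V A"
  shows "card {y \<in> embeddings V A. range y = range x} = 4"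
proof -
  define a where "a i j = A (x i) (x j)" for i j
  let ?P = "{\<pi>. \<pi> permutes UNIV \<and> F38_at a (\<pi> I0) (\<pi> I1) (\<pi> I2) (\<pi> I3) (\<pi> I4) (\<pi> I5)}"
  have x': "range x \<subseteq> V" "inj x" "F38_at a I0 I1 I2 I3 I4 I5"
    using x by (simp_all add: embeddings_def a_def F38_at_def)
  have "{y \<in> embeddings V A. range y = range x} = (\<lambda>\<pi>. x \<circ> \<pi>) ` ?P"
  proof (intro equalityI subsetI)
    fix y assume y: "y \<in> {y \<in> embeddings V A. range y = range x}"
    define \<pi> where "\<pi> i = inv x (y i)" for i
    have xy: "x (\<pi> i) = y i" for i
      unfolding \<pi>_def using y by (intro f_inv_into_f) auto
    have "inj \<pi>"
      using y xy by (metis (no_types, lifting) embeddings_def injD injI mem_Collect_eq)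
    then have "\<pi> permutes UNIV"
      using finite_UNIV_inj_surj[of \<pi>] by (intro bij_imp_permutes) (simp_all add: bij_def)
    moreover have "F38_at a (\<pi> I0) (\<pi> I1) (\<pi> I2) (\<pi> I3) (\<pi> I4) (\<pi> I5)"
      using y by (simp add: embeddings_def a_def F38_at_def xy)
    ultimately show "y \<in> (\<lambda>\<pi>. x \<circ> \<pi>) ` ?P"
      using xy by (intro image_eqI[of _ _ \<pi>]) auto
  next
    fix y assume "y \<in> (\<lambda>\<pi>. x \<circ> \<pi>) ` ?P"
    then obtain \<pi> where \<pi>: "\<pi> permutes UNIV" "F38_at a (\<pi> I0) (\<pi> I1) (\<pi> I2) (\<pi> I3) (\<pi> I4) (\<pi> I5)" "y = x \<circ> \<pi>"
      by auto
    then have "bij \<pi>" using permutes_imp_bij by blast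
    moreover have "range y = x ` range \<pi>"
      by (simp add: \<pi>(3) image_comp)
    ultimately have "range y = range x" "inj y"
      using x'(2) by (simp_all add: bij_def \<pi>(3) inj_compose)
    then show "y \<in> {y \<in> embeddings V A. range y = range x}"
      using x' \<pi> by (simp add: embeddings_def a_def F38_at_def)
  qed
  moreover have "inj_on (\<lambda>\<pi>. x \<circ> \<pi>) ?P"
    using x'(2) by (auto intro!: inj_onI ext dest: fun_cong simp: inj_eq)
  moreover have "card ?P = 4"
    by (rule F38_automorphisms) (use sym irr x' in \<open>auto simp: a_def\<close>)
  ultimately show ?thesis by (simp add: card_image)
qed

lemma card_embeddings:
  assumes V: "finite V" and sym: "\<And>u v. A u v = A v u" and irr: "\<And>v. \<not> A v v"
  shows "card (embeddings V A) = 4 * card (range ` embeddings V A)"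
proof -
  have "card (embeddings V A) = (\<Sum>S\<in>range ` embeddings V A. card {y \<in> embeddings V A. range y = S})"
    using sum.image_gen[OF finite_embeddings[OF V], of "\<lambda>_. 1 :: nat" A range] by simp
  also have "\<dots> = (\<Sum>S\<in>range ` embeddings V A. 4)"
    by (intro sum.cong refl) (use card_embeddings_of_range[of A, OF sym irr] in auto)
  finally show ?thesis by simp
qed

lemma F38_subsets:
  assumes G: "is_graph G"
  shows "{S. S \<subseteq> verts G \<and> card S = card (verts F38) \<and> isomorphic (induced G S) F38} =
    range ` embeddings (verts G) (adjacent G)"
proof (intro equalityI subsetI)
  fix S assume "S \<in> {S. S \<subseteq> verts G \<and> card S = card (verts F38) \<and> isomorphic (induced G S) F38}"
  then obtain f where S: "S \<subseteq> verts G" and f: "bij_betw f S {0..<6}"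
    and iso: "\<And>u v. u \<in> S \<Longrightarrow> v \<in> S \<Longrightarrow> adjacent G u v \<longleftrightarrow> adjacent F38 (f u) (f v)"
    by (auto simp: isomorphic_def is_iso_def induced_def F38_def)
  define x where "x i = inv_into S f (index i)" for i
  have idx: "index i \<in> {0..<6}" for i
    using bij_index by (auto simp: bij_betw_def)
  have x: "x i \<in> S" "f (x i) = index i" for i
    using idx[of i] f by (auto simp: x_def bij_betw_def inv_into_into f_inv_into_f)
  have b: "bij_betw x UNIV S"
    unfolding x_def using bij_betw_trans[OF bij_index bij_betw_inv_into[OF f]] by (simp add: o_def)
  have "F38_at (adjacent G) (x I0) (x I1) (x I2) (x I3) (x I4) (x I5)"
    using F38_at_iff[where A = "adjacent G" and x = x, OF adjacent_commute graph_adjacent(2)[OF G]] by (simp add: iso x)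
  then have "x \<in> embeddings (verts G) (adjacent G)" "range x = S"
    using b S by (auto simp: embeddings_def bij_betw_def)
  then show "S \<in> range ` embeddings (verts G) (adjacent G)" by blast
next
  fix S assume "S \<in> range ` embeddings (verts G) (adjacent G)"
  then obtain x where S: "S = range x" and x: "range x \<subseteq> verts G" "inj x"
    and F: "F38_at (adjacent G) (x I0) (x I1) (x I2) (x I3) (x I4) (x I5)"
    by (auto simp: embeddings_def)
  have iff: "adjacent G (x i) (x j) \<longleftrightarrow> adjacent F38 (index i) (index j)" for i j
    using F F38_at_iff[where A = "adjacent G" and x = x, OF adjacent_commute graph_adjacent(2)[OF G]] by simp
  have "bij_betw (inv x) S UNIV"
    using x(2) by (simp add: S bij_betw_def inj_on_inv_into image_inv_f_f inv_f_f)
  then have "bij_betw (index \<circ> inv x) S {0..<6}"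
    by (rule bij_betw_trans[OF _ bij_index])
  moreover have "adjacent (induced G S) u v \<longleftrightarrow> adjacent F38 ((index \<circ> inv x) u) ((index \<circ> inv x) v)"
    if "u \<in> S" "v \<in> S" for u v
    using that x(2) by (auto simp: S induced_def iff)
  ultimately have "isomorphic (induced G S) F38"
    unfolding isomorphic_def is_iso_def by (intro exI[of _ "index \<circ> inv x"]) (auto simp: induced_def F38_def)
  moreover have "card S = 6"
    using x(2) by (simp add: S card_image card_UNIV_ix)
  ultimately show "S \<in> {S. S \<subseteq> verts G \<and> card S = card (verts F38) \<and> isomorphic (induced G S) F38}"
    using x S by (auto simp: F38_def)
qed

lemma density_F38:
  assumes G: "is_graph G"
  shows "density F38 G = real (card (embeddings (verts G) (adjacent G))) / (4 * real (card (verts G) choose 6))"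
  using card_embeddings[OF graph_adjacent(1)[OF G] adjacent_commute graph_adjacent(2)[OF G]]
  unfolding density_def F38_subsets[OF G] by (simp add: F38_def)

lemma copies_one:
  assumes "finite V"
  shows "copies V A (\<lambda>_. 1) = card {x. range x \<subseteq> V \<and> F38_at A (x I0) (x I1) (x I2) (x I3) (x I4) (x I5)}"
  unfolding copies_def wsum_def
  using finite_tuples[OF assms] by (simp add: of_bool_def sum.If_cases Int_def)

lemma embeddings_le_copies:
  assumes V: "finite V"
  shows "card (embeddings V A) \<le> copies V A (\<lambda>_. 1)"
  unfolding copies_one[OF V] embeddings_def
  by (intro of_nat_mono card_mono) (auto intro: finite_subset[OF _ finite_tuples[OF V]])

lemma copies_le_embeddings:
  assumes V: "finite V"
  shows "copies V A (\<lambda>_. 1) \<le> card (embeddings V A) + 36 * real (card V) ^ 5"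
proof -
  have "card {x. range x \<subseteq> V \<and> F38_at A (x I0) (x I1) (x I2) (x I3) (x I4) (x I5)}
      \<le> card (embeddings V A \<union> {x. range x \<subseteq> V \<and> \<not> inj x})"
    by (intro card_mono) (auto simp: embeddings_def intro: finite_subset[OF _ finite_tuples[OF V]])
  also have "\<dots> \<le> card (embeddings V A) + card {x :: ix \<Rightarrow> 'a. range x \<subseteq> V \<and> \<not> inj x}"
    by (rule card_Un_le)
  also have "\<dots> \<le> card (embeddings V A) + 36 * card V ^ 5"
    using card_not_inj[OF V] by simp
  finally have "real (card {x. range x \<subseteq> V \<and> F38_at A (x I0) (x I1) (x I2) (x I3) (x I4) (x I5)})
      \<le> real (card (embeddings V A) + 36 * card V ^ 5)"
    by (rule of_nat_mono)
  then show ?thesis by (simp add: copies_one[OF V])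
qed

section \<open>Blowups of the pentagon and limits\<close>

lemma path_sum_C5_cong:
  assumes "\<And>a b c d. path_at (adjacent C5) a b c d \<Longrightarrow> a < 5 \<Longrightarrow> X a b c d = Y a b c d"
  shows "path_sum {..<5} (adjacent C5) w X = path_sum {..<5} (adjacent C5) w Y"
  unfolding path_sum_def
  by (intro sum.cong refl arg_cong2[where f = "(*)"]) (use assms in auto)

text \<open>The flag inequality for the weighted pentagon, where the imbalance is the same for all paths.\<close>

lemma C5_stable:
  assumes w: "\<And>i. i < 5 \<Longrightarrow> 0 \<le> w i"
  shows "62500 * copies {..<5} (adjacent C5) w + cyclic_gap w * path_sum {..<5} (adjacent C5) w (\<lambda>a b c d. 1)
    \<le> 40 * (\<Sum>i<5. w i) ^ 6"
proof -
  have w': "0 \<le> w i" if "i \<in> {..<5}" for i using w that by simp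
  have "cyclic_gap w * path_sum {..<5} (adjacent C5) w (\<lambda>a b c d. 1)
      = path_sum {..<5} (adjacent C5) w (\<lambda>a b c d. imbalance {..<5} (adjacent C5) w a b c d)"
    unfolding path_sum_cmult[symmetric] by (rule path_sum_C5_cong) (simp add: imbalance_C5)
  also have "\<dots> \<le> path_sum {..<5} (adjacent C5) w
      (\<lambda>a b c d. imbalance {..<5} (adjacent C5) w a b c d + 18 * misfits {..<5} (adjacent C5) w a b c d)"
    using misfits_nonneg[where V = "{..<5}" and w = w, OF w'] by (intro path_sum_mono w') simp_all
  finally show ?thesis
    using flag_inequality[where V = "{..<5}" and w = w and A = "adjacent C5", OF w' adjacent_commute C5_irrefl]
    by linarith
qed

lemma cyclic_gap_zero:
  assumes "cyclic_gap w = 0" "(\<Sum>i<5. w i) = s" "i < 5"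
  shows "w i = s / 5"
proof -
  have "w 0 = w 1" "w 1 = w 2" "w 2 = w 3" "w 3 = w 4"
    using assms(1) unfolding cyclic_gap_def
    by (smt (verit) zero_le_power2 power2_eq_iff_nonneg zero_power2 right_minus_eq power_eq_0_iff)+
  moreover have "w 0 + w 1 + w 2 + w 3 + w 4 = s"
    using assms(2) by (simp add: eval_nat_numeral)
  moreover have "i \<in> {0, 1, 2, 3, 4}" using assms(3) by auto
  ultimately show ?thesis by auto
qed

lemma copies_scale: "copies V A (\<lambda>v. c * w v) = c ^ 6 * copies V A w"
proof -
  have "(\<Prod>i\<in>(UNIV :: ix set). c * w (x i)) = c ^ 6 * (\<Prod>i\<in>UNIV. w (x i))" for x
    by (simp add: prod.distrib card_UNIV_ix)
  then show ?thesis
    by (simp add: copies_def wsum_def sum_distrib_left mult.assoc)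
qed

lemma copies_cong:
  assumes "\<And>u v. u \<in> V \<Longrightarrow> v \<in> V \<Longrightarrow> A u v = B u v"
  shows "copies V A w = copies V B w"
proof -
  have "F38_at A (x I0) (x I1) (x I2) (x I3) (x I4) (x I5) = F38_at B (x I0) (x I1) (x I2) (x I3) (x I4) (x I5)"
    if "range x \<subseteq> V" for x
  proof -
    have "A (x i) (x j) = B (x i) (x j)" for i j
      using that by (intro assms) auto
    then show ?thesis by (simp add: F38_at_def)
  qed
  then show ?thesis
    unfolding copies_def wsum_def by (intro sum.cong refl) simp
qed

lemma tendsto_copies:
  assumes "finite V" "\<And>v. v \<in> V \<Longrightarrow> ((\<lambda>n. w n v) \<longlongrightarrow> x v) F"
  shows "((\<lambda>n. copies V A (w n)) \<longlongrightarrow> copies V A x) F"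
  unfolding copies_def wsum_def
  by (intro tendsto_sum tendsto_mult tendsto_prod tendsto_const assms(2)) auto

lemma verts_C5: "verts C5 = {..<5}"
  by (auto simp: C5_def)

definition part :: "(nat \<Rightarrow> 'v set) \<Rightarrow> 'v \<Rightarrow> nat" where
  "part P v = (THE i. i < 5 \<and> v \<in> P i)"

context
  fixes P :: "nat \<Rightarrow> 'v set"
  assumes P: "blowup_parts C5 P"
begin

lemma part_eq: "i < 5 \<Longrightarrow> v \<in> P i \<Longrightarrow> part P v = i"
  using P unfolding part_def blowup_parts_def verts_C5 disjoint_family_on_def
  by (intro the_equality) blast+

lemma verts_blowup: "verts (blowup C5 P) = (\<Union>i<5. P i)"
  by (simp add: blowup_def verts_C5)

lemma finite_verts_blowup: "finite (verts (blowup C5 P))"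
  using P by (auto simp: verts_blowup blowup_parts_def verts_C5)

lemma part_less: "v \<in> verts (blowup C5 P) \<Longrightarrow> part P v < 5"
  by (auto simp: verts_blowup part_eq)

lemma adjacent_blowup:
  "adjacent (blowup C5 P) u v \<longleftrightarrow>
    u \<in> verts (blowup C5 P) \<and> v \<in> verts (blowup C5 P) \<and> adjacent C5 (part P u) (part P v)"
proof
  assume "adjacent (blowup C5 P) u v"
  then obtain x y i j where *: "{u, v} = {x, y}" "i < 5" "j < 5" "x \<in> P i" "y \<in> P j" "adjacent C5 i j"
    by (auto simp: blowup_def verts_C5)
  then show "u \<in> verts (blowup C5 P) \<and> v \<in> verts (blowup C5 P) \<and> adjacent C5 (part P u) (part P v)"
    by (auto simp: doubleton_eq_iff verts_blowup part_eq insert_commute)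
next
  assume *: "u \<in> verts (blowup C5 P) \<and> v \<in> verts (blowup C5 P) \<and> adjacent C5 (part P u) (part P v)"
  then obtain i j where ij: "i < 5" "j < 5" "u \<in> P i" "v \<in> P j" by (auto simp: verts_blowup)
  then have "adjacent C5 i j" using * part_eq by auto
  moreover from this have "u \<noteq> v" using ij part_eq C5_irrefl by blast
  ultimately show "adjacent (blowup C5 P) u v"
    using ij by (auto simp: blowup_def verts_C5)
qed

lemma is_graph_blowup: "is_graph (blowup C5 P)"
proof -
  have "edges (blowup C5 P) \<subseteq> {{x, y} |x y. x \<in> verts (blowup C5 P) \<and> y \<in> verts (blowup C5 P)}"
    by (auto simp: blowup_def)
  moreover have "{x} \<notin> edges (blowup C5 P)" for x
    using adjacent_blowup[of x x] C5_irrefl by auto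
  ultimately show ?thesis
    using finite_verts_blowup by (simp add: is_graph_def is_pattern_def)
qed

lemma card_verts_blowup: "card (verts (blowup C5 P)) = (\<Sum>i<5. card (P i))"
  unfolding verts_blowup using P
  by (intro card_UN_disjoint) (auto simp: blowup_parts_def verts_C5 disjoint_family_on_def)

lemma copies_blowup:
  "copies (verts (blowup C5 P)) (adjacent (blowup C5 P)) (\<lambda>_. 1) = copies {..<5} (adjacent C5) (\<lambda>i. real (card (P i)))"
proof -
  have "copies (verts (blowup C5 P)) (adjacent (blowup C5 P)) (\<lambda>_. 1) =
      copies (verts (blowup C5 P)) (\<lambda>u v. adjacent C5 (part P u) (part P v)) (\<lambda>_. 1)"
    by (rule copies_cong) (simp add: adjacent_blowup)
  also have "\<dots> = copies {..<5} (adjacent C5) (\<lambda>k. \<Sum>v | v \<in> verts (blowup C5 P) \<and> part P v = k. 1)"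
    by (rule copies_push) (simp_all add: finite_verts_blowup part_less)
  also have "\<dots> = copies {..<5} (adjacent C5) (\<lambda>i. real (card (P i)))"
    unfolding copies_def wsum_def
  proof (intro sum.cong refl arg_cong2[where f = "(*)"] prod.cong)
    fix x :: "ix \<Rightarrow> nat" and i assume "x \<in> {x. range x \<subseteq> {..<5}}"
    then have "x i < 5" by auto
    then have "{v. v \<in> verts (blowup C5 P) \<and> part P v = x i} = P (x i)"
      by (auto simp: verts_blowup part_eq)
    then show "(\<Sum>v | v \<in> verts (blowup C5 P) \<and> part P v = x i. 1) = real (card (P (x i)))"
      by simp
  qed
  finally show ?thesis .
qed

end

lemma power_over_binomial: "(\<lambda>n. real n ^ 6 / (4 * real (n choose 6))) \<longlonglongrightarrow> 180"
proof -
  have "(\<lambda>n. 1 / (4 * ((\<Prod>i<6. 1 - real i / real n) / 720))) \<longlonglongrightarrow> 1 / (4 * ((\<Prod>i<(6::nat). 1 - 0) / 720))"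
    by (intro tendsto_intros tendsto_prod lim_const_over_n) simp_all
  moreover have "\<forall>\<^sub>F n in sequentially. 1 / (4 * ((\<Prod>i<6. 1 - real i / real n) / 720)) = real n ^ 6 / (4 * real (n choose 6))"
    using eventually_gt_at_top[of 0]
  proof eventually_elim
    case (elim n)
    have "(\<Prod>i<6. 1 - real i / real n) = (\<Prod>i<6. (real n - real i) / real n)"
      using elim by (intro prod.cong refl) (simp add: field_simps)
    also have "\<dots> = (\<Prod>i<6. real n - real i) / real n ^ 6"
      by (simp add: prod_dividef)
    also have "(\<Prod>i<6. real n - real i) = 720 * real (n choose 6)"
      by (simp add: binomial_gbinomial gbinomial_prod_rev atLeast0LessThan fact_numeral)
    finally show ?case by simp
  qed
  ultimately show ?thesis
    by (simp add: tendsto_cong)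
qed

lemma density_limit:
  assumes G: "\<And>n :: nat. is_graph (G n)"
    and size: "filterlim (\<lambda>n. card (verts (G n))) at_top sequentially"
    and L: "(\<lambda>n. copies (verts (G n)) (adjacent (G n)) (\<lambda>_. 1) / real (card (verts (G n))) ^ 6) \<longlonglongrightarrow> L"
  shows "(\<lambda>n. density F38 (G n)) \<longlonglongrightarrow> 180 * L"
proof -
  define N where "N n = real (card (verts (G n)))" for n
  define T where "T n = copies (verts (G n)) (adjacent (G n)) (\<lambda>_. 1)" for n
  define E where "E n = real (card (embeddings (verts (G n)) (adjacent (G n))))" for n
  have N: "filterlim N at_top sequentially"
    unfolding N_def using filterlim_compose[OF filterlim_real_sequentially size] .
  have pos: "\<forall>\<^sub>F n in sequentially. 0 < N n"
    using N by (simp add: filterlim_at_top_dense)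
  have small: "(\<lambda>n. 36 / N n) \<longlonglongrightarrow> 0"
    by (intro tendsto_divide_0[OF tendsto_const] filterlim_at_top_imp_at_infinity N)
  have "(\<lambda>n. E n / N n ^ 6) \<longlonglongrightarrow> L"
  proof (rule tendsto_sandwich)
    show "\<forall>\<^sub>F n in sequentially. T n / N n ^ 6 - 36 / N n \<le> E n / N n ^ 6"
      using pos
    proof eventually_elim
      case (elim n)
      have "T n - 36 * N n ^ 5 \<le> E n"
        using copies_le_embeddings[OF graph_adjacent(1)[OF G], of n "adjacent (G n)"] by (simp add: T_def E_def N_def)
      then have "(T n - 36 * N n ^ 5) / N n ^ 6 \<le> E n / N n ^ 6"
        using elim by (intro divide_right_mono) simp_all
      moreover have "(T n - 36 * N n ^ 5) / N n ^ 6 = T n / N n ^ 6 - 36 / N n"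
        using elim by (simp add: diff_divide_distrib eval_nat_numeral)
      ultimately show ?case by simp
    qed
    show "\<forall>\<^sub>F n in sequentially. E n / N n ^ 6 \<le> T n / N n ^ 6"
      using pos
    proof eventually_elim
      case (elim n)
      then show ?case
        using embeddings_le_copies[OF graph_adjacent(1)[OF G], of n "adjacent (G n)"]
        by (intro divide_right_mono) (simp_all add: T_def E_def)
    qed
    show "(\<lambda>n. T n / N n ^ 6 - 36 / N n) \<longlonglongrightarrow> L"
      using tendsto_diff[OF L small] by (simp add: T_def N_def)
    show "(\<lambda>n. T n / N n ^ 6) \<longlonglongrightarrow> L"
      using L by (simp add: T_def N_def)
  qed
  moreover have "(\<lambda>n. N n ^ 6 / (4 * real (card (verts (G n)) choose 6))) \<longlonglongrightarrow> 180"
    unfolding N_def by (rule filterlim_compose[OF power_over_binomial size])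
  ultimately have "(\<lambda>n. (N n ^ 6 / (4 * real (card (verts (G n)) choose 6))) * (E n / N n ^ 6)) \<longlonglongrightarrow> 180 * L"
    by (intro tendsto_mult)
  moreover have "\<forall>\<^sub>F n in sequentially.
      (N n ^ 6 / (4 * real (card (verts (G n)) choose 6))) * (E n / N n ^ 6) = density F38 (G n)"
    using pos by eventually_elim (simp add: density_F38[OF G] E_def)
  ultimately show ?thesis
    by (simp add: tendsto_cong)
qed

lemma blowup_density_limit:
  fixes P :: "nat \<Rightarrow> nat \<Rightarrow> 'v set"
  assumes P: "\<And>n. blowup_parts C5 (P n)"
    and x: "\<And>i. i < 5 \<Longrightarrow> (\<lambda>n. real (card (P n i)) / real n) \<longlonglongrightarrow> x i" and x1: "(\<Sum>i<5. x i) = 1"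
  shows "(\<lambda>n. density F38 (blowup C5 (P n))) \<longlonglongrightarrow> 180 * copies {..<5} (adjacent C5) x"
proof (rule density_limit)
  define N where "N n = real (card (verts (blowup C5 (P n))))" for n
  have "(\<lambda>n. \<Sum>i<5. real (card (P n i)) / real n) \<longlonglongrightarrow> (\<Sum>i<5. x i)"
    by (intro tendsto_sum x) simp
  then have ratio: "(\<lambda>n. N n / real n) \<longlonglongrightarrow> 1"
    by (simp add: N_def card_verts_blowup[OF P] x1 sum_divide_distrib)
  have "filterlim (\<lambda>n. N n / real n * real n) at_top sequentially"
    by (rule filterlim_tendsto_pos_mult_at_top[OF ratio _ filterlim_real_sequentially]) simp
  moreover have "\<forall>\<^sub>F n in sequentially. N n / real n * real n = N n"
    using eventually_gt_at_top[of 0] by eventually_elim simp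
  ultimately have N: "filterlim N at_top sequentially"
    by (simp add: filterlim_cong)
  then show "filterlim (\<lambda>n. card (verts (blowup C5 (P n)))) at_top sequentially"
    unfolding N_def by (simp add: filterlim_sequentially_iff_filterlim_real)
  show "(\<lambda>n. copies (verts (blowup C5 (P n))) (adjacent (blowup C5 (P n))) (\<lambda>_. 1)
      / real (card (verts (blowup C5 (P n)))) ^ 6) \<longlonglongrightarrow> copies {..<5} (adjacent C5) x"
  proof -
    have "(\<lambda>n. (1 / (N n / real n)) * (real (card (P n i)) / real n)) \<longlonglongrightarrow> (1 / 1) * x i" if "i < 5" for i
      by (intro tendsto_intros ratio x that) simp
    then have "(\<lambda>n. copies {..<5} (adjacent C5) (\<lambda>i. (1 / (N n / real n)) * (real (card (P n i)) / real n)))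
        \<longlonglongrightarrow> copies {..<5} (adjacent C5) x"
      by (intro tendsto_copies) simp_all
    moreover have "\<forall>\<^sub>F n in sequentially. copies {..<5} (adjacent C5) (\<lambda>i. (1 / (N n / real n)) * (real (card (P n i)) / real n))
        = copies (verts (blowup C5 (P n))) (adjacent (blowup C5 (P n))) (\<lambda>_. 1) / N n ^ 6"
      using eventually_gt_at_top[of 0]
    proof eventually_elim
      case (elim n)
      have "copies {..<5} (adjacent C5) (\<lambda>i. (1 / (N n / real n)) * (real (card (P n i)) / real n))
          = copies {..<5} (adjacent C5) (\<lambda>i. (1 / N n) * real (card (P n i)))"
        using elim by (intro arg_cong[where f = "copies _ _"] ext) simp
      also have "\<dots> = copies (verts (blowup C5 (P n))) (adjacent (blowup C5 (P n))) (\<lambda>_. 1) / N n ^ 6"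
        unfolding copies_scale copies_blowup[OF P] by (simp add: power_one_over)
      finally show ?case .
    qed
    ultimately show ?thesis
      unfolding N_def[symmetric] by (simp add: tendsto_cong)
  qed
qed (rule is_graph_blowup[OF P])

text \<open>Besides the limit itself this needs one sequence of blowups with the prescribed proportions, since
without one every number would qualify as the limit density. The parts of such a sequence are cut
from different residue classes modulo \<open>5\<close>.\<close>

lemma limit_density_C5:
  assumes x: "x \<in> simplex 5"
  shows "limit_density F38 C5 x = 180 * copies {..<5} (adjacent C5) x"
proof -
  have x0: "0 \<le> x i" if "i < 5" for i using x that by (simp add: simplex_def)
  have x1: "(\<Sum>i<5. x i) = 1" using x by (simp add: simplex_def)
  define P :: "nat \<Rightarrow> nat \<Rightarrow> nat set" where "P n i = (\<lambda>k. 5 * k + i) ` {..<nat \<lfloor>x i * real n\<rfloor>}" for n i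
  have "disjoint_family_on (P n) {..<5}" for n
    unfolding disjoint_family_on_def
  proof (intro ballI impI equals0I)
    fix i j v assume *: "i \<in> {..<5}" "j \<in> {..<5}" "i \<noteq> j" "v \<in> P n i \<inter> P n j"
    from *(4) obtain k where "v = 5 * k + i" unfolding P_def by blast
    moreover from *(4) obtain l where "v = 5 * l + j" unfolding P_def by blast
    ultimately show False using *(1-3) unfolding lessThan_iff by presburger
  qed
  then have P: "blowup_parts C5 (P n)" for n
    by (simp add: blowup_parts_def verts_C5 P_def)
  have card: "card (P n i) = nat \<lfloor>x i * real n\<rfloor>" for n i
    unfolding P_def by (subst card_image) (auto simp: inj_on_def)
  have lim: "(\<lambda>n. real (card (P n i)) / real n) \<longlonglongrightarrow> x i" if i: "i < 5" for i
  proof (rule tendsto_sandwich)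
    have fl: "real (card (P n i)) = real_of_int \<lfloor>x i * real n\<rfloor>" for n
      using x0[OF i] by (simp add: card)
    show "\<forall>\<^sub>F n in sequentially. x i - 1 / real n \<le> real (card (P n i)) / real n"
      using eventually_gt_at_top[of 0]
    proof eventually_elim
      case (elim n)
      have "x i * real n - 1 \<le> real (card (P n i))" unfolding fl by linarith
      then show ?case
        using elim divide_right_mono[of "x i * real n - 1" "real (card (P n i))" "real n"]
        by (simp add: diff_divide_distrib)
    qed
    show "\<forall>\<^sub>F n in sequentially. real (card (P n i)) / real n \<le> x i"
      using eventually_gt_at_top[of 0]
    proof eventually_elim
      case (elim n)
      have "real (card (P n i)) \<le> x i * real n" unfolding fl by linarith
      then show ?case using elim by (simp add: field_simps)
    qed
    show "(\<lambda>n. x i - 1 / real n) \<longlonglongrightarrow> x i"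
      using tendsto_diff[OF tendsto_const[of "x i"] lim_const_over_n[of 1]] by simp
  qed simp
  show ?thesis
    unfolding limit_density_def
  proof (rule the_equality, intro allI impI)
    fix V :: "nat \<Rightarrow> nat \<Rightarrow> nat set"
    assume "\<forall>n. blowup_parts C5 (V n)" "\<forall>i\<in>verts C5. (\<lambda>n. real (card (V n i)) / real n) \<longlonglongrightarrow> x i"
    then show "(\<lambda>n. density F38 (blowup C5 (V n))) \<longlonglongrightarrow> 180 * copies {..<5} (adjacent C5) x"
      by (intro blowup_density_limit x1) (auto simp: verts_C5)
  next
    fix L
    assume "\<forall>V :: nat \<Rightarrow> nat \<Rightarrow> nat set. (\<forall>n. blowup_parts C5 (V n)) \<longrightarrow>
      (\<forall>i\<in>verts C5. (\<lambda>n. real (card (V n i)) / real n) \<longlonglongrightarrow> x i) \<longrightarrow>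
      (\<lambda>n. density F38 (blowup C5 (V n))) \<longlonglongrightarrow> L"
    then have "(\<lambda>n. density F38 (blowup C5 (P n))) \<longlonglongrightarrow> L"
      using P lim by (auto simp: verts_C5)
    moreover have "(\<lambda>n. density F38 (blowup C5 (P n))) \<longlonglongrightarrow> 180 * copies {..<5} (adjacent C5) x"
      by (rule blowup_density_limit[OF P lim x1])
    ultimately show "L = 180 * copies {..<5} (adjacent C5) x"
      by (rule LIMSEQ_unique)
  qed
qed

text \<open>A maximiser attains equality in \<open>C5_stable\<close> and has induced paths of positive weight, so its cyclic gap
is zero and all its weights are equal.\<close>

lemma unique_maximiser_C5: "unique_maximiser 5 F38 C5 (\<lambda>i. if i < 5 then 1/5 else 0)"
proof -
  let ?u = "\<lambda>i :: nat. if i < 5 then 1/5 else 0 :: real"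
  have u: "?u \<in> simplex 5" by (simp add: simplex_def)
  have "copies {..<5} (adjacent C5) ?u = copies {..<5} (adjacent C5) (\<lambda>_. 1/5)"
    unfolding copies_def wsum_def
    by (intro sum.cong refl arg_cong2[where f = "(*)"] prod.cong) auto
  also have "\<dots> = 40 / 62500"
    by (simp add: copies_C5_uniform power_one_over)
  finally have Lu: "copies {..<5} (adjacent C5) ?u = 40 / 62500" .
  have bound: "62500 * copies {..<5} (adjacent C5) x + cyclic_gap x * path_sum {..<5} (adjacent C5) x (\<lambda>a b c d. 1) \<le> 40"
    if "x \<in> simplex 5" for x
    using C5_stable[of x] that by (simp add: simplex_def)
  have nonneg: "0 \<le> cyclic_gap x" "0 \<le> path_sum {..<5} (adjacent C5) x (\<lambda>a b c d. 1)" if "x \<in> simplex 5" for x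
    using that by (auto simp: cyclic_gap_def simplex_def intro!: path_sum_nonneg)
  have "is_maximiser 5 F38 C5 ?u"
    unfolding is_maximiser_def
  proof (intro conjI ballI u)
    fix y assume y: "y \<in> simplex 5"
    have "0 \<le> cyclic_gap y * path_sum {..<5} (adjacent C5) y (\<lambda>a b c d. 1)"
      by (intro mult_nonneg_nonneg nonneg y)
    then show "limit_density F38 C5 y \<le> limit_density F38 C5 ?u"
      using bound[OF y] unfolding limit_density_C5[OF y] limit_density_C5[OF u] Lu by linarith
  qed
  moreover have "x i = ?u i" if max: "is_maximiser 5 F38 C5 x" and i: "i \<in> verts C5" for x i
  proof -
    have x: "x \<in> simplex 5" using max by (simp add: is_maximiser_def)
    have "limit_density F38 C5 ?u \<le> limit_density F38 C5 x"
      using max u by (simp add: is_maximiser_def)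
    then have T: "40 / 62500 \<le> copies {..<5} (adjacent C5) x"
      unfolding limit_density_C5[OF x] limit_density_C5[OF u] Lu by linarith
    have w: "0 \<le> x v" if "v \<in> {..<5}" for v using x that by (simp add: simplex_def)
    have "copies {..<5} (adjacent C5) x \<le> path_sum {..<5} (adjacent C5) x (\<lambda>a b c d. 1)"
      using copies_le_path_sum[where V = "{..<5}" and w = x and A = "adjacent C5", OF w adjacent_commute] x
      by (simp add: simplex_def)
    then have p: "0 < path_sum {..<5} (adjacent C5) x (\<lambda>a b c d. 1)"
      using T by linarith
    have "cyclic_gap x * path_sum {..<5} (adjacent C5) x (\<lambda>a b c d. 1) \<le> 0"
      using bound[OF x] T by linarith
    then have "cyclic_gap x = 0"
      using p nonneg(1)[OF x] by (simp add: mult_le_0_iff)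
    then show ?thesis
      using cyclic_gap_zero[of x 1 i] x i by (simp add: simplex_def verts_C5)
  qed
  moreover have "automorphism id C5"
    by (simp add: automorphism_def is_iso_def)
  ultimately show ?thesis
    unfolding unique_maximiser_def by (metis id_apply)
qed

lemma finite_densities:
  "finite {density F G |G :: nat pattern. is_graph G \<and> card (verts G) = n}"
proof (rule finite_subset)
  show "{density F G |G :: nat pattern. is_graph G \<and> card (verts G) = n}
      \<subseteq> (\<lambda>k. real k / real (n choose card (verts F))) ` {..2 ^ n}"
  proof
    fix d assume "d \<in> {density F G |G :: nat pattern. is_graph G \<and> card (verts G) = n}"
    then obtain G :: "nat pattern" where G: "is_graph G" "card (verts G) = n" "d = density F G" by blast
    let ?X = "{S. S \<subseteq> verts G \<and> card S = card (verts F) \<and> isomorphic (induced G S) F}"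
    have "card ?X \<le> card (Pow (verts G))"
      using graph_adjacent(1)[OF G(1)] by (intro card_mono) auto
    then have "card ?X \<in> {..2 ^ n}"
      using G graph_adjacent(1)[OF G(1)] by (simp add: card_Pow)
    then show "d \<in> (\<lambda>k. real k / real (n choose card (verts F))) ` {..2 ^ n}"
      using G by (auto simp: density_def)
  qed
qed simp

lemma density_le_max:
  fixes G :: "nat pattern"
  shows "is_graph G \<Longrightarrow> density F G \<le> max_density F (card (verts G))"
  unfolding max_density_def by (rule Max_ge[OF finite_densities]) blast

lemma max_density_attained:
  obtains G :: "nat pattern" where "is_graph G" "card (verts G) = n" "max_density F n = density F G"
proof -
  let ?D = "{density F G |G :: nat pattern. is_graph G \<and> card (verts G) = n}"
  have "is_graph ({..<n}, {})" "card (verts ({..<n}, {})) = n"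
    by (simp_all add: is_graph_def is_pattern_def)
  then have "?D \<noteq> {}" by blast
  then have "max_density F n \<in> ?D"
    unfolding max_density_def by (rule Max_in[OF finite_densities])
  then show thesis using that by blast
qed

lemma density_le:
  assumes "is_graph G"
  shows "density F38 G \<le> 40 / 62500 * (real (card (verts G)) ^ 6 / (4 * real (card (verts G) choose 6)))"
proof -
  let ?V = "verts G"
  have "62500 * copies ?V (adjacent G) (\<lambda>_. 1) \<le> 40 * real (card ?V) ^ 6"
    using copies_le[where V = ?V and w = "\<lambda>_. 1" and A = "adjacent G", OF _ adjacent_commute graph_adjacent(2)[OF assms]]
    by simp
  then have "real (card (embeddings ?V (adjacent G))) \<le> 40 / 62500 * real (card ?V) ^ 6"
    using embeddings_le_copies[OF graph_adjacent(1)[OF assms], of "adjacent G"] by linarith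
  then show ?thesis
    unfolding density_F38[OF assms] times_divide_eq_right by (rule divide_right_mono) simp
qed

definition residue_classes :: "nat \<Rightarrow> nat \<Rightarrow> nat set" where
  "residue_classes n i = {v. v < n \<and> v mod 5 = i}"

lemma blowup_parts_residue_classes: "blowup_parts C5 (residue_classes n)"
  by (auto simp: blowup_parts_def disjoint_family_on_def residue_classes_def)

lemma card_residue_classes: "i < 5 \<Longrightarrow> card (residue_classes n i) = (n + 4 - i) div 5"
proof (induction n)
  case (Suc n)
  have "residue_classes (Suc n) i = (if n mod 5 = i then insert n (residue_classes n i) else residue_classes n i)"
    by (auto simp: residue_classes_def less_Suc_eq)
  moreover have "n \<notin> residue_classes n i" "finite (residue_classes n i)"
    by (auto simp: residue_classes_def)
  ultimately have "card (residue_classes (Suc n) i) = (n + 4 - i) div 5 + (if n mod 5 = i then 1 else 0)"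
    using Suc by simp
  also have "\<dots> = (Suc n + 4 - i) div 5"
  proof -
    define q r where "q = n div 5" and "r = n mod 5"
    have n: "n = 5 * q + r" "r < 5" "n mod 5 = r" by (simp_all add: q_def r_def)
    have "(n + 4 - i) div 5 = q + (if i < r then 1 else 0)"
      by (rule div_nat_eqI) (use n Suc.prems in auto)
    moreover have "(Suc n + 4 - i) div 5 = q + (if i \<le> r then 1 else 0)"
      by (rule div_nat_eqI) (use n Suc.prems in auto)
    ultimately show ?thesis using n(3) by auto
  qed
  finally show ?case .
qed (simp add: residue_classes_def)

text \<open>The upper bound is the flag inequality with unit weights; the lower bound comes from the blowups whose parts are
the residue classes modulo \<open>5\<close>.\<close>

lemma max_density_limit: "max_density F38 \<longlonglongrightarrow> 72/625"
proof (rule tendsto_sandwich)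
  have lim: "(\<lambda>n. real (card (residue_classes n i)) / real n) \<longlonglongrightarrow> 1/5" if i: "i < 5" for i
  proof (rule tendsto_sandwich)
    have c: "real n / 5 - 1 \<le> real (card (residue_classes n i))" "real (card (residue_classes n i)) \<le> real n / 5 + 1" for n
    proof -
      have "n \<le> 5 * ((n + 4 - i) div 5) + 5" "5 * ((n + 4 - i) div 5) \<le> n + 5"
        using i by linarith+
      then show "real n / 5 - 1 \<le> real (card (residue_classes n i))" "real (card (residue_classes n i)) \<le> real n / 5 + 1"
        unfolding card_residue_classes[OF i] by linarith+
    qed
    show "\<forall>\<^sub>F n in sequentially. 1/5 - 1 / real n \<le> real (card (residue_classes n i)) / real n"
      using eventually_gt_at_top[of 0]
    proof eventually_elim
      case (elim n)
      then show ?case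
        using divide_right_mono[OF c(1), of "real n" n] by (simp add: diff_divide_distrib)
    qed
    show "\<forall>\<^sub>F n in sequentially. real (card (residue_classes n i)) / real n \<le> 1/5 + 1 / real n"
      using eventually_gt_at_top[of 0]
    proof eventually_elim
      case (elim n)
      then show ?case
        using divide_right_mono[OF c(2), of "real n" n] by (simp add: add_divide_distrib)
    qed
    show "(\<lambda>n. 1/5 - 1 / real n) \<longlonglongrightarrow> 1/5"
      using tendsto_diff[OF tendsto_const[of "1/5 :: real"] lim_const_over_n[of 1]] by simp
    show "(\<lambda>n. 1/5 + 1 / real n) \<longlonglongrightarrow> 1/5"
      using tendsto_add[OF tendsto_const[of "1/5 :: real"] lim_const_over_n[of 1]] by simp
  qed
  have "(\<lambda>n. density F38 (blowup C5 (residue_classes n))) \<longlonglongrightarrow> 180 * copies {..<5} (adjacent C5) (\<lambda>_. 1/5)"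
    by (rule blowup_density_limit[OF blowup_parts_residue_classes lim]) simp_all
  then show "(\<lambda>n. density F38 (blowup C5 (residue_classes n))) \<longlonglongrightarrow> 72/625"
    by (simp add: copies_C5_uniform power_one_over)
  have "card (verts (blowup C5 (residue_classes n))) = n" for n
  proof -
    have "(\<Union>i<5. residue_classes n i) = {..<n}"
      by (auto simp: residue_classes_def)
    then show ?thesis by (simp add: verts_blowup[OF blowup_parts_residue_classes])
  qed
  then show "\<forall>\<^sub>F n in sequentially. density F38 (blowup C5 (residue_classes n)) \<le> max_density F38 n"
    using density_le_max[OF is_graph_blowup[OF blowup_parts_residue_classes]] by (metis (mono_tags) always_eventually)
  show "(\<lambda>n. 40 / 62500 * (real n ^ 6 / (4 * real (n choose 6)))) \<longlonglongrightarrow> 72/625"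
    using tendsto_mult[OF tendsto_const[of "40 / 62500 :: real"] power_over_binomial] by simp
  show "\<forall>\<^sub>F n in sequentially. max_density F38 n \<le> 40 / 62500 * (real n ^ 6 / (4 * real (n choose 6)))"
  proof (intro always_eventually allI)
    fix n
    obtain G :: "nat pattern" where "is_graph G" "card (verts G) = n" "max_density F38 n = density F38 G"
      by (rule max_density_attained)
    then show "max_density F38 n \<le> 40 / 62500 * (real n ^ 6 / (4 * real (n choose 6)))"
      using density_le[of G] by simp
  qed
qed

section \<open>Changing a graph and its weights\<close>

lemma copies_weight_cong: "(\<And>v. v \<in> V \<Longrightarrow> w v = w' v) \<Longrightarrow> copies V A w = copies V A w'"
  unfolding copies_def wsum_def
  by (intro sum.cong refl arg_cong2[where f = "(*)"] prod.cong) auto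

definition disagreement :: "'v set \<Rightarrow> ('v \<Rightarrow> 'v \<Rightarrow> bool) \<Rightarrow> ('v \<Rightarrow> 'v \<Rightarrow> bool) \<Rightarrow> ('v \<times> 'v) set" where
  "disagreement V A B = {(u, v). u \<in> V \<and> v \<in> V \<and> A u v \<noteq> B u v}"

lemma finite_disagreement: "finite V \<Longrightarrow> finite (disagreement V A B)"
  by (rule finite_subset[of _ "V \<times> V"]) (auto simp: disagreement_def)

text \<open>Two graphs can only differ in whether a draw shows \<open>F38\<close> if the draw hits a disagreement. The factor \<open>c\<close>
covers the three applications below: unit weights, the change of weights, and the restriction to
draws with repeated vertices.\<close>

lemma perturbation_bound:
  fixes V :: "'v set" and c :: "(ix \<Rightarrow> 'v) \<Rightarrow> real" and \<theta> :: real
  assumes V: "finite V" and \<theta>: "0 \<le> \<theta>"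
    and c: "\<And>x. range x \<subseteq> V \<Longrightarrow> \<bar>c x\<bar> \<le> \<theta>" "\<And>x. range x \<subseteq> V \<Longrightarrow> \<not> Q x \<Longrightarrow> c x = 0"
  shows "\<bar>\<Sum>x | range x \<subseteq> V. c x * (of_bool (F38_at B (x I0) (x I1) (x I2) (x I3) (x I4) (x I5))
      - of_bool (F38_at A (x I0) (x I1) (x I2) (x I3) (x I4) (x I5)))\<bar>
    \<le> \<theta> * card {x :: ix \<Rightarrow> 'v. range x \<subseteq> V \<and> hits (disagreement V A B) x \<and> Q x}"
    (is "\<bar>\<Sum>x | _. c x * ?d x\<bar> \<le> _")
proof -
  let ?S = "disagreement V A B"
  have "\<bar>c x * ?d x\<bar> \<le> (if hits ?S x \<and> Q x then \<theta> else 0)" if x: "range x \<subseteq> V" for x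
  proof (cases "hits ?S x")
    case True
    have "\<bar>?d x\<bar> \<le> 1" by (simp add: of_bool_def)
    then have "\<bar>c x\<bar> * \<bar>?d x\<bar> \<le> \<theta> * 1"
      using c(1)[OF x] \<theta> by (intro mult_mono) simp_all
    then show ?thesis using True c(2)[OF x] by (auto simp: abs_mult)
  next
    case False
    then have "A (x i) (x j) = B (x i) (x j)" for i j
      using rangeI[of x i] rangeI[of x j] x by (auto simp: hits_def disagreement_def subset_eq)
    then show ?thesis using False by (simp add: F38_at_def)
  qed
  then have "\<bar>\<Sum>x | range x \<subseteq> V. c x * ?d x\<bar> \<le> (\<Sum>x | range x \<subseteq> V. if hits ?S x \<and> Q x then \<theta> else 0)"
    by (intro order_trans[OF sum_abs] sum_mono) simp
  also have "\<dots> = \<theta> * card {x :: ix \<Rightarrow> 'v. range x \<subseteq> V \<and> hits ?S x \<and> Q x}"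
    using finite_tuples[OF V] by (simp add: sum.If_cases Int_def mult.commute conj_assoc)
  finally show ?thesis .
qed

context
  fixes V :: "'v set" and A B :: "'v \<Rightarrow> 'v \<Rightarrow> bool"
  assumes V: "finite V" and irrA: "\<And>v. \<not> A v v" and irrB: "\<And>v. \<not> B v v"
begin

lemma card_hits_disagreement:
  "real (card {x. range x \<subseteq> V \<and> hits (disagreement V A B) x}) \<le> 36 * real (card (disagreement V A B)) * real (card V) ^ 4"
proof -
  have "card {x. range x \<subseteq> V \<and> hits (disagreement V A B) x} \<le> 36 * card (disagreement V A B) * card V ^ 4"
    by (rule card_hits[OF V finite_disagreement[OF V]]) (simp add: disagreement_def irrA irrB)
  then have "real (card {x. range x \<subseteq> V \<and> hits (disagreement V A B) x}) \<le> real (36 * card (disagreement V A B) * card V ^ 4)"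
    by (rule of_nat_mono)
  then show ?thesis by simp
qed

lemma copies_difference:
  "copies V A (\<lambda>_. 1) - copies V B (\<lambda>_. 1) \<le> 36 * real (card (disagreement V A B)) * real (card V) ^ 4"
proof -
  have "\<bar>copies V B (\<lambda>_. 1) - copies V A (\<lambda>_. 1)\<bar> \<le> 1 * card {x. range x \<subseteq> V \<and> hits (disagreement V A B) x \<and> True}"
    using perturbation_bound[OF V, of 1 "\<lambda>_. 1" "\<lambda>_. True" B A]
    by (simp add: copies_def wsum_def sum_subtractf)
  then show ?thesis
    using card_hits_disagreement by simp
qed

lemma copies_reweighting:
  assumes \<theta>: "0 \<le> \<theta>" and w: "\<And>x. range x \<subseteq> V \<Longrightarrow> \<bar>(\<Prod>i\<in>(UNIV :: ix set). w (x i)) - 1\<bar> \<le> \<theta>"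
  shows "(copies V B w - copies V A w) - (copies V B (\<lambda>_. 1) - copies V A (\<lambda>_. 1))
    \<le> \<theta> * (36 * real (card (disagreement V A B)) * real (card V) ^ 4)"
proof -
  have "\<bar>(copies V B w - copies V A w) - (copies V B (\<lambda>_. 1) - copies V A (\<lambda>_. 1))\<bar>
      \<le> \<theta> * card {x. range x \<subseteq> V \<and> hits (disagreement V A B) x \<and> True}"
    using perturbation_bound[OF V \<theta>, of "\<lambda>x. (\<Prod>i\<in>UNIV. w (x i)) - 1" "\<lambda>_. True" B A] w
    by (simp add: copies_def wsum_def sum_subtractf[symmetric] algebra_simps)
  also have "\<dots> \<le> \<theta> * (36 * real (card (disagreement V A B)) * real (card V) ^ 4)"
    using card_hits_disagreement by (intro mult_left_mono \<theta>) simp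
  finally show ?thesis by linarith
qed

lemma embeddings_difference:
  "(copies V B (\<lambda>_. 1) - copies V A (\<lambda>_. 1)) - (real (card (embeddings V B)) - real (card (embeddings V A)))
    \<le> 1296 * real (card (disagreement V A B)) * real (card V) ^ 3"
proof -
  have emb: "real (card (embeddings V E)) = (\<Sum>x | range x \<subseteq> V. of_bool (inj x) *
      of_bool (F38_at E (x I0) (x I1) (x I2) (x I3) (x I4) (x I5)))" for E
    unfolding of_bool_conj[symmetric] embeddings_def
    using finite_tuples[OF V] by (simp add: of_bool_def sum.If_cases Int_def)
  have "(copies V B (\<lambda>_. 1) - copies V A (\<lambda>_. 1)) - (real (card (embeddings V B)) - real (card (embeddings V A)))
      = (\<Sum>x | range x \<subseteq> V. of_bool (\<not> inj x) * (of_bool (F38_at B (x I0) (x I1) (x I2) (x I3) (x I4) (x I5))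
      - of_bool (F38_at A (x I0) (x I1) (x I2) (x I3) (x I4) (x I5))))"
    unfolding emb copies_def wsum_def sum_subtractf[symmetric]
    by (intro sum.cong refl) (simp add: of_bool_def)
  also have "\<dots> \<le> 1 * card {x. range x \<subseteq> V \<and> hits (disagreement V A B) x \<and> \<not> inj x}"
    using perturbation_bound[OF V, of 1 "\<lambda>x. of_bool (\<not> inj x)" "\<lambda>x. \<not> inj x" B A] by simp
  also have "\<dots> \<le> real (1296 * card (disagreement V A B) * card V ^ 3)"
    using card_hits_not_inj[OF V finite_disagreement[OF V], of A B] irrA irrB
    by (simp add: disagreement_def del: of_nat_mult of_nat_power)
  finally show ?thesis by simp
qed

end

lemma path_sum_misfits:
  "path_sum V A w (misfits V A w) = wsum V w (\<lambda>x. of_bool (path_at A (x I0) (x I1) (x I2) (x I3)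
     \<and> misfit (role A (x I0) (x I1) (x I2) (x I3) (x I4)) (role A (x I0) (x I1) (x I2) (x I3) (x I5)) (A (x I4) (x I5))))"
  unfolding wsum_nested path_sum_def misfits_def ix.case
  by (intro sum.cong refl arg_cong2[where f = "(*)"]) simp

lemma path_sum_pos_ex:
  assumes "0 < path_sum V A w (\<lambda>a b c d. 1)"
  shows "\<exists>a b c d. {a, b, c, d} \<subseteq> V \<and> path_at A a b c d"
proof (rule ccontr)
  assume *: "\<not> ?thesis"
  have "path_sum V A w (\<lambda>a b c d. 1) = (\<Sum>a\<in>V. w a * (\<Sum>b\<in>V. w b * (\<Sum>c\<in>V. w c * (\<Sum>d\<in>V. w d * 0))))"
    unfolding path_sum_def by (intro sum.cong refl arg_cong2[where f = "(*)"]) (use * in auto)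
  then show False using assms by simp
qed

text \<open>An induced path whose number of misfits is at most the average.\<close>

lemma best_path:
  assumes V: "finite V" and pos: "0 < path_sum V A (\<lambda>_. 1) (\<lambda>a b c d. 1)"
  obtains a b c d where "{a, b, c, d} \<subseteq> V" "path_at A a b c d"
    "misfits V A (\<lambda>_. 1) a b c d * path_sum V A (\<lambda>_. 1) (\<lambda>a b c d. 1) \<le> path_sum V A (\<lambda>_. 1) (misfits V A (\<lambda>_. 1))"
proof -
  let ?Q = "{(a, b, c, d). {a, b, c, d} \<subseteq> V \<and> path_at A a b c d}"
  let ?f = "\<lambda>(a, b, c, d). misfits V A (\<lambda>_. 1) a b c d"
  have "finite ?Q"
    by (rule finite_subset[of _ "V \<times> V \<times> V \<times> V"]) (use V in auto)
  moreover have "?Q \<noteq> {}" using path_sum_pos_ex[OF pos] by auto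
  ultimately have "Min (?f ` ?Q) \<in> ?f ` ?Q" "\<And>q. q \<in> ?Q \<Longrightarrow> Min (?f ` ?Q) \<le> ?f q"
    by (auto intro!: Min_in)
  then obtain a b c d where q: "{a, b, c, d} \<subseteq> V" "path_at A a b c d"
    and min: "\<And>a' b' c' d'. {a', b', c', d'} \<subseteq> V \<Longrightarrow> path_at A a' b' c' d' \<Longrightarrow>
      misfits V A (\<lambda>_. 1) a b c d \<le> misfits V A (\<lambda>_. 1) a' b' c' d'"
    by force
  have "misfits V A (\<lambda>_. 1) a b c d * path_sum V A (\<lambda>_. 1) (\<lambda>a b c d. 1) \<le> path_sum V A (\<lambda>_. 1) (misfits V A (\<lambda>_. 1))"
    unfolding path_sum_cmult[symmetric] by (rule path_sum_mono) (simp_all add: min)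
  with q show thesis by (rule that)
qed

text \<open>\<open>B\<close> is the blowup defined by the views of the path, so every pair on which \<open>A\<close> and \<open>B\<close> disagree is
a misfit.\<close>

lemma card_disagreement_le_misfits:
  assumes V: "finite V"
    and B: "\<And>u v. u \<in> V \<Longrightarrow> v \<in> V \<Longrightarrow>
      B u v = adjacent C5 (class_of (role A a b c d u)) (class_of (role A a b c d v))"
  shows "real (card (disagreement V A B)) \<le> misfits V A (\<lambda>_. 1) a b c d"
proof -
  have "real (card (disagreement V A B)) = (\<Sum>p\<in>V \<times> V. of_bool (p \<in> disagreement V A B))"
    using V by (simp add: of_bool_def sum.If_cases disagreement_def Int_def case_prod_beta' mem_Times_iff conj_assoc)
  also have "\<dots> = (\<Sum>u\<in>V. \<Sum>v\<in>V. of_bool ((u, v) \<in> disagreement V A B))"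
    by (simp add: sum.cartesian_product)
  also have "\<dots> \<le> misfits V A (\<lambda>_. 1) a b c d"
    unfolding misfits_def mult_1
    by (intro sum_mono) (use B misfit_if_wrong in \<open>auto simp: disagreement_def of_bool_def\<close>)
  finally show ?thesis .
qed

lemma prod_near_one:
  fixes f :: "ix \<Rightarrow> real"
  assumes "\<And>i. \<bar>f i - 1\<bar> \<le> 1 / 10 ^ 10"
  shows "\<bar>(\<Prod>i\<in>UNIV. f i) - 1\<bar> \<le> 1 / 10 ^ 9"
proof -
  have f: "1 - 1 / 10 ^ 10 \<le> f i" "f i \<le> 1 + 1 / 10 ^ 10" for i
    using assms[of i] by linarith+
  have "0 \<le> f i" for i using f(1)[of i] by (rule order_trans[rotated]) simp
  note pos = this
  have "(\<Prod>i\<in>(UNIV :: ix set). f i) \<le> (\<Prod>i\<in>(UNIV :: ix set). 1 + 1 / 10 ^ 10)"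
    by (intro prod_mono conjI f(2) pos)
  moreover have "(\<Prod>i\<in>(UNIV :: ix set). 1 - 1 / 10 ^ 10) \<le> (\<Prod>i\<in>(UNIV :: ix set). f i)"
    by (intro prod_mono conjI f(1)) simp
  moreover have "(1 + 1 / 10 ^ 10 :: real) ^ 6 \<le> 1 + 1 / 10 ^ 9" "1 - 1 / 10 ^ 9 \<le> (1 - 1 / 10 ^ 10 :: real) ^ 6"
    by (simp_all add: power_divide)
  ultimately show ?thesis
    unfolding prod_constant card_UNIV_ix by linarith
qed

section \<open>Perfect stability\<close>

lemma cyclic_gap_small:
  assumes gap: "cyclic_gap y \<le> (\<epsilon> * n)\<^sup>2" and \<epsilon>: "0 \<le> \<epsilon> * n" and y: "(\<Sum>i<5. y i) = n" and i: "i < 5"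
  shows "\<bar>5 * y i - n\<bar> \<le> 8 * (\<epsilon> * n)"
proof -
  have sq: "\<bar>u\<bar> \<le> \<epsilon> * n" if "u\<^sup>2 \<le> (\<epsilon> * n)\<^sup>2" for u
    using that \<epsilon> by (simp add: power2_le_iff_abs_le)
  have "\<bar>y 0 - y 1\<bar> \<le> \<epsilon> * n" "\<bar>y 1 - y 2\<bar> \<le> \<epsilon> * n" "\<bar>y 2 - y 3\<bar> \<le> \<epsilon> * n" "\<bar>y 3 - y 4\<bar> \<le> \<epsilon> * n" "\<bar>y 4 - y 0\<bar> \<le> \<epsilon> * n"
    using gap unfolding cyclic_gap_def
    by (intro sq order_trans[OF _ gap[unfolded cyclic_gap_def]]; simp)+
  moreover have "y 0 + y 1 + y 2 + y 3 + y 4 = n"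
    using y by (simp add: eval_nat_numeral)
  moreover have "i \<in> {0, 1, 2, 3, 4}" using i by auto
  ultimately show ?thesis by (elim insertE emptyE) (simp_all add: abs_le_iff)
qed

text \<open>The thresholds \<open>10^11\<close> and \<open>1/10^36\<close> are chosen generously so that every error below is dominated: there are at least
\<open>39/62500 n^4\<close> induced paths, each with at least as many misfits as the chosen path, and this gain has to exceed the cost of
changing the weights by \<open>1/10^10\<close> and that of the draws with repeated vertices.\<close>

lemma near_extremal:
  fixes G :: "nat pattern"
  assumes G: "is_graph G" and n: "n = real (card (verts G))" "10 ^ 11 \<le> n"
    and near: "(40 - 1 / 10 ^ 36) * n ^ 6 \<le> 62500 * copies (verts G) (adjacent G) (\<lambda>_. 1)"
  obtains P where "blowup_parts C5 P" "verts (blowup C5 P) = verts G"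
    "real (card (disagreement (verts G) (adjacent G) (adjacent (blowup C5 P)))) * n ^ 4 \<le> 250 * 62500 *
      (real (card (embeddings (verts G) (adjacent (blowup C5 P)))) - real (card (embeddings (verts G) (adjacent G))))"
proof -
  let ?V = "verts G" and ?A = "adjacent G"
  note V = graph_adjacent(1)[OF G]
  have irrA: "\<not> ?A v v" for v by (rule graph_adjacent(2)[OF G])
  have n0: "0 < n" using n(2) by (rule less_le_trans[rotated]) simp
  have p6: "n ^ 6 = n\<^sup>2 * n ^ 4" by (simp add: power_add[symmetric])
  have cancel: "u \<le> v" if "n ^ k * u \<le> n ^ k * v" for u v and k :: nat
    using that n0 by (simp only: mult_le_cancel_left_pos zero_less_power)
  have sumV: "(\<Sum>v\<in>?V. 1) = n" by (simp add: n(1))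
  define Pn where "Pn = path_sum ?V ?A (\<lambda>_. 1) (\<lambda>a b c d. 1)"
  have Pn: "39 / 62500 * n ^ 4 \<le> Pn"
  proof -
    have "39 * n ^ 6 \<le> (40 - 1 / 10 ^ 36) * n ^ 6"
      using n0 by (intro mult_right_mono) simp_all
    also have "\<dots> \<le> 62500 * (n\<^sup>2 * Pn)"
      using near copies_le_path_sum[where V = ?V and w = "\<lambda>_. 1" and A = ?A, OF _ adjacent_commute]
      by (simp add: Pn_def n(1))
    finally have "n\<^sup>2 * (39 * n ^ 4) \<le> n\<^sup>2 * (62500 * Pn)"
      by (simp only: p6 mult.left_commute)
    then have "39 * n ^ 4 \<le> 62500 * Pn" by (rule cancel)
    then show ?thesis by simp
  qed
  have "0 < n ^ 4" using n0 by simp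
  then have "0 < Pn" using Pn by linarith
  then obtain a b c d where path: "{a, b, c, d} \<subseteq> ?V" "path_at ?A a b c d"
    and best: "misfits ?V ?A (\<lambda>_. 1) a b c d * Pn \<le> path_sum ?V ?A (\<lambda>_. 1) (misfits ?V ?A (\<lambda>_. 1))"
    unfolding Pn_def by (rule best_path[OF V])
  define m where "m = misfits ?V ?A (\<lambda>_. 1) a b c d"
  define M where "M = path_sum ?V ?A (\<lambda>_. 1) (misfits ?V ?A (\<lambda>_. 1))"
  have m0: "0 \<le> m" unfolding m_def by (rule misfits_nonneg) simp
  have mM: "39 / 62500 * (n ^ 4 * m) \<le> M"
    using mult_right_mono[OF Pn m0] best by (simp add: m_def M_def mult.commute)
  define \<delta> :: real where "\<delta> = 1 / 10 ^ 36"
  have near': "40 * n ^ 6 - \<delta> * n ^ 6 \<le> 62500 * copies ?V ?A (\<lambda>_. 1)"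
    using near by (simp only: left_diff_distrib \<delta>_def)
  have \<delta>n: "0 \<le> \<delta> * n\<^sup>2" "0 \<le> \<delta> * n ^ 6" "0 \<le> n ^ 6" "\<delta> * n ^ 6 \<le> 1 / 10000000000 * n ^ 6"
    using n0 by (simp_all add: \<delta>_def)
  define \<kappa> where "\<kappa> v = class_of (role ?A a b c d v)" for v
  define P where "P i = {v \<in> ?V. \<kappa> v = i}" for i
  have \<kappa>5: "\<kappa> v < 5" for v by (simp add: \<kappa>_def class_of_less)
  have P: "blowup_parts C5 P"
    using V by (auto simp: blowup_parts_def disjoint_family_on_def P_def)
  have VP: "verts (blowup C5 P) = ?V"
    using \<kappa>5 by (auto simp: verts_blowup[OF P] P_def)
  have part: "part P v = \<kappa> v" if "v \<in> ?V" for v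
    using part_eq[OF P \<kappa>5[of v], of v] that by (simp add: P_def)
  let ?B = "adjacent (blowup C5 P)"
  have B: "?B u v = adjacent C5 (\<kappa> u) (\<kappa> v)" if "u \<in> ?V" "v \<in> ?V" for u v
    using that by (simp add: adjacent_blowup[OF P] VP part)
  have irrB: "\<not> ?B v v" for v by (rule graph_adjacent(2)[OF is_graph_blowup[OF P]])
  define s where "s = real (card (disagreement ?V ?A ?B))"
  have sm: "s \<le> m"
    unfolding s_def m_def by (rule card_disagreement_le_misfits[OF V]) (simp add: B \<kappa>_def)
  have s0: "0 \<le> s" by (simp add: s_def)
  define y where "y i = real (card (P i))" for i
  have ysum: "(\<Sum>i<5. y i) = n"
    using card_verts_blowup[OF P] by (simp add: y_def n(1) VP)
  have y0: "0 \<le> y i" for i by (simp add: y_def)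
  have yB: "copies ?V ?B (\<lambda>_. 1) = copies {..<5} (adjacent C5) y"
    using copies_blowup[OF P] by (simp add: VP y_def[abs_def])

  \<comment> \<open>The chosen path sees few misfits, so the blowup is close to \<open>G\<close> and hence almost balanced.\<close>
  have flag1: "62500 * copies ?V ?A (\<lambda>_. 1) + 18 * M \<le> 40 * n ^ 6"
  proof -
    have "18 * M \<le> path_sum ?V ?A (\<lambda>_. 1) (\<lambda>a b c d. imbalance ?V ?A (\<lambda>_. 1) a b c d + 18 * misfits ?V ?A (\<lambda>_. 1) a b c d)"
      unfolding M_def path_sum_cmult[symmetric] by (rule path_sum_mono) (simp_all add: imbalance_nonneg)
    then show ?thesis
      using flag_inequality[where V = ?V and w = "\<lambda>_. 1" and A = ?A, OF _ adjacent_commute irrA] by (simp add: n(1))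
  qed
  have m_le: "m \<le> 90 * (\<delta> * n\<^sup>2)"
  proof -
    have "18 * (39 / 62500 * (n ^ 4 * m)) \<le> \<delta> * n ^ 6"
      using flag1 near' mM by linarith
    also have "n ^ 6 = n ^ 4 * n\<^sup>2" by (simp add: power_add[symmetric])
    finally have "n ^ 4 * (18 * (39 / 62500 * m)) \<le> n ^ 4 * (\<delta> * n\<^sup>2)"
      by (simp only: mult_ac)
    then have "18 * (39 / 62500 * m) \<le> \<delta> * n\<^sup>2"
      by (rule cancel)
    then show ?thesis using \<delta>n(1) by linarith
  qed
  have gap: "cyclic_gap y \<le> (1 / 10 ^ 12 * n)\<^sup>2"
  proof -
    have "s * n ^ 4 \<le> 90 * (\<delta> * n ^ 6)"
    proof -
      have "s * n ^ 4 \<le> 90 * (\<delta> * n\<^sup>2) * n ^ 4"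
        using sm m_le n0 by (intro mult_right_mono) simp_all
      then show ?thesis by (simp only: p6 mult.assoc)
    qed
    moreover have "copies ?V ?A (\<lambda>_. 1) - copies {..<5} (adjacent C5) y \<le> 36 * (s * n ^ 4)"
      using copies_difference[where V = ?V and A = ?A and B = ?B, OF V irrA irrB]
      unfolding yB[symmetric] n(1)[symmetric] s_def[symmetric] by simp
    ultimately have close: "40 * n ^ 6 - 300000000 * (\<delta> * n ^ 6) \<le> 62500 * copies {..<5} (adjacent C5) y"
      using near' \<delta>n by linarith
    define P5 where "P5 = path_sum {..<5} (adjacent C5) y (\<lambda>a b c d. 1)"
    have P5: "39 / 62500 * n ^ 4 \<le> P5"
    proof -
      have "39 * n ^ 6 \<le> 40 * n ^ 6 - 300000000 * (\<delta> * n ^ 6)"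
        using \<delta>n by linarith
      also have "\<dots> \<le> 62500 * (n\<^sup>2 * P5)"
        using close copies_le_path_sum[where V = "{..<5}" and w = y and A = "adjacent C5", OF y0 adjacent_commute]
        unfolding P5_def ysum by linarith
      finally have "n\<^sup>2 * (39 * n ^ 4) \<le> n\<^sup>2 * (62500 * P5)"
        by (simp only: p6 mult.left_commute)
      then have "39 * n ^ 4 \<le> 62500 * P5" by (rule cancel)
      then show ?thesis by simp
    qed
    have gap0: "0 \<le> cyclic_gap y" by (simp add: cyclic_gap_def)
    have "cyclic_gap y * (39 / 62500 * n ^ 4) \<le> cyclic_gap y * P5"
      by (rule mult_left_mono[OF P5 gap0])
    also have "\<dots> \<le> 300000000 * (\<delta> * n ^ 6)"
      using C5_stable[of y, OF y0] close unfolding P5_def ysum by linarith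
    also have "n ^ 6 = n ^ 4 * n\<^sup>2" by (simp add: power_add[symmetric])
    finally have "n ^ 4 * (39 / 62500 * cyclic_gap y) \<le> n ^ 4 * (300000000 * (\<delta> * n\<^sup>2))"
      by (simp only: mult_ac)
    then have "39 / 62500 * cyclic_gap y \<le> 300000000 * (\<delta> * n\<^sup>2)"
      by (rule cancel)
    then have "cyclic_gap y \<le> 500000000000 * (\<delta> * n\<^sup>2)"
      using \<delta>n(1) by linarith
    also have "\<dots> \<le> (1 / 10 ^ 12 * n)\<^sup>2"
      by (simp add: \<delta>_def power_mult_distrib power_divide)
    finally show ?thesis .
  qed
  have balanced: "\<bar>5 * y i - n\<bar> \<le> n / 100000000000" if "i < 5" for i
  proof -
    have "\<bar>5 * y i - n\<bar> \<le> 8 * (1 / 10 ^ 12 * n)"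
      using n0 by (intro cyclic_gap_small[OF gap _ ysum that]) simp
    also have "\<dots> \<le> n / 100000000000" using n0 by simp
    finally show ?thesis .
  qed
  have ypos: "0 < y i" if "i < 5" for i
    using balanced[OF that] n0 by linarith

  \<comment> \<open>Vertex weights that make the blowup exactly balanced, hence exactly extremal.\<close>
  define w where "w v = n / (5 * y (\<kappa> v))" for v
  have w0: "0 \<le> w v" for v using n0 ypos[OF \<kappa>5] by (simp add: w_def less_imp_le)
  have w1: "\<bar>w v - 1\<bar> \<le> 1 / 10 ^ 10" for v
  proof -
    let ?y = "y (\<kappa> v)"
    have "\<bar>w v - 1\<bar> = \<bar>5 * ?y - n\<bar> / (5 * ?y)"
      using ypos[OF \<kappa>5, of v] by (simp add: w_def abs_if field_simps)
    also have "\<dots> \<le> 1 / 10 ^ 10"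
    proof -
      have "\<bar>5 * ?y - n\<bar> \<le> 1 / 10000000000 * (5 * ?y)"
        using balanced[OF \<kappa>5, of v] n0 by linarith
      then show ?thesis using ypos[OF \<kappa>5, of v] by (simp add: divide_le_eq)
    qed
    finally show ?thesis .
  qed
  have prod: "\<bar>(\<Prod>i\<in>(UNIV :: ix set). w (x i)) - 1\<bar> \<le> 1 / 1000000000" for x
    by (rule order_trans[OF prod_near_one[OF w1]]) simp
  have wclass: "(\<Sum>v | v \<in> ?V \<and> \<kappa> v = i. w v) = n / 5" if "i < 5" for i
  proof -
    have "(\<Sum>v | v \<in> ?V \<and> \<kappa> v = i. w v) = y i * (n / (5 * y i))"
      by (simp add: w_def y_def P_def)
    then show ?thesis using ypos[OF that] by simp
  qed
  have wsumV: "(\<Sum>v\<in>?V. w v) = n"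
  proof -
    have "(\<Sum>v\<in>?V. w v) = (\<Sum>i<5. \<Sum>v | v \<in> ?V \<and> \<kappa> v = i. w v)"
      by (rule sum.group[symmetric]) (use V \<kappa>5 in auto)
    also have "\<dots> = (\<Sum>i<(5::nat). n / 5)"
      by (intro sum.cong refl wclass) simp
    finally show ?thesis by simp
  qed
  have wB: "62500 * copies ?V ?B w = 40 * n ^ 6"
  proof -
    have "copies ?V ?B w = copies ?V (\<lambda>u v. adjacent C5 (\<kappa> u) (\<kappa> v)) w"
      by (rule copies_cong) (rule B)
    also have "\<dots> = copies {..<5} (adjacent C5) (\<lambda>i. \<Sum>v | v \<in> ?V \<and> \<kappa> v = i. w v)"
      by (rule copies_push[OF V \<kappa>5])
    also have "\<dots> = copies {..<5} (adjacent C5) (\<lambda>_. n / 5)"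
      by (rule copies_weight_cong) (simp add: wclass)
    also have "\<dots> = 10 * (n / 5) ^ 6"
      using n0 by (intro copies_C5_uniform) simp
    finally show ?thesis by (simp add: power_divide)
  qed
  have wA: "62500 * copies ?V ?A w + 17 * M \<le> 40 * n ^ 6"
  proof -
    have "17 / 18 * M \<le> path_sum ?V ?A w (misfits ?V ?A w)"
      unfolding M_def path_sum_misfits wsum_def sum_distrib_left
    proof (rule sum_mono)
      fix x :: "ix \<Rightarrow> nat"
      have "17 / 18 \<le> (\<Prod>i\<in>UNIV. w (x i))" using prod[of x] by linarith
      then show "17 / 18 * ((\<Prod>i\<in>(UNIV :: ix set). 1) * of_bool (path_at ?A (x I0) (x I1) (x I2) (x I3)
          \<and> misfit (role ?A (x I0) (x I1) (x I2) (x I3) (x I4)) (role ?A (x I0) (x I1) (x I2) (x I3) (x I5)) (?A (x I4) (x I5))))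
        \<le> (\<Prod>i\<in>UNIV. w (x i)) * of_bool (path_at ?A (x I0) (x I1) (x I2) (x I3)
          \<and> misfit (role ?A (x I0) (x I1) (x I2) (x I3) (x I4)) (role ?A (x I0) (x I1) (x I2) (x I3) (x I5)) (?A (x I4) (x I5)))"
        by (simp add: of_bool_def)
    qed
    also have "18 * path_sum ?V ?A w (misfits ?V ?A w) \<le> path_sum ?V ?A w (\<lambda>a b c d. imbalance ?V ?A w a b c d + 18 * misfits ?V ?A w a b c d)"
      unfolding path_sum_cmult[symmetric] by (rule path_sum_mono[OF w0]) (simp add: imbalance_nonneg)
    finally show ?thesis
      using flag_inequality[where V = ?V and w = w and A = ?A, OF w0 adjacent_commute irrA] unfolding wsumV by linarith
  qed

  \<comment> \<open>Back to counting measure; the gain from the misfits outweighs all errors.\<close>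
  have "s * n ^ 4 \<le> 250 * 62500 * (real (card (embeddings ?V ?B)) - real (card (embeddings ?V ?A)))"
  proof -
    define T where "T = copies ?V ?B (\<lambda>_. 1) - copies ?V ?A (\<lambda>_. 1)"
    have 1: "17 * (39 / 62500 * (n ^ 4 * m)) \<le> 62500 * (copies ?V ?B w - copies ?V ?A w)"
      using wA wB mM by (simp add: right_diff_distrib)
    have 2: "(copies ?V ?B w - copies ?V ?A w) - T \<le> 1 / 1000000000 * (36 * (s * n ^ 4))"
      using copies_reweighting[where V = ?V and A = ?A and B = ?B and w = w and \<theta> = "1 / 1000000000", OF V irrA irrB _ prod]
      unfolding T_def s_def n(1) by simp
    have 3: "T - (real (card (embeddings ?V ?B)) - real (card (embeddings ?V ?A))) \<le> 1296 * (s * n ^ 3)"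
      using embeddings_difference[where V = ?V and A = ?A and B = ?B, OF V irrA irrB]
      unfolding T_def s_def n(1) by simp
    have 4: "100000000000 * (s * n ^ 3) \<le> s * n ^ 4"
    proof -
      have "100000000000 * (s * n ^ 3) \<le> n * (s * n ^ 3)"
        using n(2) n0 s0 by (intro mult_right_mono) simp_all
      then show ?thesis by (simp add: eval_nat_numeral mult_ac)
    qed
    have 5: "s * n ^ 4 \<le> n ^ 4 * m"
      unfolding mult.commute[of s] using sm n0 by (intro mult_left_mono) simp_all
    have 6: "0 \<le> s * n ^ 4" using s0 n0 by simp
    have "x \<le> 250 * 62500 * e"
      if "17 * (39 / 62500 * z) \<le> 62500 * d" "d - t \<le> 1 / 1000000000 * (36 * x)" "t - e \<le> 1296 * u"
        "100000000000 * u \<le> x" "x \<le> z" "0 \<le> x" for x z d t e u :: real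
      using that by linarith
    from this[OF 1 2 3 4 5 6] show ?thesis .
  qed
  then show thesis
    unfolding s_def by (rule that[OF P VP])
qed

lemma edit_distance_le:
  fixes G :: "nat pattern" and P :: "nat \<Rightarrow> nat set"
  assumes G: "is_graph G" and P: "blowup_parts C5 P" and VP: "verts (blowup C5 P) = verts G"
  shows "edit_distance G C5 \<le> card (disagreement (verts G) (adjacent G) (adjacent (blowup C5 P)))"
proof -
  note V = graph_adjacent(1)[OF G]
  let ?H = "blowup C5 P" and ?S = "disagreement (verts G) (adjacent G) (adjacent (blowup C5 P))"
  let ?D = "\<lambda>H. (edges G - edges H) \<union> (edges H - edges G)"
  let ?\<H> = "\<lambda>H. is_graph H \<and> verts H = verts G \<and> (\<exists>H' \<in> (blowups C5 :: nat pattern set). isomorphic H H')"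
  have H: "is_graph ?H" by (rule is_graph_blowup[OF P])
  have edges_sub: "edges H \<subseteq> Pow (verts G)" if "is_graph H" "verts H = verts G" for H :: "nat pattern"
    using that by (auto simp: is_graph_def is_pattern_def)
  have "finite {card (?D H) |H. ?\<H> H}"
  proof (rule finite_subset)
    show "{card (?D H) |H. ?\<H> H} \<subseteq> {..card (Pow (verts G))}"
    proof
      fix k assume "k \<in> {card (?D H) |H. ?\<H> H}"
      then obtain H :: "nat pattern" where H: "is_graph H" "verts H = verts G" "k = card (?D H)" by blast
      then have "?D H \<subseteq> Pow (verts G)" using edges_sub[of H] edges_sub[OF G] by auto
      then have "card (?D H) \<le> card (Pow (verts G))" using V by (intro card_mono) simp_all
      then show "k \<in> {..card (Pow (verts G))}" by (simp only: H(3) atMost_iff)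
    qed
  qed simp
  moreover have "card (?D ?H) \<in> {card (?D H) |H. ?\<H> H}"
  proof -
    have "?H \<in> blowups C5" using P by (auto simp: blowups_def)
    moreover have "isomorphic ?H ?H" unfolding isomorphic_def is_iso_def by (intro exI[of _ id]) simp
    ultimately show ?thesis using H VP by blast
  qed
  ultimately have "edit_distance G C5 \<le> card (?D ?H)"
    unfolding edit_distance_def by (rule Min_le)
  also have "\<dots> \<le> card ((\<lambda>(u, v). {u, v}) ` ?S)"
  proof (rule card_mono)
    show "finite ((\<lambda>(u, v). {u, v}) ` ?S)" by (intro finite_imageI finite_disagreement V)
    show "?D ?H \<subseteq> (\<lambda>(u, v). {u, v}) ` ?S"
    proof
      fix e assume e: "e \<in> ?D ?H"
      then obtain u v where "e = {u, v}" "u \<in> verts G" "v \<in> verts G"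
        using G H VP by (auto simp: is_graph_def is_pattern_def)
      then show "e \<in> (\<lambda>(u, v). {u, v}) ` ?S"
        using e by (intro image_eqI[of _ _ "(u, v)"]) (auto simp: disagreement_def)
    qed
  qed
  also have "\<dots> \<le> card ?S" by (intro card_image_le finite_disagreement V)
  finally show ?thesis .
qed

text \<open>The graph without edges is a blowup with a single nonempty part.\<close>

lemma edit_distance_le_square:
  fixes G :: "nat pattern"
  assumes G: "is_graph G"
  shows "edit_distance G C5 \<le> (card (verts G))\<^sup>2"
proof -
  note V = graph_adjacent(1)[OF G]
  define P where "P i = (if i = 0 then verts G else {})" for i :: nat
  have P: "blowup_parts C5 P"
    using V by (auto simp: blowup_parts_def disjoint_family_on_def P_def)
  have "verts (blowup C5 P) = verts G"
    unfolding verts_blowup[OF P] by (auto simp: P_def split: if_splits intro!: bexI[of _ 0])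
  then have "edit_distance G C5 \<le> card (disagreement (verts G) (adjacent G) (adjacent (blowup C5 P)))"
    by (rule edit_distance_le[OF G P])
  also have "\<dots> \<le> card (verts G \<times> verts G)"
    using V by (intro card_mono) (auto simp: disagreement_def)
  finally show ?thesis by (simp add: card_cartesian_product power2_eq_square)
qed

lemma near_extremal_edit_distance:
  fixes G :: "nat pattern"
  assumes G: "is_graph G" and n: "n = real (card (verts G))" "10 ^ 11 \<le> n"
    and near: "(40 - 1 / 10 ^ 36) * n ^ 6 \<le> 62500 * copies (verts G) (adjacent G) (\<lambda>_. 1)"
  shows "real (edit_distance G C5) \<le> 90000 * (max_density F38 (card (verts G)) - density F38 G) * n\<^sup>2"
proof -
  obtain P where P: "blowup_parts C5 P" and VP: "verts (blowup C5 P) = verts G"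
    and gain: "real (card (disagreement (verts G) (adjacent G) (adjacent (blowup C5 P)))) * n ^ 4 \<le> 250 * 62500 *
      (real (card (embeddings (verts G) (adjacent (blowup C5 P)))) - real (card (embeddings (verts G) (adjacent G))))"
    by (rule near_extremal[OF G n near])
  let ?H = "blowup C5 P"
  define N where "N = 4 * real (card (verts G) choose 6)"
  define gap where "gap = max_density F38 (card (verts G)) - density F38 G"
  have n0: "0 < n" using n(2) by (rule less_le_trans[rotated]) simp
  have "10 ^ 11 \<le> card (verts G)"
    using n by (metis of_nat_le_iff of_nat_numeral of_nat_power)
  then have "6 \<le> card (verts G)" by (rule order_trans[rotated]) simp
  then have N0: "0 < N" by (simp add: N_def)
  have N: "180 * N \<le> n ^ 6"
  proof -
    have "fact 6 * (card (verts G) choose 6) \<le> card (verts G) ^ 6"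
      using binomial_fact_pow[of "card (verts G)" 6] by (simp add: mult.commute)
    then have "real (fact 6 * (card (verts G) choose 6)) \<le> real (card (verts G) ^ 6)"
      by (rule of_nat_mono)
    then show ?thesis by (simp add: N_def n(1) fact_numeral)
  qed
  have gap0: "0 \<le> gap" unfolding gap_def using density_le_max[OF G] by simp
  have "real (card (embeddings (verts G) (adjacent ?H))) - real (card (embeddings (verts G) (adjacent G)))
      = N * (density F38 ?H - density F38 G)"
    using N0 unfolding density_F38[OF G] density_F38[OF is_graph_blowup[OF P]] VP N_def[symmetric]
    by (simp add: right_diff_distrib)
  also have "\<dots> \<le> N * gap"
    using density_le_max[OF is_graph_blowup[OF P], of F38] N0 by (simp add: gap_def VP)
  also have "\<dots> \<le> n ^ 6 / 180 * gap"
    using N by (intro mult_right_mono gap0) simp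
  finally have "250 * 62500 * (real (card (embeddings (verts G) (adjacent ?H))) - real (card (embeddings (verts G) (adjacent G))))
      \<le> 250 * 62500 * (n ^ 6 / 180 * gap)"
    by (rule mult_left_mono) simp
  then have "real (card (disagreement (verts G) (adjacent G) (adjacent ?H))) * n ^ 4 \<le> 250 * 62500 * (n ^ 6 / 180 * gap)"
    using gain by linarith
  also have "\<dots> \<le> 90000 * (n ^ 6 * gap)"
  proof -
    have "0 \<le> n ^ 6 * gap" using n0 gap0 by simp
    then show ?thesis by (simp add: mult.commute)
  qed
  also have "\<dots> = 90000 * gap * n\<^sup>2 * n ^ 4"
    by (simp add: eval_nat_numeral)
  finally have "real (card (disagreement (verts G) (adjacent G) (adjacent ?H))) \<le> 90000 * gap * n\<^sup>2"
    using n0 by (simp only: mult_le_cancel_right_pos zero_less_power)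
  then show ?thesis
    using edit_distance_le[OF G P VP] unfolding gap_def by linarith
qed

text \<open>If the weight of copies stays a fixed proportion below the bound, so does the density, and then \<open>n^2\<close> edits
are within the allowance once the constant is large. Otherwise \<open>near_extremal\<close> applies.\<close>

lemma perfectly_stable_C5: "perfectly_stable F38 C5"
proof -
  define \<delta> :: real where "\<delta> = 1 / 10 ^ 36"
  define q where "q n = real n ^ 6 / (4 * real (n choose 6))" for n
  have "(\<lambda>n. max_density F38 n - (40 - \<delta>) / 62500 * q n) \<longlonglongrightarrow> 72/625 - (40 - \<delta>) / 62500 * 180"
    unfolding q_def by (intro tendsto_intros max_density_limit power_over_binomial)
  moreover have "72/625 - (40 - \<delta>) / 62500 * 180 > 90 * \<delta> / 62500"
    by (simp add: \<delta>_def)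
  ultimately have "\<forall>\<^sub>F n in sequentially. 90 * \<delta> / 62500 < max_density F38 n - (40 - \<delta>) / 62500 * q n"
    by (rule order_tendstoD(1))
  then obtain n0 where far: "\<And>n. n0 \<le> n \<Longrightarrow> 90 * \<delta> / 62500 < max_density F38 n - (40 - \<delta>) / 62500 * q n"
    by (auto simp: eventually_sequentially)
  define C :: real where "C = max (max (real n0) (10 ^ 11)) (62500 / (90 * \<delta>))"
  have C: "real n0 \<le> C" "10 ^ 11 \<le> C" "62500 / (90 * \<delta>) \<le> C" by (simp_all add: C_def)
  have "0 < C" using C(2) by (rule less_le_trans[rotated]) simp
  moreover have "real (edit_distance G C5) \<le> C * (max_density F38 (card (verts G)) - density F38 G) * (real (card (verts G)))\<^sup>2"
    if G: "is_graph G" and large: "C \<le> real (card (verts G))" for G :: "nat pattern"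
  proof -
    define n where "n = card (verts G)"
    define gap where "gap = max_density F38 n - density F38 G"
    have gap0: "0 \<le> gap" unfolding gap_def n_def using density_le_max[OF G] by simp
    have n: "n0 \<le> n" "10 ^ 11 \<le> real n"
      using large C by (simp_all add: n_def)
    show ?thesis
    proof (cases "(40 - \<delta>) * real n ^ 6 \<le> 62500 * copies (verts G) (adjacent G) (\<lambda>_. 1)")
      case True
      then have "real (edit_distance G C5) \<le> 90000 * gap * (real n)\<^sup>2"
        using near_extremal_edit_distance[OF G refl] n(2) unfolding n_def \<delta>_def gap_def by simp
      also have "\<dots> \<le> C * gap * (real n)\<^sup>2"
        using C(2) gap0 by (intro mult_right_mono) simp_all
      finally show ?thesis by (simp add: gap_def n_def)
    next
      case False
      then have "real (card (embeddings (verts G) (adjacent G))) \<le> (40 - \<delta>) / 62500 * real n ^ 6"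
        using embeddings_le_copies[OF graph_adjacent(1)[OF G], of "adjacent G"] by (simp add: field_simps)
      then have "density F38 G \<le> (40 - \<delta>) / 62500 * q n"
        unfolding density_F38[OF G] q_def n_def times_divide_eq_right by (rule divide_right_mono) simp
      then have "90 * \<delta> / 62500 \<le> gap"
        using far[OF n(1)] unfolding gap_def by linarith
      then have "C * (90 * \<delta> / 62500) \<le> C * gap"
        using \<open>0 < C\<close> by simp
      moreover have "1 \<le> C * (90 * \<delta> / 62500)"
        using C(3) by (simp add: \<delta>_def field_simps)
      ultimately have "1 \<le> C * gap" by linarith
      then have "1 * (real n)\<^sup>2 \<le> C * gap * (real n)\<^sup>2"
        by (intro mult_right_mono) simp_all
      moreover have "real (edit_distance G C5) \<le> (real n)\<^sup>2"
        using edit_distance_le_square[OF G] unfolding n_def by (metis of_nat_le_iff of_nat_power)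
      ultimately show ?thesis unfolding gap_def n_def by linarith
    qed
  qed
  ultimately show ?thesis unfolding perfectly_stable_def by blast
qed

theorem theorem3p18:
  "convergent (max_density F38) \<and> inducibility F38 = 72/625
    \<and> perfectly_stable F38 C5
    \<and> unique_maximiser 5 F38 C5 (\<lambda>i. if i < 5 then 1/5 else 0)"
  using max_density_limit perfectly_stable_C5 unique_maximiser_C5
  by (auto simp: inducibility_def convergent_def limI)

end
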